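(* Let $X$ and $U$ be Hilbert spaces, let $\mathcal A$ be the infinitesimal generator of a $C_0$-semigroup $(e^{\mathcal A t})_{t\ge0}$ on $X$, and let $\mathcal B$ be an admissible input operator for $e^{\mathcal A t}$. If the system $\dot x=\mathcal A x+\mathcal B u$ is exactly null controllable in $X_{-1}$, then it is completely stabilizable by admissible feedback, and hence also by bounded feedback. That is, for every $\omega>0$ there are an admissible feedback $\mathcal F_\omega$ and a constant $M_\omega\ge1$ with $\Vert e^{(\mathcal A+\mathcal B\mathcal F_\omega)t}\Vert\le M_\omega e^{-\omega t}$ for all $t\ge0$, and likewise for every $\omega>0$ there are a bounded operator $\mathcal F\in\mathcal L(X,U)$ and a constant $M\ge1$ with $\Vert e^{(\mathcal A+\mathcal B\mathcal F)t}\Vert\le M e^{-\omega t}$ for all $t\ge0$.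
   Context: $X_1$ denotes $D(\mathcal A)$ endowed with the graph norm. $X_{-1}$ is the completion of $X$ with respect to the resolvent norm $\Vert x\Vert_{-1}=\Vert(\lambda I-\mathcal A)^{-1}x\Vert_X$, for a fixed $\lambda\in\rho(\mathcal A)$. One has $X_1\subset X\subset X_{-1}$ with continuous dense injections, and $e^{\mathcal A t}$ extends to a $C_0$-semigroup on $X_{-1}$, denoted by the same symbol. The system is exactly null controllable in $X_{-1}$ if for some $T>0$, for every $x_0\in X_{-1}$ there is $u\in L_2(0,T;U)$ with $e^{\mathcal A T}x_0+\int_0^T e^{\mathcal A(T-\tau)}\mathcal B u(\tau)\,d\tau=0$. Admissible input operator: a bounded linear operator $\mathcal B:U\to X$ is an admissible input operator for $e^{\mathcal A t}$ if there exist $t_1>0$ and $\beta>0$ such that for all $u\in L_2(0,t_1;U)$, $$\int_0^{t_1}e^{\mathcal A(t_1-\tau)}\mathcal B u(\tau)\,d\tau\in X_1,\qquad \left\Vert\int_0^{t_1}e^{\mathcal A(t_1-\tau)}\mathcal B u(\tau)\,d\tau\right\Vert_{X_1}\le\beta\Vert u\Vert_{L_2(0,t_1)} .$$ Admissible feedback: a linear operator $\mathcal F$, bounded from $X_1$ to $U$, such that there exist $t_1>0$ and $\alpha>0$ with $\Vert \mathcal F e^{\mathcal A(t_1-\cdot)}x\Vert_{L_2(0,t_1;U)}\le\alpha\Vert x\Vert_X$ for all $x\in X_1$. For an admissible input operator $\mathcal B$ and an admissible feedback $\mathcal F$, $e^{(\mathcal A+\mathcal B\mathcal F)t}$ denotes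 the perturbed semigroup, characterized by $$e^{(\mathcal A+\mathcal B\mathcal F)t}x=e^{\mathcal A t}x+\int_0^t e^{\mathcal A(t-\tau)}\mathcal B\mathcal F e^{(\mathcal A+\mathcal B\mathcal F)\tau}x\,d\tau,\qquad x\in X_1,$$ which extends to a $C_0$-semigroup on $X$ (a known fact for the Pritchard–Salamon class). The norms of the semigroups in the claim are operator norms on $X$. *)

theory Defs
  imports "HOL-Analysis.Analysis"
begin

section \<open>Scalars and bounded operators\<close>

text \<open>
  The scalar field \<open>\<K>\<close> is a type \<open>'k\<close> of class \<^class>\<open>real_normed_field\<close>. By the
  Mazur--Ostrowski theorem the only instances are, up to isometric isomorphism, \<open>\<real>\<close> and \<open>\<complex>\<close>,
  so both real and complex spaces are covered.

  A normed space over \<open>\<K>\<close> is a real normed space with a compatible scalar multiplication by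
  \<open>\<K>\<close>. A Hilbert space over \<open>\<K>\<close> is such a space whose type is in \<^class>\<open>real_inner\<close> and
  \<^class>\<open>complete_space\<close>. For \<open>\<K> = \<complex>\<close> the class inner product \<open>x \<bullet> y\<close> is the real part of the
  complex one: homogeneity of the norm makes multiplication by \<open>\<i>\<close> an isometry, and
  \<open>x \<bullet> y + \<i> (x \<bullet> \<i>y)\<close> is a complex inner product inducing the given norm.
\<close>

definition normed_space_over ::
    "('k::real_normed_field \<Rightarrow> 'x::real_normed_vector \<Rightarrow> 'x) \<Rightarrow> bool" where
  "normed_space_over sc \<longleftrightarrow>
     vector_space sc \<and>
     (\<forall>r x. sc (of_real r) x = r *\<^sub>R x) \<and>
     (\<forall>c x. norm (sc c x) = norm c * norm x)"

definition bounded_operator ::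
    "('k \<Rightarrow> 'x::real_normed_vector \<Rightarrow> 'x) \<Rightarrow> ('k \<Rightarrow> 'y::real_normed_vector \<Rightarrow> 'y) \<Rightarrow>
     ('x \<Rightarrow> 'y) \<Rightarrow> bool" where
  "bounded_operator scaleX scaleY f \<longleftrightarrow>
     bounded_linear f \<and> (\<forall>c x. f (scaleX c x) = scaleY c (f x))"


section \<open>Semigroups and generators\<close>

text \<open>A semigroup is a function on \<^typ>\<open>real\<close> of which only the values at \<open>t \<ge> 0\<close> matter.\<close>

definition C0_semigroup ::
    "('k \<Rightarrow> 'x::real_normed_vector \<Rightarrow> 'x) \<Rightarrow> (real \<Rightarrow> 'x \<Rightarrow> 'x) \<Rightarrow> bool" where
  "C0_semigroup sc T \<longleftrightarrow>
     (\<forall>t\<ge>0. bounded_operator sc sc (T t)) \<and>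
     (\<forall>x. T 0 x = x) \<and>
     (\<forall>s\<ge>0. \<forall>t\<ge>0. \<forall>x. T (s + t) x = T s (T t x)) \<and>
     (\<forall>x. ((\<lambda>t. T t x) \<longlongrightarrow> x) (at_right 0))"

definition gen_dom :: "(real \<Rightarrow> 'x::real_normed_vector \<Rightarrow> 'x) \<Rightarrow> 'x set" where
  "gen_dom T = {x. \<exists>y. ((\<lambda>h. (T h x - x) /\<^sub>R h) \<longlongrightarrow> y) (at_right 0)}"

definition gen :: "(real \<Rightarrow> 'x::real_normed_vector \<Rightarrow> 'x) \<Rightarrow> 'x \<Rightarrow> 'x" where
  "gen T x = Lim (at_right 0) (\<lambda>h. (T h x - x) /\<^sub>R h)"

definition graph_norm :: "('x::real_normed_vector \<Rightarrow> 'x) \<Rightarrow> 'x \<Rightarrow> real" where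
  "graph_norm A x = norm x + norm (A x)"

abbreviation norm_X1 :: "(real \<Rightarrow> 'x::real_normed_vector \<Rightarrow> 'x) \<Rightarrow> 'x \<Rightarrow> real" where
  "norm_X1 T \<equiv> graph_norm (gen T)"

definition resolvent ::
    "('k \<Rightarrow> 'x::real_normed_vector \<Rightarrow> 'x) \<Rightarrow> 'x set \<Rightarrow> ('x \<Rightarrow> 'x) \<Rightarrow> 'k \<Rightarrow> 'x \<Rightarrow> 'x" where
  "resolvent sc D A l = inv_into D (\<lambda>x. sc l x - A x)"

definition resolvent_set ::
    "('k \<Rightarrow> 'x::real_normed_vector \<Rightarrow> 'x) \<Rightarrow> 'x set \<Rightarrow> ('x \<Rightarrow> 'x) \<Rightarrow> 'k set" where
  "resolvent_set sc D A =
     {l. bij_betw (\<lambda>x. sc l x - A x) D UNIV \<and>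
         bounded_operator sc sc (resolvent sc D A l)}"


section \<open>The extrapolation space\<close>

text \<open>
  Completions are unique up to isometric isomorphism but live on a new carrier, so a completion
  is given by a Banach space type \<open>'y\<close> and an embedding of \<open>'x\<close> into it, isometric for the norm
  \<open>nrm\<close> on \<open>'x\<close> (in general weaker than the norm of the type) and with dense range.
\<close>

definition is_completion ::
    "('k::real_normed_field \<Rightarrow> 'x::real_normed_vector \<Rightarrow> 'x) \<Rightarrow> ('x \<Rightarrow> real) \<Rightarrow>
     ('k \<Rightarrow> 'y::banach \<Rightarrow> 'y) \<Rightarrow> ('x \<Rightarrow> 'y) \<Rightarrow> bool" where
  "is_completion scaleX nrm scaleY emb \<longleftrightarrow>
     normed_space_over scaleY \<and>
     (\<forall>x x'. emb (x + x') = emb x + emb x') \<and>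
     (\<forall>c x. emb (scaleX c x) = scaleY c (emb x)) \<and>
     (\<forall>x. norm (emb x) = nrm x) \<and>
     closure (range emb) = UNIV"

definition extrapolation_space ::
    "('k::real_normed_field \<Rightarrow> 'x::real_normed_vector \<Rightarrow> 'x) \<Rightarrow> (real \<Rightarrow> 'x \<Rightarrow> 'x) \<Rightarrow> 'k \<Rightarrow>
     ('k \<Rightarrow> 'y::banach \<Rightarrow> 'y) \<Rightarrow> ('x \<Rightarrow> 'y) \<Rightarrow> bool" where
  "extrapolation_space scaleX T l scaleY emb \<longleftrightarrow>
     is_completion scaleX (\<lambda>x. norm (resolvent scaleX (gen_dom T) (gen T) l x)) scaleY emb"

text \<open>By density of the range of \<open>emb\<close>, the extension is unique for \<open>t \<ge> 0\<close>.\<close>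

definition semigroup_extension ::
    "('k \<Rightarrow> 'y::real_normed_vector \<Rightarrow> 'y) \<Rightarrow> ('x \<Rightarrow> 'y) \<Rightarrow>
     (real \<Rightarrow> 'x \<Rightarrow> 'x) \<Rightarrow> (real \<Rightarrow> 'y \<Rightarrow> 'y) \<Rightarrow> bool" where
  "semigroup_extension scaleY emb T S \<longleftrightarrow>
     C0_semigroup scaleY S \<and> (\<forall>t\<ge>0. \<forall>x. S t (emb x) = emb (T t x))"


section \<open>Square-integrable inputs\<close>

text \<open>
  The spaces need not be separable, so measurability is Bochner's strong measurability, and
  vector-valued integrals are Henstock--Kurzweil integrals (the library's Bochner integral is
  restricted to second-countable types). On Bochner integrable functions the two integrals
  agree, and all integrands below are Bochner integrable.
\<close>

definition L2 :: "real \<Rightarrow> (real \<Rightarrow> 'u::real_normed_vector) set" where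
  "L2 T = {u. (\<exists>s. (\<forall>n. simple_function (lebesgue_on {0..T}) (s n)) \<and>
                 (AE t in lebesgue_on {0..T}. (\<lambda>n. s n t) \<longlonglongrightarrow> u t)) \<and>
              integrable (lebesgue_on {0..T}) (\<lambda>t. (norm (u t))\<^sup>2)}"

definition L2_norm :: "real \<Rightarrow> (real \<Rightarrow> 'u::real_normed_vector) \<Rightarrow> real" where
  "L2_norm T u = sqrt (LINT t|lebesgue_on {0..T}. (norm (u t))\<^sup>2)"


section \<open>Admissibility, controllability and feedback\<close>

definition admissible_input ::
    "('k \<Rightarrow> 'u::real_normed_vector \<Rightarrow> 'u) \<Rightarrow> ('k \<Rightarrow> 'x::real_normed_vector \<Rightarrow> 'x) \<Rightarrow>
     (real \<Rightarrow> 'x \<Rightarrow> 'x) \<Rightarrow> ('u \<Rightarrow> 'x) \<Rightarrow> bool" where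
  "admissible_input scaleU scaleX T B \<longleftrightarrow>
     bounded_operator scaleU scaleX B \<and>
     (\<exists>t1>0. \<exists>\<beta>>0. \<forall>u\<in>L2 t1.
        integral {0..t1} (\<lambda>\<tau>. T (t1 - \<tau>) (B (u \<tau>))) \<in> gen_dom T \<and>
        norm_X1 T (integral {0..t1} (\<lambda>\<tau>. T (t1 - \<tau>) (B (u \<tau>)))) \<le> \<beta> * L2_norm t1 u)"

text \<open>\<open>S\<close> is the extended semigroup on the extrapolation space, where the integral is taken.\<close>

definition exactly_null_controllable ::
    "(real \<Rightarrow> 'y::real_normed_vector \<Rightarrow> 'y) \<Rightarrow> ('x \<Rightarrow> 'y) \<Rightarrow>
     ('u::real_normed_vector \<Rightarrow> 'x) \<Rightarrow> bool" where
  "exactly_null_controllable S emb B \<longleftrightarrow>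
     (\<exists>t>0. \<forall>x0. \<exists>u\<in>L2 t. S t x0 + integral {0..t} (\<lambda>\<tau>. S (t - \<tau>) (emb (B (u \<tau>)))) = 0)"

text \<open>A feedback is defined on the domain of the generator; its values elsewhere are irrelevant.\<close>

definition admissible_feedback ::
    "('k \<Rightarrow> 'x::real_normed_vector \<Rightarrow> 'x) \<Rightarrow> ('k \<Rightarrow> 'u::real_normed_vector \<Rightarrow> 'u) \<Rightarrow>
     (real \<Rightarrow> 'x \<Rightarrow> 'x) \<Rightarrow> ('x \<Rightarrow> 'u) \<Rightarrow> bool" where
  "admissible_feedback scaleX scaleU T F \<longleftrightarrow>
     (\<forall>x\<in>gen_dom T. \<forall>y\<in>gen_dom T. F (x + y) = F x + F y) \<and>
     (\<forall>c. \<forall>x\<in>gen_dom T. F (scaleX c x) = scaleU c (F x)) \<and>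
     (\<exists>K. \<forall>x\<in>gen_dom T. norm (F x) \<le> K * norm_X1 T x) \<and>
     (\<exists>t1>0. \<exists>\<alpha>>0. \<forall>x\<in>gen_dom T.
        (\<lambda>\<tau>. F (T (t1 - \<tau>) x)) \<in> L2 t1 \<and>
        L2_norm t1 (\<lambda>\<tau>. F (T (t1 - \<tau>) x)) \<le> \<alpha> * norm x)"

text \<open>
  The integral equation presupposes that the perturbed semigroup maps \<open>X\<^sub>1\<close> into itself and that
  its orbits in \<open>X\<^sub>1\<close> are continuous for the graph norm, as in the Pritchard--Salamon class.
  (Boundedness on \<open>X\<^sub>1\<close> then follows from the closed graph theorem.) These conditions determine
  \<open>S\<close> on \<open>t \<ge> 0\<close> whenever \<open>B\<close> and \<open>F\<close> are admissible.
\<close>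

definition perturbed_semigroup ::
    "('k \<Rightarrow> 'x::real_normed_vector \<Rightarrow> 'x) \<Rightarrow> (real \<Rightarrow> 'x \<Rightarrow> 'x) \<Rightarrow>
     ('u \<Rightarrow> 'x) \<Rightarrow> ('x \<Rightarrow> 'u) \<Rightarrow> (real \<Rightarrow> 'x \<Rightarrow> 'x) \<Rightarrow> bool" where
  "perturbed_semigroup scaleX T B F S \<longleftrightarrow>
     C0_semigroup scaleX S \<and>
     (\<forall>t\<ge>0. \<forall>x\<in>gen_dom T. S t x \<in> gen_dom T) \<and>
     (\<forall>x\<in>gen_dom T. ((\<lambda>t. norm_X1 T (S t x - x)) \<longlongrightarrow> 0) (at_right 0)) \<and>
     (\<forall>t\<ge>0. \<forall>x\<in>gen_dom T.
        S t x = T t x + integral {0..t} (\<lambda>\<tau>. T (t - \<tau>) (B (F (S \<tau> x)))))"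

definition decays_at_rate :: "(real \<Rightarrow> 'x::real_normed_vector \<Rightarrow> 'x) \<Rightarrow> real \<Rightarrow> bool" where
  "decays_at_rate S \<omega> \<longleftrightarrow> (\<exists>M\<ge>1. \<forall>t\<ge>0. onorm (S t) \<le> M * exp (- \<omega> * t))"

definition completely_stabilizable_admissible ::
    "('k \<Rightarrow> 'x::real_normed_vector \<Rightarrow> 'x) \<Rightarrow> ('k \<Rightarrow> 'u::real_normed_vector \<Rightarrow> 'u) \<Rightarrow>
     (real \<Rightarrow> 'x \<Rightarrow> 'x) \<Rightarrow> ('u \<Rightarrow> 'x) \<Rightarrow> bool" where
  "completely_stabilizable_admissible scaleX scaleU T B \<longleftrightarrow>
     (\<forall>\<omega>>0. \<exists>F S. admissible_feedback scaleX scaleU T F \<and>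
        perturbed_semigroup scaleX T B F S \<and> decays_at_rate S \<omega>)"

definition completely_stabilizable_bounded ::
    "('k \<Rightarrow> 'x::real_normed_vector \<Rightarrow> 'x) \<Rightarrow> ('k \<Rightarrow> 'u::real_normed_vector \<Rightarrow> 'u) \<Rightarrow>
     (real \<Rightarrow> 'x \<Rightarrow> 'x) \<Rightarrow> ('u \<Rightarrow> 'x) \<Rightarrow> bool" where
  "completely_stabilizable_bounded scaleX scaleU T B \<longleftrightarrow>
     (\<forall>\<omega>>0. \<exists>F S. bounded_operator scaleX scaleU F \<and>
        perturbed_semigroup scaleX T B F S \<and> decays_at_rate S \<omega>)"

end

theory Submission
  imports Defs
begin

text \<open>
  A bounded feedback is admissible, so it suffices to stabilize by bounded feedback. Restricting
  the controllability hypothesis to initial states in \<open>X\<close> and using that the embedding into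
  \<open>X\<^sub>-\<^sub>1\<close> is injective gives null controllability in \<open>X\<close> by the bounded input operator \<open>B\<close>, which
  persists for the shifted semigroup \<open>e\<^sup>\<omega>\<^sup>t T(t)\<close>. For the latter, consider the value function \<open>V\<close> of
  the linear-quadratic problem \<open>\<integral> |y|\<^sup>2 + |u|\<^sup>2\<close> over piecewise constant controls of finite duration, with a
  terminal penalty \<open>K |y|\<^sup>2\<close>. By Baire's theorem, null controllability gives controls whose energy is
  bounded by a multiple of \<open>|x|\<^sup>2\<close> and which steer \<open>x\<close> arbitrarily close to \<open>0\<close>; hence for
  large \<open>K\<close> a control can be prolonged at no cost to any sufficiently long duration. So \<open>V\<close>
  satisfies the dynamic programming principle and the parallelogram law, and it is a bounded
  quadratic form \<open>\<langle>Qx, x\<rangle>\<close>.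

  No minimizer is needed. Dynamic programming yields \<open>|V(x) - V(T(t)x)| \<le> C t |x|\<^sup>2\<close>, which makes
  \<open>T(s)\<^sup>* Q x\<close> continuous at \<open>s = 0\<close>, and completing squares along near-optimal controls on \<open>[0, t]\<close>
  then gives \<open>V(S(t)x) \<le> V(x) - t |x|\<^sup>2 + o(t)\<close> for the semigroup \<open>S\<close> of the closed loop with
  feedback \<open>F = - B\<^sup>* Q\<close>. A Dini derivative argument bounds \<open>\<integral> |S(t)x|\<^sup>2 dt\<close> by \<open>V(x)\<close>,
  so \<open>S\<close> is bounded, and undoing the shift gives the decay rate \<open>\<omega>\<close>.
\<close>

section \<open>Banach spaces and strongly continuous semigroups\<close>

text \<open>Finite lists of pieces can be concatenated, cut and refined exactly, and no limit of
  controls is ever formed; this is why near-optimal controls have to carry the whole argument. The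
  price is that an L2 control must be approximated, so that the origin is reached only up to an
  error. The terminal penalty absorbs this error and takes the place of both an end point constraint
  and an infinite horizon. The main obstacle is a first-order expansion at states outside the domain
  of the generator, where T(t)x - x is not O(t). Hence S(t)x is compared with T(t)x and not with x:
  the difference is t B F x + o(t) for every x. Likewise the cross terms of V are handled by testing
  against the functional b x, since T(s) need not approach the identity in operator norm. All
  constructions use the real inner product. Linearity of F over the scalar field is recovered at the
  end from V(cx) = |c|^2 V(x).\<close>

lemma Baire_closed_cover:
  fixes C :: "nat \<Rightarrow> 'a::complete_space set"
  assumes "\<And>n. closed (C n)" and "(\<Union>n. C n) = UNIV"
  obtains n x e where "e > 0" "ball x e \<subseteq> C n"
proof -
  have "\<exists>n. interior (C n) \<noteq> {}"
  proof (rule ccontr)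
    assume "\<not> ?thesis"
    then have *: "interior (C n) = {}" for n by blast
    have "Met_TC.mtopology interior_of (\<Union>(range C)) = {}"
      by (rule Met_TC.metric_Baire_category_alt)
        (use assms(1) * complete_UNIV in auto)
    then show False using assms(2) by simp
  qed
  then obtain n x where "x \<in> interior (C n)" by blast
  then obtain e where "e > 0" "ball x e \<subseteq> C n" by (auto simp: mem_interior)
  then show ?thesis using that by blast
qed

lemma linear_bound_from_ball:
  assumes "linear f" and "e > 0" and "\<And>z. norm z < e \<Longrightarrow> norm (f z) \<le> c"
  shows "norm (f x) \<le> (2 * c / e) * norm x"
proof (cases "x = 0")
  case True
  then show ?thesis using linear_0[OF assms(1)] by simp
next
  case False
  \<comment> \<open>The factor 1/2 brings \<open>x\<close> to norm \<open>e / 2\<close>, strictly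
    inside the open ball.\<close>
  let ?r = "e / (2 * norm x)"
  have "norm (f (?r *\<^sub>R x)) \<le> c"
    using False assms(2) by (intro assms(3)) auto
  then have "?r * norm (f x) \<le> c"
    using assms(2) by (simp add: linear_cmul[OF assms(1)])
  then show ?thesis using False assms(2) by (simp add: field_simps)
qed

text \<open>Banach-Steinhaus. The ball on which all \<open>f i\<close> are bounded by
  \<open>n\<close> need not be centred at 0; subtracting the value at its centre moves it there and
  doubles the bound.\<close>

lemma uniform_boundedness:
  fixes f :: "'i \<Rightarrow> 'a::{real_normed_vector,complete_space} \<Rightarrow> 'b::real_normed_vector"
  assumes bl: "\<And>i. i \<in> I \<Longrightarrow> bounded_linear (f i)"
    and pw: "\<And>x. \<exists>C. \<forall>i\<in>I. norm (f i x) \<le> C"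
  shows "\<exists>C. \<forall>i\<in>I. \<forall>x. norm (f i x) \<le> C * norm x"
proof -
  define C where "C n = {x. \<forall>i\<in>I. norm (f i x) \<le> real n}" for n
  have "C n = (\<Inter>i\<in>I. {x. norm (f i x) \<le> real n})" for n
    by (auto simp: C_def)
  moreover have "closed {x. norm (f i x) \<le> real n}" if "i \<in> I" for i n
    by (intro closed_Collect_le continuous_intros bounded_linear.continuous_on[OF bl[OF that]])
  ultimately have "closed (C n)" for n by auto
  moreover have "(\<Union>n. C n) = UNIV"
  proof -
    have "\<exists>n. x \<in> C n" for x
    proof -
      obtain c where c: "\<forall>i\<in>I. norm (f i x) \<le> c" using pw by blast
      obtain n where "c \<le> real n" using real_arch_simple by blast
      with c show ?thesis unfolding C_def by (auto intro: order_trans)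
    qed
    then show ?thesis by blast
  qed
  ultimately obtain n x0 e where e: "e > 0" "ball x0 e \<subseteq> C n"
    using Baire_closed_cover by metis
  have "norm (f i x) \<le> (2 * (2 * real n) / e) * norm x" if "i \<in> I" for i x
  proof (rule linear_bound_from_ball)
    show "linear (f i)" using bl[OF that] by (rule bounded_linear.linear)
    fix z :: 'a assume "norm z < e"
    then have "x0 + z \<in> C n" "x0 \<in> C n"
      using e by (auto simp: subset_eq dist_norm)
    then have "norm (f i (x0 + z)) \<le> n" "norm (f i x0) \<le> n"
      using that by (auto simp: C_def)
    moreover have "f i z = f i (x0 + z) - f i x0"
      using bounded_linear.linear[OF bl[OF that]] by (simp add: linear_add)
    ultimately show "norm (f i z) \<le> 2 * real n"
      using norm_triangle_ineq4[of "f i (x0 + z)" "f i x0"] by simp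
  qed (use e in auto)
  then show ?thesis by blast
qed

section \<open>Local boundedness and joint strong continuity of a semigroup\<close>

locale strongly_continuous_semigroup =
  fixes T :: "real \<Rightarrow> 'x::{real_normed_vector,complete_space} \<Rightarrow> 'x"
  assumes C0: "C0_semigroup (*\<^sub>R) T"
begin

lemma bounded_linear_T: "0 \<le> t \<Longrightarrow> bounded_linear (T t)"
  and T_zero: "T 0 x = x"
  and T_add: "0 \<le> s \<Longrightarrow> 0 \<le> t \<Longrightarrow> T (s + t) x = T s (T t x)"
  and T_tendsto: "((\<lambda>t. T t x) \<longlongrightarrow> x) (at_right 0)"
  using C0 by (auto simp: C0_semigroup_def bounded_operator_def)

lemma linear_T: "0 \<le> t \<Longrightarrow> linear (T t)"
  using bounded_linear_T by (rule bounded_linear.linear)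

lemma T_plus: "0 \<le> t \<Longrightarrow> T t (x + y) = T t x + T t y"
  and T_diff: "0 \<le> t \<Longrightarrow> T t (x - y) = T t x - T t y"
  and T_scaleR: "0 \<le> t \<Longrightarrow> T t (r *\<^sub>R x) = r *\<^sub>R T t x"
  and T_of_zero: "0 \<le> t \<Longrightarrow> T t 0 = 0"
  using linear_T by (auto simp: linear_add linear_diff linear_cmul linear_0)

text \<open>If the operator norms were unbounded near 0, there would be times \<open>t n\<close>
  tending to 0 at which they exceed \<open>n\<close>, although every orbit converges along these
  times; uniform boundedness excludes this.\<close>

lemma T_bounded_near_zero:
  obtains d M where "d > 0" "M \<ge> 1" "\<And>t x. t \<in> {0..d} \<Longrightarrow> norm (T t x) \<le> M * norm x"
proof -
  have "\<exists>n. \<forall>t\<in>{0..1 / real (Suc n)}. \<forall>x. norm (T t x) \<le> real n * norm x"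
  proof (rule ccontr)
    assume "\<not> ?thesis"
    then have "\<forall>n. \<exists>t. t \<in> {0..1 / real (Suc n)} \<and> (\<exists>x. norm (T t x) > real n * norm x)"
      by (metis not_le)
    then obtain t where t: "\<And>n. t n \<in> {0..1 / real (Suc n)}"
      and nb: "\<And>n. \<exists>x. norm (T (t n) x) > real n * norm x" by metis
    have t0: "t \<longlonglongrightarrow> 0"
      by (rule tendsto_sandwich[OF _ _ tendsto_const LIMSEQ_inverse_real_of_nat])
        (use t in \<open>auto intro!: always_eventually simp: field_simps\<close>)
    have "\<exists>C. \<forall>n\<in>UNIV. norm (T (t n) x) \<le> C" for x
    proof -
      \<comment> \<open>Some \<open>t n\<close> may be 0, so a limit from the right is not enough:
        the even extension turns it into continuity at 0, value included.\<close>
      have "isCont (\<lambda>s. T \<bar>s\<bar> x) 0"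
      proof -
        have "filterlim abs (at_right 0) (at (0::real))"
          unfolding filterlim_at by (auto intro!: tendsto_eq_intros simp: eventually_at_filter)
        then have "((\<lambda>s. T \<bar>s\<bar> x) \<longlongrightarrow> x) (at 0)"
          using T_tendsto[of x] by (rule filterlim_compose[rotated])
        then show ?thesis by (simp add: isCont_def T_zero)
      qed
      then have "(\<lambda>n. T \<bar>t n\<bar> x) \<longlonglongrightarrow> T \<bar>0\<bar> x"
        using t0 by (rule isCont_tendsto_compose)
      then have "Bseq (\<lambda>n. T \<bar>t n\<bar> x)" by (blast intro: convergentI convergent_imp_Bseq)
      then show ?thesis using t by (auto simp: Bseq_def)
    qed
    then obtain C where C: "\<And>n x. norm (T (t n) x) \<le> C * norm x"
      using uniform_boundedness[of UNIV "\<lambda>n. T (t n)"] bounded_linear_T t by auto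
    obtain n where n: "C \<le> real n" using real_arch_simple by blast
    obtain x where "norm (T (t n) x) > real n * norm x" using nb by blast
    moreover have "C * norm x \<le> real n * norm x" using n by (simp add: mult_right_mono)
    ultimately show False using C[of n x] by linarith
  qed
  then obtain n where n: "\<And>t x. t \<in> {0..1 / real (Suc n)} \<Longrightarrow> norm (T t x) \<le> real n * norm x"
    by blast
  show ?thesis
  proof (rule that[of "1 / real (Suc n)" "real (Suc n)"])
    fix t x assume "t \<in> {0..1 / real (Suc n)}"
    then show "norm (T t x) \<le> real (Suc n) * norm x"
      using n[of t x] by (smt (verit) mult_right_mono norm_ge_zero of_nat_Suc)
  qed auto
qed

lemma T_bounded_on_interval:
  obtains M where "M \<ge> 1" "\<And>t x. t \<in> {0..b} \<Longrightarrow> norm (T t x) \<le> M * norm x"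
proof -
  obtain d M where d: "d > 0" "M \<ge> 1" and M: "\<And>t x. t \<in> {0..d} \<Longrightarrow> norm (T t x) \<le> M * norm x"
    using T_bounded_near_zero by blast
  have *: "norm (T t x) \<le> M ^ Suc n * norm x" if "0 \<le> t" "t \<le> real (Suc n) * d" for n t x
    using that
  proof (induction n arbitrary: t x)
    case 0
    then show ?case using M by simp
  next
    case (Suc n)
    show ?case
    proof (cases "t \<le> d")
      case True
      then have "norm (T t x) \<le> M * norm x" using M Suc.prems by simp
      also have "\<dots> \<le> M ^ Suc (Suc n) * norm x"
        using d(2) power_increasing[of 1 "Suc (Suc n)" M] by (intro mult_right_mono) auto
      finally show ?thesis .
    next
      case False
      have "T t x = T d (T (t - d) x)" using T_add[of d "t - d"] False d by simp
      then have "norm (T t x) \<le> M * norm (T (t - d) x)" using M d by simp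
      also have "\<dots> \<le> M * (M ^ Suc n * norm x)"
        using Suc.IH[of "t - d" x] Suc.prems False d by (intro mult_left_mono) (auto simp: algebra_simps)
      finally show ?thesis by (simp add: mult.assoc)
    qed
  qed
  obtain n where "b / d \<le> real n" using real_arch_simple by blast
  then have "b \<le> real n * d" using d by (simp add: field_simps)
  then have n: "b \<le> real (Suc n) * d" using d by (simp add: algebra_simps)
  show ?thesis
  proof (rule that[of "M ^ Suc n"])
    show "1 \<le> M ^ Suc n" using d by (simp add: one_le_power del: power_Suc)
    fix t x assume "t \<in> {0..b}"
    then show "norm (T t x) \<le> M ^ Suc n * norm x" using *[of t n x] n by auto
  qed
qed

lemma continuous_on_orbit: "continuous_on {0..} (\<lambda>t. T t x)"
proof -
  have "((\<lambda>s. T s x) \<longlongrightarrow> T t x) (at t within {0..})" if t: "t \<ge> 0" for t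
  proof -
    obtain M where M: "M \<ge> 1" "\<And>r y. r \<in> {0..t + 1} \<Longrightarrow> norm (T r y) \<le> M * norm y"
      using T_bounded_on_interval by blast
    \<comment> \<open>Increments to either side reduce to an increment at time 0 by factoring out
      \<open>T\<close> at the earlier time. For \<open>s < t\<close> the factored operator varies
      with \<open>s\<close>, hence the bound uniform on an interval.\<close>
    have est: "norm (T s x - T t x) \<le> M * norm (T \<bar>s - t\<bar> x - x)" if "s \<ge> 0" "s \<le> t + 1" for s
    proof (cases "s \<le> t")
      case True
      have "T t x = T s (T (t - s) x)" using T_add[of s "t - s"] that True by simp
      then have "T s x - T t x = - T s (T (t - s) x - x)" using that by (simp add: T_diff)
      then show ?thesis using M(2)[of s "T (t - s) x - x"] that True t by (simp add: abs_minus_commute)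
    next
      case False
      have "T s x = T t (T (s - t) x)" using T_add[of t "s - t"] that False t by simp
      then have "T s x - T t x = T t (T (s - t) x - x)" using t by (simp add: T_diff)
      then show ?thesis using M(2)[of t] that False t by simp
    qed
    have "((\<lambda>s. T \<bar>s - t\<bar> x) \<longlongrightarrow> x) (at t within {0..})"
    proof (rule filterlim_compose[OF T_tendsto])
      show "filterlim (\<lambda>s. \<bar>s - t\<bar>) (at_right 0) (at t within {0..})"
        unfolding filterlim_at by (auto intro!: tendsto_eq_intros simp: eventually_at_filter)
    qed
    then have "((\<lambda>s. M * norm (T \<bar>s - t\<bar> x - x)) \<longlongrightarrow> 0) (at t within {0..})"
      by (auto intro!: tendsto_eq_intros)
    moreover have "\<forall>\<^sub>F s in at t within {0..}. norm (T s x - T t x) \<le> M * norm (T \<bar>s - t\<bar> x - x)"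
      unfolding eventually_at by (rule exI[of _ 1]) (auto intro!: est simp: dist_real_def)
    ultimately have "((\<lambda>s. T s x - T t x) \<longlongrightarrow> 0) (at t within {0..})"
      by (rule Lim_null_comparison[rotated])
    then show ?thesis by (simp add: LIM_zero_iff)
  qed
  then show ?thesis by (auto simp: continuous_on_def)
qed

text \<open>The change of the vector is controlled by the local bound on the operators, the change
  of time by the continuity of the single orbit of \<open>f p\<close>.\<close>

lemma continuous_on_T:
  assumes a: "continuous_on A a" and f: "continuous_on A f" and pos: "\<And>p. p \<in> A \<Longrightarrow> 0 \<le> a p"
  shows "continuous_on A (\<lambda>p. T (a p) (f p))"
  unfolding continuous_on_def
proof
  fix p assume p: "p \<in> A"
  let ?F = "at p within A"
  obtain M where M: "M \<ge> 1" "\<And>r y. r \<in> {0..a p + 1} \<Longrightarrow> norm (T r y) \<le> M * norm y"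
    using T_bounded_on_interval by blast
  have a': "(a \<longlongrightarrow> a p) ?F" and f': "(f \<longlongrightarrow> f p) ?F"
    using a f p by (auto simp: continuous_on_def)
  have "continuous_on A (\<lambda>q. T (a q) (f p))"
    by (rule continuous_on_compose2[OF continuous_on_orbit a]) (use pos in auto)
  then have 1: "((\<lambda>q. T (a q) (f p) - T (a p) (f p)) \<longlongrightarrow> 0) ?F"
    using p by (simp add: continuous_on_def LIM_zero_iff)
  have 2: "((\<lambda>q. T (a q) (f q - f p)) \<longlongrightarrow> 0) ?F"
  proof (rule Lim_null_comparison)
    show "((\<lambda>q. M * norm (f q - f p)) \<longlongrightarrow> 0) ?F"
      using f' by (auto intro!: tendsto_eq_intros)
    have "\<forall>\<^sub>F q in ?F. a q < a p + 1" using order_tendstoD(2)[OF a', of "a p + 1"] by simp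
    moreover have "\<forall>\<^sub>F q in ?F. q \<in> A" by (simp add: eventually_at_filter)
    ultimately show "\<forall>\<^sub>F q in ?F. norm (T (a q) (f q - f p)) \<le> M * norm (f q - f p)"
      by eventually_elim (use pos M in auto)
  qed
  have "((\<lambda>q. T (a q) (f q) - T (a p) (f p)) \<longlongrightarrow> 0) ?F"
  proof (rule Lim_transform_eventually[OF tendsto_add[OF 2 1, simplified]])
    have "\<forall>\<^sub>F q in ?F. q \<in> A" by (simp add: eventually_at_filter)
    then show "\<forall>\<^sub>F q in ?F. T (a q) (f q - f p) + (T (a q) (f p) - T (a p) (f p)) = T (a q) (f q) - T (a p) (f p)"
      by eventually_elim (use pos in \<open>simp add: T_diff\<close>)
  qed
  then show "((\<lambda>q. T (a q) (f q)) \<longlongrightarrow> T (a p) (f p)) ?F" by (simp add: LIM_zero_iff)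
qed

end

section \<open>Square-integrable inputs\<close>

text \<open>A real majorant \<open>g\<close> carries the squared L2 distance, so that the
  measurability of \<open>f - v\<close> need not be discussed.\<close>

definition L2_close :: "real \<Rightarrow> (real \<Rightarrow> 'a::real_normed_vector) \<Rightarrow> (real \<Rightarrow> 'a) \<Rightarrow> real \<Rightarrow> bool" where
  "L2_close t f v e \<longleftrightarrow>
     (\<exists>g. g integrable_on {0..t} \<and> (\<forall>s\<in>{0..t}. (norm (f s - v s))\<^sup>2 \<le> g s) \<and> integral {0..t} g \<le> e)"

definition L2_approximable :: "real \<Rightarrow> (real \<Rightarrow> 'a::real_normed_vector) \<Rightarrow> bool" where
  "L2_approximable t f \<longleftrightarrow> (\<forall>e>0. \<exists>v. continuous_on {0..t} v \<and> L2_close t f v e)"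

lemma norm_add_power2_le: "(norm (a + b))\<^sup>2 \<le> 2 * (norm a)\<^sup>2 + 2 * (norm b)\<^sup>2"
proof -
  have "(norm (a + b))\<^sup>2 \<le> (norm a + norm b)\<^sup>2" by (intro power_mono norm_triangle_ineq) auto
  also have "\<dots> \<le> 2 * (norm a)\<^sup>2 + 2 * (norm b)\<^sup>2"
    using zero_le_power2[of "norm a - norm b"] unfolding power2_diff power2_sum by linarith
  finally show ?thesis .
qed

lemma L2_close_add:
  assumes "L2_close t f v d" "L2_close t f' v' e"
  shows "L2_close t (\<lambda>s. f s + f' s) (\<lambda>s. v s + v' s) (2 * (d + e))"
proof -
  obtain g g' where g: "g integrable_on {0..t}" "\<forall>s\<in>{0..t}. (norm (f s - v s))\<^sup>2 \<le> g s" "integral {0..t} g \<le> d"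
    and g': "g' integrable_on {0..t}" "\<forall>s\<in>{0..t}. (norm (f' s - v' s))\<^sup>2 \<le> g' s" "integral {0..t} g' \<le> e"
    using assms unfolding L2_close_def by blast
  have "(norm (f s + f' s - (v s + v' s)))\<^sup>2 \<le> 2 * (g s + g' s)" if "s \<in> {0..t}" for s
    using norm_add_power2_le[of "f s - v s" "f' s - v' s"] g(2) g'(2) that
    by (fastforce simp: algebra_simps)
  then show ?thesis
    unfolding L2_close_def using g g'
    by (intro exI[of _ "\<lambda>s. 2 * (g s + g' s)"]) (auto simp: integral_add intro!: integrable_add integrable_on_mult_right)
qed

text \<open>In the sum of the pairs \<open>(f, v)\<close> and \<open>(v, w)\<close> the middle
  function cancels; the factor 2 is that of \<open>norm_add_power2_le\<close>, since distances are
  squared.\<close>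

lemma L2_close_trans:
  assumes "L2_close t f v d" "L2_close t v w e"
  shows "L2_close t f w (2 * (d + e))"
  using L2_close_add[OF assms] unfolding L2_close_def by (simp add: algebra_simps)

lemma L2_approximable_add:
  assumes "L2_approximable t f" "L2_approximable t f'"
  shows "L2_approximable t (\<lambda>s. f s + f' s)"
  unfolding L2_approximable_def
proof (intro allI impI)
  fix e :: real assume "e > 0"
  then obtain v v' where "continuous_on {0..t} v" "L2_close t f v (e/4)"
    "continuous_on {0..t} v'" "L2_close t f' v' (e/4)"
    using assms unfolding L2_approximable_def by (meson zero_less_divide_iff zero_less_numeral)
  then show "\<exists>w. continuous_on {0..t} w \<and> L2_close t (\<lambda>s. f s + f' s) w e"
    using L2_close_add[of t f v "e/4" f' v' "e/4"]
    by (intro exI[of _ "\<lambda>s. v s + v' s"]) (auto intro!: continuous_intros)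
qed

lemma L2_approximable_zero: "L2_approximable t (\<lambda>_. 0)"
  unfolding L2_approximable_def L2_close_def
  by (auto intro!: exI[of _ "\<lambda>_. 0"])

lemma L2_approximable_sum:
  assumes "finite A" "\<And>a. a \<in> A \<Longrightarrow> L2_approximable t (f a)"
  shows "L2_approximable t (\<lambda>s. \<Sum>a\<in>A. f a s)"
  using assms by (induction A rule: finite_induct) (auto intro: L2_approximable_add L2_approximable_zero)

lemma L2_approximable_limit:
  assumes "\<And>e. e > 0 \<Longrightarrow> \<exists>f'. L2_approximable t f' \<and> L2_close t f f' e"
  shows "L2_approximable t f"
  unfolding L2_approximable_def
proof (intro allI impI)
  fix e :: real assume e: "e > 0"
  obtain f' where f': "L2_approximable t f'" "L2_close t f f' (e/4)"
    using assms[of "e/4"] e by auto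
  then obtain v where v: "continuous_on {0..t} v" "L2_close t f' v (e/4)"
    using e unfolding L2_approximable_def by (meson zero_less_divide_iff zero_less_numeral)
  then show "\<exists>w. continuous_on {0..t} w \<and> L2_close t f w e"
    using L2_close_trans[OF f'(2) v(2)] by auto
qed

text \<open>Regularity of Lebesgue measure provides a closed \<open>K\<close> inside
  \<open>E\<close> and an open \<open>G\<close> around it with a small gap; an Urysohn function
  between them differs from the indicator only on \<open>G - K\<close>, and there by at most
  1.\<close>

lemma L2_approximable_indicator:
  fixes c :: "'a::real_normed_vector"
  assumes "E \<in> sets lebesgue" "E \<subseteq> {0..t}"
  shows "L2_approximable t (\<lambda>s. indicator E s *\<^sub>R c)"
  unfolding L2_approximable_def
proof (intro allI impI)
  fix e :: real assume e: "e > 0"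
  \<comment> \<open>\<open>G - K\<close> consists of two sets of measure below \<open>d\<close>,
    whence the 2; the added 1 keeps the denominator positive when \<open>c = 0\<close>.\<close>
  define d where "d = e / (2 * ((norm c)\<^sup>2 + 1))"
  have d: "d > 0" using e by (simp add: d_def add_nonneg_pos)
  obtain G where G: "open G" "E \<subseteq> G" "G - E \<in> lmeasurable" "emeasure lebesgue (G - E) < ennreal d"
    using sets_lebesgue_outer_open[OF assms(1) d] by metis
  obtain K where K: "closed K" "K \<subseteq> E" "E - K \<in> lmeasurable" "emeasure lebesgue (E - K) < ennreal d"
    using sets_lebesgue_inner_closed[OF assms(1) d] by metis
  have eq: "G - K = (G - E) \<union> (E - K)" using G K by auto
  have GK: "G - K \<in> lmeasurable" unfolding eq using G K by (intro fmeasurable.Un) auto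
  have "measure lebesgue (G - E) < d" "measure lebesgue (E - K) < d"
    using G(3,4) K(3,4) d by (auto simp: emeasure_eq_measure2 ennreal_less_iff)
  moreover have "measure lebesgue (G - K) \<le> measure lebesgue (G - E) + measure lebesgue (E - K)"
    unfolding eq using G K by (intro measure_Un_le) auto
  ultimately have m: "measure lebesgue (G - K) \<le> 2 * d" by simp
  obtain \<phi> :: "real \<Rightarrow> real" where \<phi>: "continuous_on UNIV \<phi>" "\<And>x. \<phi> x \<in> closed_segment 1 0"
    "\<And>x. x \<in> K \<Longrightarrow> \<phi> x = 1" "\<And>x. x \<in> - G \<Longrightarrow> \<phi> x = 0"
  proof (rule Urysohn[of K "- G" 1 0])
    show "closed K" "closed (- G)" "K \<inter> - G = {}" using G K by auto
  qed blast
  have \<phi>01: "0 \<le> \<phi> x" "\<phi> x \<le> 1" for x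
    using \<phi>(2)[of x] by (auto simp: closed_segment_eq_real_ivl)
  define g where "g = (\<lambda>s. indicator (G - K) s * (norm c)\<^sup>2 :: real)"
  have "((indicator (G - K) :: real \<Rightarrow> real) has_integral measure lebesgue (G - K)) UNIV"
    using GK lmeasurable_iff_has_integral by blast
  then have gU: "(g has_integral measure lebesgue (G - K) * (norm c)\<^sup>2) UNIV"
    unfolding g_def by (rule has_integral_mult_left)
  have gi: "g integrable_on {0..t}"
    unfolding g_def
  proof (intro integrable_on_mult_left)
    have "(indicator (G - K) :: real \<Rightarrow> real) absolutely_integrable_on UNIV"
      using GK by (intro nonnegative_absolutely_integrable_1) (auto simp: lmeasurable_iff_has_integral)
    then have "(indicator (G - K) :: real \<Rightarrow> real) absolutely_integrable_on {0..t}"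
      by (rule set_integrable_subset) auto
    then show "(indicator (G - K) :: real \<Rightarrow> real) integrable_on {0..t}"
      using set_lebesgue_integral_eq_integral(1) by blast
  qed
  have "integral {0..t} g \<le> integral UNIV g"
    by (rule integral_subset_le) (use gi gU in \<open>auto simp: g_def\<close>)
  also have "\<dots> \<le> 2 * d * (norm c)\<^sup>2"
    using gU m by (simp add: integral_unique mult_right_mono)
  also have "\<dots> \<le> 2 * d * ((norm c)\<^sup>2 + 1)" using d by simp
  also have "\<dots> = e" by (simp add: d_def field_simps add_nonneg_eq_0_iff)
  finally have le: "integral {0..t} g \<le> e" .
  have "(norm (indicator E s *\<^sub>R c - \<phi> s *\<^sub>R c))\<^sup>2 \<le> g s" for s
  proof -
    have "\<bar>indicator E s - \<phi> s\<bar>\<^sup>2 \<le> indicator (G - K) s"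
      using \<phi>01[of s] \<phi>(3)[of s] \<phi>(4)[of s] G(2) K(2) by (auto simp: indicator_def abs_square_le_1)
    then show ?thesis
      by (simp add: g_def mult_right_mono power_mult_distrib flip: scaleR_left_diff_distrib)
  qed
  then show "\<exists>v. continuous_on {0..t} v \<and> L2_close t (\<lambda>s. indicator E s *\<^sub>R c) v e"
    unfolding L2_close_def using gi le \<phi>(1)
    by (intro exI[of _ "\<lambda>s. \<phi> s *\<^sub>R c"] conjI exI[of _ g])
      (auto intro!: continuous_intros continuous_on_subset[OF \<phi>(1)])
qed

lemma L2_approximable_simple:
  fixes f :: "real \<Rightarrow> 'a::real_normed_vector"
  assumes "simple_function (lebesgue_on {0..t}) f"
  shows "L2_approximable t f"
proof -
  let ?E = "\<lambda>c. f -` {c} \<inter> {0..t}"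
  have fin: "finite (f ` {0..t})" and E: "\<And>c. c \<in> f ` {0..t} \<Longrightarrow> ?E c \<in> sets lebesgue"
    using assms by (auto simp: simple_function_def sets_restrict_space_iff)
  have "L2_approximable t (\<lambda>s. \<Sum>c\<in>f ` {0..t}. indicator (?E c) s *\<^sub>R c)"
    by (intro L2_approximable_sum L2_approximable_indicator fin E) auto
  moreover have "(\<Sum>c\<in>f ` {0..t}. indicator (?E c) s *\<^sub>R c) = f s" if "s \<in> {0..t}" for s
  proof -
    have "(\<Sum>c\<in>f ` {0..t}. indicator (?E c) s *\<^sub>R c) = (\<Sum>c\<in>f ` {0..t}. if c = f s then c else 0)"
      using that by (intro sum.cong) (auto simp: indicator_def)
    then show ?thesis using fin that by simp
  qed
  ultimately show ?thesis by (simp add: L2_approximable_def L2_close_def)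
qed

lemma L2_approximable_pointwise_limit:
  fixes u :: "real \<Rightarrow> 'a::real_normed_vector"
  assumes s: "\<And>n. simple_function (lebesgue_on {0..t}) (s n)"
    and lim: "\<And>x. x \<in> {0..t} \<Longrightarrow> (\<lambda>n. s n x) \<longlonglongrightarrow> u x"
    and [measurable]: "(\<lambda>x. norm (u x)) \<in> borel_measurable (lebesgue_on {0..t})"
    and int: "integrable (lebesgue_on {0..t}) (\<lambda>x. (norm (u x))\<^sup>2)"
  shows "L2_approximable t u"
proof (rule L2_approximable_limit)
  fix e :: real assume e: "e > 0"
  let ?M = "lebesgue_on {0..t}"
  \<comment> \<open>Apart from the norm of \<open>u\<close>, measurability is at hand only for
    simple functions; the error is therefore treated as a limit of distances between these.\<close>
  have d[measurable]: "(\<lambda>x. norm (s n x - u x)) \<in> borel_measurable ?M" for n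
  proof (rule borel_measurable_LIMSEQ_real)
    show "(\<lambda>k. norm (s n x - s k x)) \<longlonglongrightarrow> norm (s n x - u x)" if "x \<in> space ?M" for x
      using lim that by (intro tendsto_intros) auto
    show "(\<lambda>x. norm (s n x - s k x)) \<in> borel_measurable ?M" for k
      by (intro borel_measurable_simple_function simple_function_compose2[OF s s])
  qed
  \<comment> \<open>Where \<open>s n\<close> is farther than 1 from \<open>u\<close>, it is replaced
    by 0. The squared error is then at most \<open>1 + (norm (u x))\<^sup>2\<close>, so dominated
    convergence applies.\<close>
  define f where "f n x = (if norm (s n x - u x) \<le> 1 then s n x else 0)" for n x
  have fs: "simple_function ?M (f n)" for n
    unfolding f_def by (intro simple_function_If s simple_function_const) measurable
  define g where "g n x = (norm (f n x - u x))\<^sup>2" for n x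
  have g_eq: "g n x = (if norm (s n x - u x) \<le> 1 then (norm (s n x - u x))\<^sup>2 else (norm (u x))\<^sup>2)" for n x
    by (simp add: g_def f_def)
  have g_meas[measurable]: "g n \<in> borel_measurable ?M" for n
    unfolding g_eq[abs_def] by measurable
  have bnd: "integrable ?M (\<lambda>x. 1 + (norm (u x))\<^sup>2)"
    using int by (intro Bochner_Integration.integrable_add) (auto intro!: finite_measure.integrable_const finite_measure_lebesgue_on)
  have lim_g: "(\<lambda>n. g n x) \<longlonglongrightarrow> 0" if "x \<in> {0..t}" for x
  proof -
    have n0: "(\<lambda>n. norm (s n x - u x)) \<longlonglongrightarrow> 0"
      using lim[OF that] by (simp add: tendsto_norm_zero_iff LIM_zero_iff)
    then have "\<forall>\<^sub>F n in sequentially. norm (s n x - u x) < 1"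
      by (rule order_tendstoD) simp
    then have ev: "\<forall>\<^sub>F n in sequentially. (norm (s n x - u x))\<^sup>2 = g n x"
      by eventually_elim (simp add: g_eq)
    have "(\<lambda>n. (norm (s n x - u x))\<^sup>2) \<longlonglongrightarrow> 0"
      using tendsto_power[OF n0, of 2] by simp
    then show ?thesis using ev by (rule Lim_transform_eventually)
  qed
  have g_le: "norm (g n x) \<le> 1 + (norm (u x))\<^sup>2" for n x
    using power_mono[of "norm (s n x - u x)" 1 2]
    unfolding g_eq by (cases "norm (s n x - u x) \<le> 1") (simp_all add: add_increasing2)
  have *: "integrable ?M (g n)" for n
    by (rule Bochner_Integration.integrable_bound[OF bnd]) (use g_le in \<open>auto intro!: always_eventually intro: order_trans\<close>)
  have "(\<lambda>n. LINT x|?M. g n x) \<longlonglongrightarrow> (LINT x|?M. 0::real)"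
    by (rule integral_dominated_convergence[OF _ _ bnd]) (use g_le lim_g in \<open>auto intro!: AE_I2\<close>)
  then have "\<forall>\<^sub>F n in sequentially. (LINT x|?M. g n x) < e"
    using e by (intro order_tendstoD) auto
  then obtain n where n: "(LINT x|?M. g n x) < e" by (auto dest: eventually_happens)
  have "g n integrable_on {0..t}" using * by (intro integrable_on_lebesgue_on) auto
  moreover have "integral {0..t} (g n) = (LINT x|?M. g n x)"
    using * by (intro lebesgue_integral_eq_integral[symmetric]) auto
  moreover have "(norm (u x - f n x))\<^sup>2 = g n x" for x by (simp add: g_def norm_minus_commute)
  ultimately have "L2_close t u (f n) e" unfolding L2_close_def using n by (intro exI[of _ "g n"]) auto
  then show "\<exists>f'. L2_approximable t f' \<and> L2_close t u f' e"
    using L2_approximable_simple[OF fs] by blast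
qed

lemma L2_approximable_spike:
  assumes "L2_approximable t f" "negligible N" "\<And>x. x \<in> {0..t} - N \<Longrightarrow> f' x = f x"
  shows "L2_approximable t f'"
proof (rule L2_approximable_limit)
  fix e :: real assume "e > 0"
  have "((\<lambda>x. (norm (f' x - f x))\<^sup>2) has_integral 0) {0..t}"
    by (rule has_integral_negligible[OF assms(2)]) (simp add: assms(3))
  then have "L2_close t f' f e"
    unfolding L2_close_def using \<open>e > 0\<close>
    by (intro exI[of _ "\<lambda>x. (norm (f' x - f x))\<^sup>2"]) (auto simp: integral_unique)
  then show "\<exists>h. L2_approximable t h \<and> L2_close t f' h e" using assms(1) by blast
qed

lemma L2_imp_approximable:
  fixes u :: "real \<Rightarrow> 'a::real_normed_vector"
  assumes "u \<in> L2 t"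
  shows "L2_approximable t u"
proof -
  let ?M = "lebesgue_on {0..t}"
  obtain s where s: "\<And>n. simple_function ?M (s n)"
    and ae: "AE x in ?M. (\<lambda>n. s n x) \<longlonglongrightarrow> u x"
    and int: "integrable ?M (\<lambda>x. (norm (u x))\<^sup>2)"
    using assms by (auto simp: L2_def)
  obtain N where N: "{x \<in> space ?M. \<not> (\<lambda>n. s n x) \<longlonglongrightarrow> u x} \<subseteq> N" "emeasure ?M N = 0" "N \<in> sets ?M"
    using ae by (rule AE_E)
  then have N0: "N \<in> null_sets ?M" by blast
  then have neg: "negligible N"
    by (auto simp: null_sets_restrict_space negligible_iff_null_sets)
  \<comment> \<open>Both the function and its approximations are set to 0 on the exceptional set,
    which turns almost everywhere convergence into convergence at every point.\<close>
  define u' where "u' x = (if x \<in> N then 0 else u x)" for x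
  define s' where "s' n x = (if x \<in> N then 0 else s n x)" for n x
  have Nm: "{x \<in> space ?M. x \<in> N} \<in> sets ?M"
    using N(3) sets.Int_space_eq2[OF N(3)] by (simp add: Int_def conj_commute)
  have s'f: "simple_function ?M (s' n)" for n
    unfolding s'_def by (intro simple_function_If s simple_function_const Nm)
  have lim: "(\<lambda>n. s' n x) \<longlonglongrightarrow> u' x" if "x \<in> {0..t}" for x
    using N(1) that by (auto simp: s'_def u'_def)
  have [measurable]: "(\<lambda>x. norm (u' x)) \<in> borel_measurable ?M"
  proof (rule borel_measurable_LIMSEQ_real)
    show "(\<lambda>n. norm (s' n x)) \<longlonglongrightarrow> norm (u' x)" if "x \<in> space ?M" for x
      using lim that by (intro tendsto_intros) auto
    show "(\<lambda>x. norm (s' n x)) \<in> borel_measurable ?M" for n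
      by (intro borel_measurable_simple_function simple_function_compose1[OF s'f])
  qed
  have "AE x in ?M. x \<notin> N" using N0 by (rule AE_not_in)
  then have "AE x in ?M. (norm (u x))\<^sup>2 = (norm (u' x))\<^sup>2"
    by eventually_elim (simp add: u'_def)
  then have int': "integrable ?M (\<lambda>x. (norm (u' x))\<^sup>2)"
    by (rule integrable_cong_AE_imp[OF int, rotated]) measurable
  have "L2_approximable t u'"
    by (intro L2_approximable_pointwise_limit[where s = s', OF s'f]) (use lim int' in auto)
  then show ?thesis by (rule L2_approximable_spike[OF _ neg]) (simp add: u'_def)
qed

text \<open>Riemann sums of \<open>f\<close> differ from those of \<open>v\<close> by at most a
  Riemann sum of \<open>g\<close>, so \<open>f\<close> inherits the Cauchy criterion. The integral
  of \<open>g\<close> and the deviations of the sums of \<open>g\<close> and \<open>v\<close> each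
  cost \<open>e / 8\<close>; two divisions together stay below \<open>e\<close>.\<close>

lemma integrable_on_approx:
  fixes f :: "real \<Rightarrow> 'a::banach"
  assumes "\<And>e. e > 0 \<Longrightarrow> \<exists>v g. v integrable_on {0..t} \<and> g integrable_on {0..t} \<and>
      (\<forall>x\<in>{0..t}. norm (f x - v x) \<le> g x) \<and> integral {0..t} g \<le> e"
  shows "f integrable_on {0..t}"
proof -
  have "f integrable_on cbox 0 t"
    unfolding integrable_Cauchy
  proof (intro allI impI)
    fix e :: real assume e: "e > 0"
    let ?S = "\<lambda>D h. \<Sum>(x, K)\<in>D. measure lborel K *\<^sub>R h x"
    obtain v g where v: "v integrable_on cbox 0 t" and g: "g integrable_on cbox 0 t"
      and fvg: "\<And>x. x \<in> cbox 0 t \<Longrightarrow> norm (f x - v x) \<le> g x" and ig: "integral (cbox 0 t) g \<le> e / 8"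
      using assms[of "e/8"] e by auto
    obtain y z where y: "(v has_integral y) (cbox 0 t)" and z: "(g has_integral z) (cbox 0 t)" and "z \<le> e / 8"
      using v g ig integral_unique by (metis integrable_on_def)
    obtain \<gamma> where \<gamma>: "gauge \<gamma>" "\<And>D. D tagged_division_of cbox 0 t \<Longrightarrow> \<gamma> fine D \<Longrightarrow> norm (?S D v - y) < e / 8"
      using y[unfolded has_integral, rule_format, of "e/8"] e by auto
    obtain \<delta> where \<delta>: "gauge \<delta>" "\<And>D. D tagged_division_of cbox 0 t \<Longrightarrow> \<delta> fine D \<Longrightarrow> norm (?S D g - z) < e / 8"
      using z[unfolded has_integral, rule_format, of "e/8"] e by auto
    have est: "norm (?S D f - y) < 3 * e / 8"
      if D: "D tagged_division_of cbox 0 t" "(\<lambda>x. \<gamma> x \<inter> \<delta> x) fine D" for D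
    proof -
      have fine: "\<gamma> fine D" "\<delta> fine D" using D(2) by (auto simp: fine_Int)
      have "norm (?S D f - ?S D v) \<le> ?S D g"
      proof -
        have "?S D f - ?S D v = (\<Sum>(x, K)\<in>D. measure lborel K *\<^sub>R (f x - v x))"
          by (simp add: scaleR_diff_right sum_subtractf case_prod_beta)
        also have "norm \<dots> \<le> ?S D g"
          using D(1) fvg tag_in_interval[OF D(1)]
          by (intro sum_norm_le) (auto intro!: mult_left_mono)
        finally show ?thesis .
      qed
      moreover have "norm (?S D v - y) < e / 8" using \<gamma> D fine by blast
      moreover have "?S D g < z + e / 8" using \<delta>(2)[OF D(1) fine(2)] unfolding real_norm_def by linarith
      moreover have "norm (?S D f - y) \<le> norm (?S D f - ?S D v) + norm (?S D v - y)"
        using norm_triangle_ineq[of "?S D f - ?S D v" "?S D v - y"] by simp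
      ultimately show ?thesis using \<open>z \<le> e/8\<close> by linarith
    qed
    show "\<exists>\<gamma>. gauge \<gamma> \<and> (\<forall>D1 D2. D1 tagged_division_of cbox 0 t \<and> \<gamma> fine D1 \<and>
        D2 tagged_division_of cbox 0 t \<and> \<gamma> fine D2 \<longrightarrow> norm (?S D1 f - ?S D2 f) < e)"
    proof (intro exI[of _ "\<lambda>x. \<gamma> x \<inter> \<delta> x"] conjI allI impI; (elim conjE)?)
      show "gauge (\<lambda>x. \<gamma> x \<inter> \<delta> x)" using \<gamma> \<delta> by (intro gauge_Int)
      fix D1 D2 assume "D1 tagged_division_of cbox 0 t" "(\<lambda>x. \<gamma> x \<inter> \<delta> x) fine D1"
        "D2 tagged_division_of cbox 0 t" "(\<lambda>x. \<gamma> x \<inter> \<delta> x) fine D2"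
      then have "norm (?S D1 f - y) < 3 * e / 8" "norm (?S D2 f - y) < 3 * e / 8" using est by auto
      then show "norm (?S D1 f - ?S D2 f) < e"
        using norm_triangle_ineq4[of "?S D1 f - y" "?S D2 f - y"] e by simp
    qed
  qed
  then show ?thesis by simp
qed

section \<open>Integrals along orbits\<close>

lemma has_integral_norm_le:
  fixes f :: "real \<Rightarrow> 'a::real_normed_vector"
  assumes "(f has_integral i) {a..b}" "a \<le> b" "\<And>x. x \<in> {a..b} \<Longrightarrow> norm (f x) \<le> C"
  shows "norm i \<le> (b - a) * C"
proof -
  have "0 \<le> C" using assms(2) by (intro order_trans[OF norm_ge_zero assms(3)[of a]]) auto
  then have "norm i \<le> C * measure lborel (cbox a b)"
    using assms by (intro has_integral_bound[of C f i a b]) auto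
  then show ?thesis using assms(2) by (simp add: mult.commute)
qed

locale banach_semigroup = strongly_continuous_semigroup T
  for T :: "real \<Rightarrow> 'x::banach \<Rightarrow> 'x"
begin

text \<open>The state reached from 0 at time \<open>h\<close> under the constant forcing
  \<open>z\<close>: reversing time turns \<open>T (h - s) z\<close> into
  \<open>T s z\<close>.\<close>

definition orbit_integral :: "real \<Rightarrow> 'x \<Rightarrow> 'x" where
  "orbit_integral h z = integral {0..h} (\<lambda>s. T s z)"

lemma continuous_on_orbit_interval: "0 \<le> a \<Longrightarrow> continuous_on {a..b} (\<lambda>t. T t x)"
  by (rule continuous_on_subset[OF continuous_on_orbit]) auto

lemma has_integral_orbit: "((\<lambda>s. T s z) has_integral orbit_integral h z) {0..h}"
  unfolding orbit_integral_def
  by (intro integrable_integral integrable_continuous_interval continuous_on_orbit_interval) auto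

lemma has_integral_orbit_T:
  assumes "0 \<le> a" "0 \<le> h"
  shows "((\<lambda>s. T (a + s) z) has_integral T a (orbit_integral h z)) {0..h}"
proof -
  have "((\<lambda>s. T a (T s z)) has_integral T a (orbit_integral h z)) {0..h}"
    using has_integral_linear[OF has_integral_orbit bounded_linear_T[OF assms(1)]] by (simp add: o_def)
  then show ?thesis
    by (rule has_integral_eq[rotated]) (use assms T_add in auto)
qed

lemma orbit_integral_add:
  assumes "0 \<le> h" "0 \<le> k"
  shows "orbit_integral (h + k) z = orbit_integral h z + T h (orbit_integral k z)"
proof -
  have "((\<lambda>s. T s z) has_integral T h (orbit_integral k z)) {h..h + k}"
    using has_integral_shift_real_ivl[OF has_integral_orbit_T[OF assms], of "- h" z] by (simp add: add.commute)
  then have "((\<lambda>s. T s z) has_integral orbit_integral h z + T h (orbit_integral k z)) {0..h + k}"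
    using assms by (intro has_integral_combine[OF _ _ has_integral_orbit]) auto
  then show ?thesis using has_integral_orbit has_integral_unique by blast
qed

lemma norm_T_orbit_integral_le:
  assumes "0 \<le> a" "0 \<le> h" "\<And>s. s \<in> {a..a + h} \<Longrightarrow> norm (T s z) \<le> C"
  shows "norm (T a (orbit_integral h z)) \<le> h * C"
  using has_integral_norm_le[OF has_integral_orbit_T[OF assms(1,2)] assms(2), of z C] assms by auto

lemma orbit_integral_commute:
  assumes "bounded_linear L" "\<And>s z. 0 \<le> s \<Longrightarrow> T s (L z) = L (T s z)"
  shows "orbit_integral h (L z) = L (orbit_integral h z)"
proof -
  have "((\<lambda>s. L (T s z)) has_integral L (orbit_integral h z)) {0..h}"
    using has_integral_linear[OF has_integral_orbit assms(1)] by (simp add: o_def)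
  then have "((\<lambda>s. T s (L z)) has_integral L (orbit_integral h z)) {0..h}"
    by (rule has_integral_eq[rotated]) (use assms in auto)
  then show ?thesis using has_integral_orbit has_integral_unique by blast
qed

lemma orbit_integral_plus: "orbit_integral h (y + z) = orbit_integral h y + orbit_integral h z"
proof (cases "h \<ge> 0")
  case True
  have "((\<lambda>s. T s (y + z)) has_integral orbit_integral h y + orbit_integral h z) {0..h}"
    by (rule has_integral_eq[OF _ has_integral_add[OF has_integral_orbit has_integral_orbit]])
      (simp add: T_plus)
  then show ?thesis using has_integral_orbit has_integral_unique by blast
qed (simp add: orbit_integral_def)

lemma orbit_integral_scaleR: "orbit_integral h (r *\<^sub>R z) = r *\<^sub>R orbit_integral h z"
  by (rule orbit_integral_commute) (auto simp: T_scaleR bounded_linear_scaleR_right)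

lemma linear_orbit_integral: "linear (orbit_integral h)"
  by (rule linearI) (auto simp: orbit_integral_plus orbit_integral_scaleR)

lemma orbit_integral_zero: "orbit_integral 0 z = 0"
  by (simp add: orbit_integral_def)

lemma continuous_on_orbit_integral: "continuous_on {0..b} (\<lambda>h. orbit_integral h z)"
  unfolding orbit_integral_def
  by (intro indefinite_integral_continuous_1 integrable_continuous_interval continuous_on_orbit_interval) auto

lemma continuous_on_convolution_integrand:
  assumes "continuous_on {a..b} f"
  shows "continuous_on {a..b} (\<lambda>s. T (b - s) (f s))"
  using assms by (intro continuous_on_T continuous_intros) auto

lemma has_integral_convolution:
  assumes "continuous_on {a..b} f"
  shows "((\<lambda>s. T (b - s) (f s)) has_integral integral {a..b} (\<lambda>s. T (b - s) (f s))) {a..b}"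
  by (intro integrable_integral integrable_continuous_interval continuous_on_convolution_integrand assms)

lemma has_integral_convolution_const:
  "((\<lambda>s. T (b - s) z) has_integral orbit_integral (b - a) z) {a..b}"
proof -
  have "((\<lambda>s. T (- s) z) has_integral orbit_integral (b - a) z) {- (b - a)..- 0}"
    using has_integral_orbit by (simp only: has_integral_reflect_real[of "\<lambda>s. T s z"])
  from has_integral_shift_real_ivl[OF this, of "- b"] show ?thesis
    by simp
qed

text \<open>The hypothesis lives in the weaker space reached by \<open>emb\<close>. Approximating
  \<open>u\<close> by continuous controls shows that the integrand is integrable already in
  \<open>'x\<close>; then \<open>emb\<close> can be pulled out of the integral and cancelled. The
  same approximations are the controls returned, with an energy bound \<open>A\<close> that does not
  depend on \<open>e\<close>.\<close>

lemma steering_approx: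
  fixes B :: "'u::real_normed_vector \<Rightarrow> 'x" and emb :: "'x \<Rightarrow> 'y::real_normed_vector"
  assumes B: "bounded_linear B" and emb: "bounded_linear emb" "\<And>z. emb z = 0 \<Longrightarrow> z = 0"
    and t: "t > 0" and u: "u \<in> L2 t"
    and null: "emb (T t x) + integral {0..t} (\<lambda>s. emb (T (t - s) (B (u s)))) = 0"
  obtains A where "\<And>e. e > 0 \<Longrightarrow> \<exists>v. continuous_on {0..t} v \<and> integral {0..t} (\<lambda>s. (norm (v s))\<^sup>2) \<le> A \<and>
    norm (T t x + integral {0..t} (\<lambda>s. T (t - s) (B (v s)))) \<le> e"
proof -
  obtain M where M: "M \<ge> 1" "\<And>s z. s \<in> {0..t} \<Longrightarrow> norm (T s z) \<le> M * norm z"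
    using T_bounded_on_interval by blast
  obtain \<beta> where \<beta>: "\<beta> > 0" "\<And>z. norm (B z) \<le> norm z * \<beta>"
    using bounded_linear.pos_bounded[OF B] by blast
  define f where "f s = T (t - s) (B (u s))" for s
  have u2: "(\<lambda>s. (norm (u s))\<^sup>2) integrable_on {0..t}"
    using u by (intro integrable_on_lebesgue_on) (auto simp: L2_def)
  \<comment> \<open>The squared norm of \<open>v\<close> is at most twice that of \<open>u\<close>
    plus twice that of \<open>u - v\<close>; the squared distance is kept below 1, hence the summand
    2.\<close>
  define A where "A = 2 * integral {0..t} (\<lambda>s. (norm (u s))\<^sup>2) + 2"
  have cw: "continuous_on {0..t} (\<lambda>s. T (t - s) (B (v s)))" if "continuous_on {0..t} v" for v
    by (intro continuous_on_convolution_integrand bounded_linear.continuous_on[OF B] that)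
  have main: "\<exists>v G. continuous_on {0..t} v \<and> integral {0..t} (\<lambda>s. (norm (v s))\<^sup>2) \<le> A \<and>
      G integrable_on {0..t} \<and> (\<forall>s\<in>{0..t}. norm (f s - T (t - s) (B (v s))) \<le> G s) \<and> integral {0..t} G \<le> e"
    if e: "e > 0" for e
  proof -
    \<comment> \<open>By Young's inequality \<open>norm (u s - v s)\<close> is at most
      \<open>\<eta> + g s / \<eta>\<close>, whose integral is at most
      \<open>\<eta> * (t + 1)\<close>; multiplied by \<open>M * \<beta>\<close> this has to be
      \<open>e\<close>.\<close>
    define \<eta> where "\<eta> = e / (M * \<beta> * (t + 1))"
    have \<eta>: "\<eta> > 0" using e M \<beta> t by (simp add: \<eta>_def)
    obtain v where v: "continuous_on {0..t} v" "L2_close t u v (min (\<eta>\<^sup>2) 1)"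
      using L2_imp_approximable[OF u] \<eta> unfolding L2_approximable_def
      by (metis min_less_iff_conj zero_less_one zero_less_power)
    obtain g where g: "g integrable_on {0..t}" "\<And>s. s \<in> {0..t} \<Longrightarrow> (norm (u s - v s))\<^sup>2 \<le> g s"
      "integral {0..t} g \<le> \<eta>\<^sup>2" "integral {0..t} g \<le> 1"
      using v(2) unfolding L2_close_def by auto
    define G where "G s = M * \<beta> * (\<eta> + g s / \<eta>)" for s
    have Gi: "(G has_integral M * \<beta> * (\<eta> * t + integral {0..t} g / \<eta>)) {0..t}"
      unfolding G_def
      using has_integral_add[OF has_integral_const_real[of \<eta> 0 t] has_integral_divide[OF integrable_integral[OF g(1)], of \<eta>]] t
      by (intro has_integral_mult_right) (simp add: mult.commute)
    have "integral {0..t} g / \<eta> \<le> \<eta>" using g(3) \<eta> by (simp add: field_simps power2_eq_square)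
    then have "M * \<beta> * (\<eta> * t + integral {0..t} g / \<eta>) \<le> M * \<beta> * (\<eta> * t + \<eta>)"
      using M \<beta> by (intro mult_left_mono) auto
    also have "\<dots> = \<eta> * (M * \<beta> * (t + 1))" by (simp add: algebra_simps)
    also have "\<dots> = e" unfolding \<eta>_def using M \<beta> t by simp
    finally have Ge: "integral {0..t} G \<le> e" using Gi by (simp add: integral_unique)
    have bound: "norm (f s - T (t - s) (B (v s))) \<le> G s" if s: "s \<in> {0..t}" for s
    proof -
      have "f s - T (t - s) (B (v s)) = T (t - s) (B (u s - v s))"
        using s by (simp add: f_def T_diff linear_diff[OF bounded_linear.linear[OF B]])
      then have "norm (f s - T (t - s) (B (v s))) \<le> M * norm (B (u s - v s))" using M s by simp
      also have "\<dots> \<le> M * (norm (u s - v s) * \<beta>)" using \<beta> M by (intro mult_left_mono) auto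
      also have "\<dots> = M * \<beta> * norm (u s - v s)" by simp
      also have "norm (u s - v s) \<le> \<eta> + g s / \<eta>"
      proof -
        let ?n = "norm (u s - v s)"
        have "0 \<le> (?n - \<eta>)\<^sup>2 + ?n * \<eta>" using \<eta> by simp
        then have "?n * \<eta> \<le> \<eta>\<^sup>2 + ?n\<^sup>2" unfolding power2_diff by linarith
        then have "?n * \<eta> \<le> \<eta>\<^sup>2 + g s" using g(2)[OF s] by linarith
        then show ?thesis using \<eta> by (simp add: field_simps power2_eq_square)
      qed
      finally show ?thesis using M \<beta> by (simp add: G_def mult_left_mono)
    qed
    have "integral {0..t} (\<lambda>s. (norm (v s))\<^sup>2) \<le> integral {0..t} (\<lambda>s. 2 * (norm (u s))\<^sup>2 + 2 * g s)"
    proof (rule integral_le)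
      show "(\<lambda>s. (norm (v s))\<^sup>2) integrable_on {0..t}"
        by (intro integrable_continuous_interval continuous_intros v)
      show "(\<lambda>s. 2 * (norm (u s))\<^sup>2 + 2 * g s) integrable_on {0..t}"
        by (intro integrable_add integrable_on_mult_right u2 g)
      fix s assume "s \<in> {0..t}"
      then show "(norm (v s))\<^sup>2 \<le> 2 * (norm (u s))\<^sup>2 + 2 * g s"
        using norm_add_power2_le[of "u s" "v s - u s"] g(2)[of s] by (simp add: norm_minus_commute)
    qed
    also have "\<dots> = 2 * integral {0..t} (\<lambda>s. (norm (u s))\<^sup>2) + 2 * integral {0..t} g"
      using u2 g(1) by (simp add: Henstock_Kurzweil_Integration.integral_add integrable_on_mult_right)
    finally have "integral {0..t} (\<lambda>s. (norm (v s))\<^sup>2) \<le> A" using g(4) by (simp add: A_def)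
    then show ?thesis using v(1) Gi Ge bound by blast
  qed
  have fi: "f integrable_on {0..t}"
  proof (rule integrable_on_approx)
    fix e :: real assume "e > 0"
    from main[OF this] obtain v G where "continuous_on {0..t} v" "G integrable_on {0..t}"
      "\<forall>s\<in>{0..t}. norm (f s - T (t - s) (B (v s))) \<le> G s" "integral {0..t} G \<le> e" by blast
    then show "\<exists>v g. v integrable_on {0..t} \<and> g integrable_on {0..t} \<and>
        (\<forall>x\<in>{0..t}. norm (f x - v x) \<le> g x) \<and> integral {0..t} g \<le> e"
      using integrable_continuous_interval[OF cw] by blast
  qed
  have "integral {0..t} (\<lambda>s. emb (f s)) = emb (integral {0..t} f)"
    using integral_linear[OF fi emb(1)] by (simp add: o_def)
  then have "emb (T t x + integral {0..t} f) = 0"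
    using null linear_add[OF bounded_linear.linear[OF emb(1)]] by (simp add: f_def)
  then have null': "T t x + integral {0..t} f = 0" by (rule emb(2))
  show ?thesis
  proof (rule that)
    fix e :: real assume "e > 0"
    from main[OF this] obtain v G where v: "continuous_on {0..t} v" "integral {0..t} (\<lambda>s. (norm (v s))\<^sup>2) \<le> A"
      and G: "G integrable_on {0..t}"
      "\<forall>s\<in>{0..t}. norm (f s - T (t - s) (B (v s))) \<le> G s" "integral {0..t} G \<le> e" by blast
    let ?w = "\<lambda>s. T (t - s) (B (v s))"
    have wi: "?w integrable_on {0..t}" by (intro integrable_continuous_interval cw v)
    have "norm (integral {0..t} (\<lambda>s. f s - ?w s)) \<le> integral {0..t} G"
      by (rule Henstock_Kurzweil_Integration.integral_norm_bound_integral)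
        (use G fi wi integrable_diff in blast)+
    also have "integral {0..t} (\<lambda>s. f s - ?w s) = - (T t x + integral {0..t} ?w)"
      using fi wi null' by (simp add: Henstock_Kurzweil_Integration.integral_diff algebra_simps eq_neg_iff_add_eq_0)
    finally have "norm (T t x + integral {0..t} ?w) \<le> e"
      unfolding norm_minus_cancel using G(3) by (rule order_trans)
    with v show "\<exists>v. continuous_on {0..t} v \<and> integral {0..t} (\<lambda>s. (norm (v s))\<^sup>2) \<le> A \<and>
        norm (T t x + integral {0..t} (\<lambda>s. T (t - s) (B (v s)))) \<le> e"
      by (intro exI[of _ v] conjI)
  qed
qed

end

section \<open>Piecewise constant controls\<close>

text \<open>A control is a list of pairs \<open>(h, v)\<close>: the value \<open>v\<close> is held for a time \<open>h\<close>.\<close>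

definition valid_control :: "(real \<times> 'u) list \<Rightarrow> bool" where
  "valid_control us \<longleftrightarrow> (\<forall>p\<in>set us. 0 \<le> fst p)"

definition duration :: "(real \<times> 'u) list \<Rightarrow> real" where
  "duration us = (\<Sum>(h, v)\<leftarrow>us. h)"

definition control_L1 :: "(real \<times> 'u::real_normed_vector) list \<Rightarrow> real" where
  "control_L1 us = (\<Sum>(h, v)\<leftarrow>us. h * norm v)"

definition control_energy :: "(real \<times> 'u::real_normed_vector) list \<Rightarrow> real" where
  "control_energy us = (\<Sum>(h, v)\<leftarrow>us. h * (norm v)\<^sup>2)"

lemma valid_control_simps [simp]:
  "valid_control []" "valid_control ((h, v) # us) \<longleftrightarrow> 0 \<le> h \<and> valid_control us"
  "valid_control (us @ vs) \<longleftrightarrow> valid_control us \<and> valid_control vs"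
  by (auto simp: valid_control_def)

lemma duration_simps [simp]:
  "duration [] = 0" "duration ((h, v) # us) = h + duration us"
  "duration (us @ vs) = duration us + duration vs"
  by (auto simp: duration_def)

lemma control_L1_simps [simp]:
  "control_L1 [] = 0" "control_L1 ((h, v) # us) = h * norm v + control_L1 us"
  "control_L1 (us @ vs) = control_L1 us + control_L1 vs"
  by (auto simp: control_L1_def)

lemma control_energy_simps [simp]:
  "control_energy [] = 0" "control_energy ((h, v) # us) = h * (norm v)\<^sup>2 + control_energy us"
  "control_energy (us @ vs) = control_energy us + control_energy vs"
  by (auto simp: control_energy_def)

lemma duration_nonneg: "valid_control us \<Longrightarrow> 0 \<le> duration us"
  by (induction us) auto

lemma control_L1_nonneg: "valid_control us \<Longrightarrow> 0 \<le> control_L1 us"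
  by (induction us) auto

text \<open>Young's inequality on each piece. It trades the L1 norm, which bounds the state, against
  the energy, which the cost bounds; the parameter \<open>r\<close> is free, and the remainder is
  linear in the duration.\<close>

lemma control_L1_young:
  assumes "valid_control us"
  shows "2 * r * control_L1 us \<le> r\<^sup>2 * duration us + control_energy us"
  using assms
proof (induction us)
  case (Cons p us)
  obtain h v where p: "p = (h, v)" by fastforce
  have "2 * r * norm v \<le> r\<^sup>2 + (norm v)\<^sup>2"
    using zero_le_power2[of "norm v - r"] unfolding power2_diff by (simp add: mult.commute mult.left_commute)
  then have "h * (2 * r * norm v) \<le> h * (r\<^sup>2 + (norm v)\<^sup>2)"
    using Cons.prems p by (intro mult_left_mono) auto
  then show ?case using Cons p by (simp add: algebra_simps)
qed simp

lemma norm_parallelogram: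
  fixes a b :: "'a::real_inner"
  shows "(norm (a + b))\<^sup>2 + (norm (a - b))\<^sup>2 = 2 * (norm a)\<^sup>2 + 2 * (norm b)\<^sup>2"
  by (simp add: power2_norm_eq_inner inner_add inner_diff inner_commute)

section \<open>States and costs produced by piecewise constant controls\<close>

locale input_system = banach_semigroup T
  for T :: "real \<Rightarrow> 'x::{real_inner,banach} \<Rightarrow> 'x" +
  fixes B :: "'u::real_inner \<Rightarrow> 'x"
  assumes bounded_linear_B: "bounded_linear B"
begin

lemma B_simps: "B (v + w) = B v + B w" "B (v - w) = B v - B w" "B (r *\<^sub>R v) = r *\<^sub>R B v" "B 0 = 0"
  using bounded_linear.linear[OF bounded_linear_B]
  by (auto simp: linear_add linear_diff linear_cmul linear_0)

definition flow :: "'x \<Rightarrow> real \<Rightarrow> 'x \<Rightarrow> 'x" where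
  "flow x h z = T h x + orbit_integral h z"

fun state :: "'x \<Rightarrow> (real \<times> 'u) list \<Rightarrow> 'x" where
  "state x [] = x"
| "state x ((h, v) # us) = state (flow x h (B v)) us"

fun running_cost :: "'x \<Rightarrow> (real \<times> 'u) list \<Rightarrow> real" where
  "running_cost x [] = 0"
| "running_cost x ((h, v) # us) =
     integral {0..h} (\<lambda>s. (norm (flow x s (B v)))\<^sup>2) + h * (norm v)\<^sup>2 + running_cost (flow x h (B v)) us"

lemma state_append: "state x (us @ vs) = state (state x us) vs"
  by (induction us arbitrary: x) auto

lemma running_cost_append: "running_cost x (us @ vs) = running_cost x us + running_cost (state x us) vs"
  by (induction us arbitrary: x) auto

lemma flow_add:
  assumes "0 \<le> h" "0 \<le> k"
  shows "flow x (h + k) z = flow (flow x h z) k z"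
  using T_add[of k h x] orbit_integral_add[of k h z] assms
  by (simp add: flow_def T_plus add.commute)

lemma flow_zero: "flow x 0 z = x"
  by (simp add: flow_def T_zero orbit_integral_zero)

lemma continuous_on_flow: "continuous_on {0..h} (\<lambda>s. flow x s z)"
  unfolding flow_def by (intro continuous_intros continuous_on_orbit_interval continuous_on_orbit_integral) auto

lemma has_integral_flow_cost:
  "((\<lambda>s. (norm (flow x s z))\<^sup>2) has_integral integral {0..h} (\<lambda>s. (norm (flow x s z))\<^sup>2)) {0..h}"
  by (intro integrable_integral integrable_continuous_interval continuous_intros continuous_on_flow)

lemma flow_cost_add:
  assumes "0 \<le> h" "0 \<le> k"
  shows "integral {0..h + k} (\<lambda>s. (norm (flow x s z))\<^sup>2) =
    integral {0..h} (\<lambda>s. (norm (flow x s z))\<^sup>2) + integral {0..k} (\<lambda>s. (norm (flow (flow x h z) s z))\<^sup>2)"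
proof -
  let ?j = "integral {0..k} (\<lambda>s. (norm (flow (flow x h z) s z))\<^sup>2)"
  have "((\<lambda>s. (norm (flow x (s + h) z))\<^sup>2) has_integral ?j) {0..k}"
    by (rule has_integral_eq[OF _ has_integral_flow_cost])
      (use assms in \<open>auto simp: flow_add add.commute[of _ h]\<close>)
  from has_integral_shift_real_ivl[OF this, of "- h"]
  have "((\<lambda>s. (norm (flow x s z))\<^sup>2) has_integral ?j) {h..h + k}" by (simp add: add.commute)
  from has_integral_combine[OF _ _ has_integral_flow_cost this] show ?thesis
    using assms by (simp add: integral_unique)
qed

lemma state_split:
  assumes "0 \<le> h" "0 \<le> k"
  shows "state x ((h + k, v) # us) = state x ((h, v) # (k, v) # us)"
    and "running_cost x ((h + k, v) # us) = running_cost x ((h, v) # (k, v) # us)"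
  using assms by (auto simp: flow_add flow_cost_add algebra_simps)

lemma running_cost_nonneg: "valid_control us \<Longrightarrow> 0 \<le> running_cost x us"
proof (induction us arbitrary: x)
  case (Cons p us)
  then show ?case
    by (cases p) (auto intro!: add_nonneg_nonneg has_integral_nonneg[OF has_integral_flow_cost])
qed simp

text \<open>Different lists may describe the same step function; they are identified by their
  effect. Quantifying over \<open>x\<close> makes the relation stable under prefixing a
  piece.\<close>

definition equivalent_control :: "(real \<times> 'u) list \<Rightarrow> (real \<times> 'u) list \<Rightarrow> bool" where
  "equivalent_control us vs \<longleftrightarrow>
     (\<forall>x. state x us = state x vs \<and> running_cost x us = running_cost x vs)"

lemma equivalent_control_Cons: "equivalent_control us vs \<Longrightarrow> equivalent_control (p # us) (p # vs)"
  by (cases p) (auto simp: equivalent_control_def)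

lemma equivalent_control_split:
  "0 \<le> h \<Longrightarrow> h \<le> k \<Longrightarrow> equivalent_control ((k, v) # us) ((h, v) # (k - h, v) # us)"
  using state_split[of h "k - h"] by (auto simp: equivalent_control_def simp del: state.simps running_cost.simps)

lemma equivalent_control_trans:
  "equivalent_control us vs \<Longrightarrow> equivalent_control vs ws \<Longrightarrow> equivalent_control us ws"
  by (auto simp: equivalent_control_def)

lemma cut_control:
  assumes "valid_control us" "0 \<le> t" "t \<le> duration us"
  obtains us1 us2 where "valid_control us1" "valid_control us2" "duration us1 = t"
    "equivalent_control us (us1 @ us2)"
proof -
  have "\<exists>us1 us2. valid_control us1 \<and> valid_control us2 \<and> duration us1 = t \<and>
      equivalent_control us (us1 @ us2)"
    using assms
  proof (induction us arbitrary: t)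
    case Nil
    then show ?case by (intro exI[of _ "[]"]) (auto simp: equivalent_control_def)
  next
    case (Cons p us)
    obtain h v where p: "p = (h, v)" by fastforce
    show ?case
    proof (cases "t \<le> h")
      case True
      then show ?thesis
        using Cons.prems p equivalent_control_split[of t h v us]
        by (intro exI[of _ "[(t, v)]"] exI[of _ "(h - t, v) # us"]) auto
    next
      case False
      then obtain us1 us2 where "valid_control us1" "valid_control us2" "duration us1 = t - h"
        "equivalent_control us (us1 @ us2)"
        using Cons.IH[of "t - h"] Cons.prems p by auto
      then show ?thesis
        using Cons.prems p equivalent_control_Cons[of us "us1 @ us2" p]
        by (intro exI[of _ "p # us1"] exI[of _ us2]) auto
    qed
  qed
  then show ?thesis using that by blast
qed

lemma equivalent_control_null:
  "valid_control us \<Longrightarrow> duration us = 0 \<Longrightarrow> equivalent_control us []"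
proof (induction us)
  case (Cons p us)
  obtain h v where p: "p = (h, v)" by fastforce
  have "h = 0" "duration us = 0" using Cons.prems p duration_nonneg[of us] by auto
  then have "equivalent_control us []" "h = 0" using Cons p by auto
  then show ?case by (auto simp: equivalent_control_def p flow_zero)
qed (simp add: equivalent_control_def)

text \<open>The longer of the two leading pieces is split, so that one list loses its head while the
  other keeps its length. With common break points, controls can be added and subtracted piece by
  piece.\<close>

lemma common_refinement:
  assumes "valid_control us" "valid_control vs" "duration us = duration vs"
  obtains ws :: "(real \<times> 'u \<times> 'u) list" where "\<And>h v w. (h, v, w) \<in> set ws \<Longrightarrow> 0 \<le> h"
    "equivalent_control us (map (\<lambda>(h, v, w). (h, v)) ws)"
    "equivalent_control vs (map (\<lambda>(h, v, w). (h, w)) ws)"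
proof -
  have "\<exists>ws :: (real \<times> 'u \<times> 'u) list. (\<forall>(h, v, w)\<in>set ws. 0 \<le> h) \<and>
      equivalent_control us (map (\<lambda>(h, v, w). (h, v)) ws) \<and>
      equivalent_control vs (map (\<lambda>(h, v, w). (h, w)) ws)"
    using assms
  proof (induction "length us + length vs" arbitrary: us vs rule: less_induct)
    case less
    show ?case
    proof (cases "us = [] \<or> vs = []")
      case True
      \<comment> \<open>One list is exhausted; the other may still contain pieces of length 0, which
        have no effect.\<close>
      then have "duration us = 0" "duration vs = 0" using less.prems by auto
      then show ?thesis using less.prems equivalent_control_null
        by (intro exI[of _ "[]"]) auto
    next
      case False
      then obtain h v us' k w vs' where us: "us = (h, v) # us'" and vs: "vs = (k, w) # vs'"
        by (metis list.exhaust surj_pair)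
      show ?thesis
      proof (cases "h \<le> k")
        case True
        obtain ws where ws: "\<forall>(h, v, w)\<in>set ws. 0 \<le> h"
          "equivalent_control us' (map (\<lambda>(h, v, w). (h, v)) ws)"
          "equivalent_control ((k - h, w) # vs') (map (\<lambda>(h, v, w). (h, w)) ws)"
          using less.hyps[of us' "(k - h, w) # vs'"] less.prems True unfolding us vs by auto
        have "equivalent_control us (map (\<lambda>(h, v, w). (h, v)) ((h, v, w) # ws))"
          using equivalent_control_Cons[OF ws(2)] us by simp
        moreover have "equivalent_control vs (map (\<lambda>(h, v, w). (h, w)) ((h, v, w) # ws))"
          using equivalent_control_trans[OF equivalent_control_split[of h k w vs'] equivalent_control_Cons[OF ws(3), of "(h, w)"]]
            less.prems True us vs by simp
        ultimately show ?thesis using ws(1) less.prems us by (intro exI[of _ "(h, v, w) # ws"]) auto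
      next
        case False
        obtain ws where ws: "\<forall>(h, v, w)\<in>set ws. 0 \<le> h"
          "equivalent_control ((h - k, v) # us') (map (\<lambda>(h, v, w). (h, v)) ws)"
          "equivalent_control vs' (map (\<lambda>(h, v, w). (h, w)) ws)"
          using less.hyps[of "(h - k, v) # us'" vs'] less.prems False unfolding us vs by auto
        have "equivalent_control vs (map (\<lambda>(h, v, w). (h, w)) ((k, v, w) # ws))"
          using equivalent_control_Cons[OF ws(3)] vs by simp
        moreover have "equivalent_control us (map (\<lambda>(h, v, w). (h, v)) ((k, v, w) # ws))"
          using equivalent_control_trans[OF equivalent_control_split[of k h v us'] equivalent_control_Cons[OF ws(2), of "(k, v)"]]
            less.prems False us vs by simp
        ultimately show ?thesis using ws(1) less.prems vs by (intro exI[of _ "(k, v, w) # ws"]) auto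
      qed
    qed
  qed
  then show ?thesis using that by blast
qed

section \<open>The cost as a quadratic form in state and control\<close>

lemma flow_linear:
  assumes "0 \<le> h"
  shows "flow (x + y) h (z + z') = flow x h z + flow y h z'"
    and "flow (x - y) h (z - z') = flow x h z - flow y h z'"
  using assms linear_diff[OF linear_orbit_integral]
  by (auto simp: flow_def T_plus T_diff orbit_integral_plus)

definition total_cost :: "real \<Rightarrow> 'x \<Rightarrow> (real \<times> 'u) list \<Rightarrow> real" where
  "total_cost K x us = running_cost x us + K * (norm (state x us))\<^sup>2"

lemma total_cost_Nil: "total_cost K x [] = K * (norm x)\<^sup>2"
  by (simp add: total_cost_def)

lemma total_cost_append: "total_cost K x (us @ vs) = running_cost x us + total_cost K (state x us) vs"
  by (simp add: total_cost_def running_cost_append state_append)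

lemma total_cost_cong: "equivalent_control us vs \<Longrightarrow> total_cost K x us = total_cost K x vs"
  by (simp add: total_cost_def equivalent_control_def)

text \<open>State and control enter the trajectory linearly, so each term of the cost is a multiple
  or an integral of the squared norm of a linear expression and inherits the parallelogram
  law.\<close>

lemma total_cost_parallelogram:
  assumes "\<And>h v w. (h, v, w) \<in> set ws \<Longrightarrow> 0 \<le> h"
  shows "total_cost K (x + y) (map (\<lambda>(h, v, w). (h, v + w)) ws) +
      total_cost K (x - y) (map (\<lambda>(h, v, w). (h, v - w)) ws) =
      2 * total_cost K x (map (\<lambda>(h, v, w). (h, v)) ws) + 2 * total_cost K y (map (\<lambda>(h, v, w). (h, w)) ws)"
  using assms
proof (induction ws arbitrary: x y)
  case Nil
  have "K * ((norm (x + y))\<^sup>2 + (norm (x - y))\<^sup>2) = K * (2 * (norm x)\<^sup>2 + 2 * (norm y)\<^sup>2)"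
    by (simp only: norm_parallelogram)
  then show ?case by (simp add: total_cost_Nil distrib_left mult.left_commute)
next
  case (Cons p ws)
  obtain h v w where p: "p = (h, v, w)" using prod_cases3 by blast
  have h: "0 \<le> h" using Cons.prems p by auto
  have prems: "0 \<le> h" if "(h, v, w) \<in> set ws" for h v w
    using Cons.prems[of h v w] that by simp
  have IH: "total_cost K (x + y) (map (\<lambda>(h, v, w). (h, v + w)) ws) +
      total_cost K (x - y) (map (\<lambda>(h, v, w). (h, v - w)) ws) =
      2 * total_cost K x (map (\<lambda>(h, v, w). (h, v)) ws) + 2 * total_cost K y (map (\<lambda>(h, v, w). (h, w)) ws)" for x y
    by (rule Cons.IH) (rule prems)
  have step: "total_cost K z ((h, v) # us) = integral {0..h} (\<lambda>s. (norm (flow z s (B v)))\<^sup>2) + h * (norm v)\<^sup>2 +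
      total_cost K (flow z h (B v)) us" for z v us
    by (simp add: total_cost_def)
  let ?i = "\<lambda>z v. integral {0..h} (\<lambda>s. (norm (flow z s (B v)))\<^sup>2)"
  have "((\<lambda>s. (norm (flow (x + y) s (B (v + w))))\<^sup>2 + (norm (flow (x - y) s (B (v - w))))\<^sup>2)
      has_integral ?i (x + y) (v + w) + ?i (x - y) (v - w)) {0..h}"
    by (intro has_integral_add has_integral_flow_cost)
  moreover have "((\<lambda>s. (norm (flow (x + y) s (B (v + w))))\<^sup>2 + (norm (flow (x - y) s (B (v - w))))\<^sup>2)
      has_integral 2 * ?i x v + 2 * ?i y w) {0..h}"
    by (rule has_integral_eq[OF _ has_integral_add[OF has_integral_mult_right[OF has_integral_flow_cost]
          has_integral_mult_right[OF has_integral_flow_cost]]])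
      (simp add: flow_linear B_simps norm_parallelogram)
  ultimately have i: "?i (x + y) (v + w) + ?i (x - y) (v - w) = 2 * ?i x v + 2 * ?i y w"
    by (rule has_integral_unique)
  have "h * ((norm (v + w))\<^sup>2 + (norm (v - w))\<^sup>2) = h * (2 * (norm v)\<^sup>2 + 2 * (norm w)\<^sup>2)"
    by (simp only: norm_parallelogram)
  then have n: "h * (norm (v + w))\<^sup>2 + h * (norm (v - w))\<^sup>2 = 2 * (h * (norm v)\<^sup>2) + 2 * (h * (norm w)\<^sup>2)"
    by (simp add: distrib_left mult.left_commute)
  show ?case
    using IH[of "flow x h (B v)" "flow y h (B w)"] i n h
    by (simp add: p step flow_linear B_simps)
qed

lemma state_eq: "valid_control us \<Longrightarrow> state x us = T (duration us) x + state 0 us"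
proof (induction us arbitrary: x)
  case Nil
  then show ?case by (simp add: T_zero)
next
  case (Cons p us)
  obtain h v where p: "p = (h, v)" by fastforce
  have h: "0 \<le> h" "valid_control us" "0 \<le> duration us" using Cons.prems p duration_nonneg by auto
  have "state x (p # us) = T (duration us) (flow x h (B v)) + state 0 us"
    using Cons.IH[of "flow x h (B v)"] h p by simp
  moreover have "state 0 (p # us) = T (duration us) (flow 0 h (B v)) + state 0 us"
    using Cons.IH[of "flow 0 h (B v)"] h p by simp
  ultimately show ?case
    using h T_add[of "duration us" h x] by (simp add: p flow_def T_plus T_of_zero add.commute)
qed

lemma state_zero_Cons:
  "valid_control ((h, v) # us) \<Longrightarrow> state 0 ((h, v) # us) = T (duration us) (orbit_integral h (B v)) + state 0 us"
  using state_eq[of us "flow 0 h (B v)"] by (simp add: flow_def T_of_zero)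

section \<open>Estimates on a time interval where the semigroup is bounded by
  \<open>M\<close>\<close>

context
  fixes b M \<beta> :: real
  assumes M: "\<And>s z. s \<in> {0..b} \<Longrightarrow> norm (T s z) \<le> M * norm z" and M0: "0 \<le> M"
    and \<beta>: "\<And>v. norm (B v) \<le> \<beta> * norm v" and \<beta>0: "0 \<le> \<beta>"
begin

lemma norm_T_B_le: "s \<in> {0..b} \<Longrightarrow> norm (T s (B v)) \<le> M * \<beta> * norm v"
  using order_trans[OF M mult_left_mono[OF \<beta> M0]] by (simp add: mult.assoc)

lemma norm_T_orbit_integral_B_le:
  assumes "0 \<le> a" "0 \<le> h" "a + h \<le> b"
  shows "norm (T a (orbit_integral h (B v))) \<le> M * \<beta> * (h * norm v)"
  using norm_T_orbit_integral_le[OF assms(1,2), of "B v" "M * \<beta> * norm v"] norm_T_B_le assms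
  by (auto simp: algebra_simps)

lemma norm_state_zero_le:
  "valid_control us \<Longrightarrow> duration us \<le> b \<Longrightarrow> norm (state 0 us) \<le> M * \<beta> * control_L1 us"
proof (induction us)
  case (Cons p us)
  obtain h v where p: "p = (h, v)" by fastforce
  have v: "0 \<le> h" "valid_control us" "0 \<le> duration us" using Cons.prems p duration_nonneg by auto
  have "norm (state 0 (p # us)) \<le> norm (T (duration us) (orbit_integral h (B v))) + norm (state 0 us)"
    using Cons.prems p state_zero_Cons[of h v us] by (simp add: norm_triangle_ineq del: state.simps)
  also have "\<dots> \<le> M * \<beta> * (h * norm v) + M * \<beta> * control_L1 us"
    using Cons p v by (intro add_mono norm_T_orbit_integral_B_le) auto
  finally show ?case by (simp add: p algebra_simps)
qed simp

text \<open>The trajectory stays within \<open>D\<close> of \<open>z\<close>: a piece moves it by at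
  most \<open>M * \<beta> * (h * norm v)\<close>, an amount that the induction transfers from the L1
  budget to \<open>R\<close>. Applied with \<open>z = 0\<close> for crude upper bounds and with
  \<open>z = x\<close> for a lower bound over short times.\<close>

lemma running_cost_bounds:
  assumes "valid_control us" "duration us \<le> b"
    and "\<And>s. s \<in> {0..duration us} \<Longrightarrow> norm (T s x - z) \<le> R"
    and "R + M * \<beta> * control_L1 us \<le> D"
    and "\<And>y. norm (y - z) \<le> D \<Longrightarrow> l \<le> (norm y)\<^sup>2 \<and> (norm y)\<^sup>2 \<le> r"
  shows "control_energy us + duration us * l \<le> running_cost x us \<and>
    running_cost x us \<le> control_energy us + duration us * r"
  using assms(1-4)
proof (induction us arbitrary: x R)
  case (Cons p us)
  obtain h v where p: "p = (h, v)" by fastforce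
  have v: "0 \<le> h" "valid_control us" "0 \<le> duration us" "0 \<le> control_L1 us"
    using Cons.prems p duration_nonneg control_L1_nonneg by auto
  have hb: "h + duration us \<le> b" using Cons.prems p by simp
  let ?x = "flow x h (B v)" and ?c = "M * \<beta> * (h * norm v)"
  have c0: "0 \<le> M * \<beta> * control_L1 us" using M0 \<beta>0 v by simp
  have D: "R + ?c + M * \<beta> * control_L1 us \<le> D" using Cons.prems(4) by (simp add: p algebra_simps)
  have IH: "control_energy us + duration us * l \<le> running_cost ?x us \<and>
      running_cost ?x us \<le> control_energy us + duration us * r"
  proof (rule Cons.IH[where R = "R + ?c"])
    fix s assume s: "s \<in> {0..duration us}"
    then have "T s ?x - z = (T (s + h) x - z) + T s (orbit_integral h (B v))"
      using v by (simp add: flow_def T_plus T_add)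
    then have "norm (T s ?x - z) \<le> norm (T (s + h) x - z) + norm (T s (orbit_integral h (B v)))"
      by (simp only: norm_triangle_ineq)
    moreover have "norm (T (s + h) x - z) \<le> R" using Cons.prems(3)[of "s + h"] s v p by simp
    moreover have "norm (T s (orbit_integral h (B v))) \<le> ?c"
      using s v hb by (intro norm_T_orbit_integral_B_le) auto
    ultimately show "norm (T s ?x - z) \<le> R + ?c" by linarith
  qed (use v hb D in auto)
  have piece: "l \<le> (norm (flow x s (B v)))\<^sup>2 \<and> (norm (flow x s (B v)))\<^sup>2 \<le> r" if s: "s \<in> {0..h}" for s
  proof (rule assms(5))
    have "norm (T 0 (orbit_integral s (B v))) \<le> M * \<beta> * (s * norm v)"
      using s v hb by (intro norm_T_orbit_integral_B_le) auto
    also have "\<dots> \<le> ?c" using s M0 \<beta>0 by (intro mult_left_mono mult_right_mono) auto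
    finally have 1: "norm (orbit_integral s (B v)) \<le> ?c" by (simp add: T_zero)
    have 2: "norm (T s x - z) \<le> R" using Cons.prems(3)[of s] s v p by simp
    have "flow x s (B v) - z = (T s x - z) + orbit_integral s (B v)" by (simp add: flow_def)
    then have "norm (flow x s (B v) - z) \<le> norm (T s x - z) + norm (orbit_integral s (B v))"
      by (simp only: norm_triangle_ineq)
    then show "norm (flow x s (B v) - z) \<le> D" using 1 2 D c0 by linarith
  qed
  let ?i = "integral {0..h} (\<lambda>s. (norm (flow x s (B v)))\<^sup>2)"
  have "((\<lambda>s. l) has_integral h * l) {0..h}" "((\<lambda>s. r) has_integral h * r) {0..h}"
    using has_integral_const_real[of l 0 h] has_integral_const_real[of r 0 h] v by auto
  then have "h * l \<le> ?i" "?i \<le> h * r"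
    using piece by (auto intro: has_integral_le[OF _ has_integral_flow_cost] has_integral_le[OF has_integral_flow_cost])
  with IH show ?case by (simp add: p algebra_simps)
qed simp

text \<open>Over short times the state driven from 0 should be close to the integral of
  \<open>B u\<close>, but \<open>T s\<close> need not be close to the identity in operator norm.
  Tested against \<open>\<phi>\<close> this does no harm, provided \<open>\<phi> \<circ> T s\<close>
  is close to \<open>\<phi>\<close> in norm.\<close>

lemma functional_state_zero:
  assumes "bounded_linear \<phi>" "\<And>s z. s \<in> {0..b} \<Longrightarrow> \<bar>\<phi> (T s z) - \<phi> z\<bar> \<le> \<eta> * norm z"
    and "0 \<le> \<eta>" "valid_control us" "duration us \<le> b"
  shows "\<bar>\<phi> (state 0 us) - (\<Sum>(h, v)\<leftarrow>us. h * \<phi> (B v))\<bar> \<le> \<eta> * \<beta> * control_L1 us"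
  using assms(4,5)
proof (induction us)
  case Nil
  then show ?case using linear_0[OF bounded_linear.linear[OF assms(1)]] by simp
next
  case (Cons p us)
  obtain h v where p: "p = (h, v)" by fastforce
  have v: "0 \<le> h" "valid_control us" "0 \<le> duration us" using Cons.prems p duration_nonneg by auto
  have hb: "h + duration us \<le> b" using Cons.prems p by simp
  let ?y = "T (duration us) (orbit_integral h (B v))"
  have "((\<lambda>s. \<phi> (T (duration us + s) (B v))) has_integral \<phi> ?y) {0..h}"
    using has_integral_linear[OF has_integral_orbit_T[of "duration us" h] assms(1)] v by (simp add: o_def)
  from has_integral_diff[OF this has_integral_const_real[of "\<phi> (B v)" 0 h]]
  have "((\<lambda>s. \<phi> (T (duration us + s) (B v)) - \<phi> (B v)) has_integral (\<phi> ?y - h * \<phi> (B v))) {0..h}"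
    using v by simp
  then have "norm (\<phi> ?y - h * \<phi> (B v)) \<le> (h - 0) * (\<eta> * \<beta> * norm v)"
  proof (rule has_integral_norm_le)
    fix s assume s: "s \<in> {0..h}"
    have "\<bar>\<phi> (T (duration us + s) (B v)) - \<phi> (B v)\<bar> \<le> \<eta> * norm (B v)"
      using s v hb by (intro assms(2)) auto
    also have "\<dots> \<le> \<eta> * (\<beta> * norm v)" by (intro mult_left_mono \<beta> assms(3))
    finally show "norm (\<phi> (T (duration us + s) (B v)) - \<phi> (B v)) \<le> \<eta> * \<beta> * norm v" by (simp add: mult.assoc)
  qed (use v in auto)
  moreover have "\<phi> (state 0 (p # us)) = \<phi> ?y + \<phi> (state 0 us)"
    using state_zero_Cons[of h v us] Cons.prems p linear_add[OF bounded_linear.linear[OF assms(1)]]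
    by (simp del: state.simps)
  ultimately show ?case using Cons.IH v hb by (simp add: p algebra_simps del: state.simps)
qed

end

end

section \<open>Uniform steering\<close>

context input_system
begin

abbreviation steering_integral :: "real \<Rightarrow> (real \<Rightarrow> 'u) \<Rightarrow> 'x" where
  "steering_integral \<tau> v \<equiv> integral {0..\<tau>} (\<lambda>s. T (\<tau> - s) (B (v s)))"

lemma continuous_on_steering: "continuous_on {0..\<tau>} v \<Longrightarrow> continuous_on {0..\<tau>} (\<lambda>s. T (\<tau> - s) (B (v s)))"
  by (intro continuous_on_convolution_integrand bounded_linear.continuous_on[OF bounded_linear_B])

lemma has_integral_steering:
  "continuous_on {0..\<tau>} v \<Longrightarrow> ((\<lambda>s. T (\<tau> - s) (B (v s))) has_integral steering_integral \<tau> v) {0..\<tau>}"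
  by (intro integrable_integral integrable_continuous_interval continuous_on_steering)

text \<open>The control is built from the right end, \<open>m\<close> counting the last intervals of
  length \<open>h\<close>: prefixing a piece leaves the contribution of the later ones to the final
  state unchanged, so the errors simply add up.\<close>

lemma piecewise_constant_approx_aux:
  assumes v: "continuous_on {0..\<tau>} v"
    and M: "\<And>s z. s \<in> {0..\<tau>} \<Longrightarrow> norm (T s z) \<le> M * norm z" "0 \<le> M"
    and \<beta>: "\<And>v. norm (B v) \<le> \<beta> * norm v" "0 \<le> \<beta>"
    and osc: "\<And>s s'. s \<in> {0..\<tau>} \<Longrightarrow> s' \<in> {0..\<tau>} \<Longrightarrow> \<bar>s - s'\<bar> \<le> h \<Longrightarrow>
      norm (v s - v s') \<le> \<epsilon> \<and> (norm (v s))\<^sup>2 \<le> (norm (v s'))\<^sup>2 + \<epsilon>"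
    and h: "0 \<le> h" and m: "real m * h \<le> \<tau>"
  shows "\<exists>us. valid_control us \<and> duration us = real m * h \<and>
    norm (state 0 us - integral {\<tau> - real m * h..\<tau>} (\<lambda>s. T (\<tau> - s) (B (v s)))) \<le> real m * h * (M * \<beta> * \<epsilon>) \<and>
    control_energy us \<le> integral {\<tau> - real m * h..\<tau>} (\<lambda>s. (norm (v s))\<^sup>2) + real m * h * \<epsilon>"
  using m
proof (induction m)
  case 0
  show ?case by (intro exI[of _ "[]"]) simp
next
  case (Suc m)
  \<comment> \<open>The new piece covers \<open>{a..c}\<close> and takes the value of
    \<open>v\<close> at its left end.\<close>
  define a c where "a = \<tau> - real (Suc m) * h" and "c = \<tau> - real m * h"
  have ac: "0 \<le> a" "a + h = c" "c \<le> \<tau>" "0 \<le> c" and mh: "0 \<le> real m * h"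
    using Suc.prems h by (auto simp: a_def c_def algebra_simps)
  let ?w = "\<lambda>s. T (\<tau> - s) (B (v s))" and ?q = "\<lambda>s. (norm (v s))\<^sup>2" and ?z = "B (v a)"
  have wi: "?w integrable_on {p..q}" if "0 \<le> p" "q \<le> \<tau>" for p q
    using that by (intro integrable_continuous_interval continuous_on_subset[OF continuous_on_steering[OF v]]) auto
  have qi: "?q integrable_on {p..q}" if "0 \<le> p" "q \<le> \<tau>" for p q
    using that by (intro integrable_continuous_interval continuous_on_power continuous_on_norm continuous_on_subset[OF v]) auto
  have w_split: "integral {a..\<tau>} ?w = integral {a..c} ?w + integral {c..\<tau>} ?w"
    and q_split: "integral {a..\<tau>} ?q = integral {a..c} ?q + integral {c..\<tau>} ?q"
    using ac h by (auto intro!: Henstock_Kurzweil_Integration.integral_combine[symmetric] wi qi)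
  have "real m * h \<le> \<tau>" using ac(4) by (simp add: c_def)
  from Suc.IH[OF this, folded c_def] obtain us where us: "valid_control us" "duration us = real m * h"
    "norm (state 0 us - integral {c..\<tau>} ?w) \<le> real m * h * (M * \<beta> * \<epsilon>)"
    "control_energy us \<le> integral {c..\<tau>} ?q + real m * h * \<epsilon>"
    by blast
  let ?y = "T (real m * h) (orbit_integral h ?z)"
  have osc': "norm (v a - v s) \<le> \<epsilon> \<and> (norm (v a))\<^sup>2 \<le> (norm (v s))\<^sup>2 + \<epsilon>" if "s \<in> {a..c}" for s
    using that ac h by (intro osc) auto
  have "((\<lambda>s. T (c - s) ?z) has_integral orbit_integral h ?z) {a..c}"
    using has_integral_convolution_const[of c ?z a] unfolding ac(2)[symmetric] by simp
  from has_integral_linear[OF this bounded_linear_T[OF mh]]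
  have "((\<lambda>s. T (real m * h) (T (c - s) ?z)) has_integral ?y) {a..c}" by (simp add: o_def)
  then have "((\<lambda>s. T (\<tau> - s) ?z) has_integral ?y) {a..c}"
  proof (rule has_integral_eq[rotated])
    fix s assume "s \<in> {a..c}"
    then show "T (real m * h) (T (c - s) ?z) = T (\<tau> - s) ?z"
      using T_add[of "real m * h" "c - s" ?z] mh by (simp add: c_def)
  qed
  then have "((\<lambda>s. T (\<tau> - s) ?z - ?w s) has_integral (?y - integral {a..c} ?w)) {a..c}"
    using ac by (intro has_integral_diff integrable_integral wi) auto
  then have "norm (?y - integral {a..c} ?w) \<le> (c - a) * (M * \<beta> * \<epsilon>)"
  proof (rule has_integral_norm_le)
    fix s assume s: "s \<in> {a..c}"
    have "T (\<tau> - s) ?z - ?w s = T (\<tau> - s) (B (v a - v s))" using s ac by (simp add: T_diff B_simps)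
    also have "norm \<dots> \<le> M * \<beta> * norm (v a - v s)"
      using s ac by (intro norm_T_B_le[OF M \<beta>]) auto
    also have "\<dots> \<le> M * \<beta> * \<epsilon>" using osc'[OF s] M \<beta> by (intro mult_left_mono) auto
    finally show "norm (T (\<tau> - s) ?z - ?w s) \<le> M * \<beta> * \<epsilon>" .
  qed (use ac h in auto)
  moreover have "state 0 ((h, v a) # us) = ?y + state 0 us"
    using state_zero_Cons[of h "v a" us] us h by (simp del: state.simps)
  then have "state 0 ((h, v a) # us) - integral {a..\<tau>} ?w =
      (?y - integral {a..c} ?w) + (state 0 us - integral {c..\<tau>} ?w)"
    by (simp add: w_split)
  then have "norm (state 0 ((h, v a) # us) - integral {a..\<tau>} ?w) \<le>
      norm (?y - integral {a..c} ?w) + norm (state 0 us - integral {c..\<tau>} ?w)"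
    by (simp only: norm_triangle_ineq)
  ultimately have 1: "norm (state 0 ((h, v a) # us) - integral {a..\<tau>} ?w) \<le> real (Suc m) * h * (M * \<beta> * \<epsilon>)"
    using us(3) unfolding ac(2)[symmetric] by (simp add: algebra_simps)
  have "((\<lambda>s. (norm (v a))\<^sup>2 - \<epsilon>) has_integral h * ((norm (v a))\<^sup>2 - \<epsilon>)) {a..c}"
    using has_integral_const_real[of "(norm (v a))\<^sup>2 - \<epsilon>" a c] h unfolding ac(2)[symmetric] by simp
  then have "h * ((norm (v a))\<^sup>2 - \<epsilon>) \<le> integral {a..c} ?q"
    by (rule has_integral_le) (use qi ac osc' in \<open>auto simp: integrable_integral diff_le_eq\<close>)
  then have 2: "control_energy ((h, v a) # us) \<le> integral {a..\<tau>} ?q + real (Suc m) * h * \<epsilon>"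
    using us(4) by (simp add: q_split algebra_simps)
  show ?case
    using 1 2 us h unfolding a_def[symmetric]
    by (intro exI[of _ "(h, v a) # us"]) (simp add: algebra_simps del: state.simps)
qed

lemma piecewise_constant_approx:
  assumes v: "continuous_on {0..\<tau>} v" and \<tau>: "\<tau> > 0" and e: "e > 0"
  obtains us where "valid_control us" "duration us = \<tau>"
    "norm (state x us - (T \<tau> x + steering_integral \<tau> v)) \<le> e"
    "control_energy us \<le> integral {0..\<tau>} (\<lambda>s. (norm (v s))\<^sup>2) + e"
proof -
  obtain M where M: "M \<ge> 1" "\<And>s z. s \<in> {0..\<tau>} \<Longrightarrow> norm (T s z) \<le> M * norm z"
    using T_bounded_on_interval by blast
  obtain \<beta> where \<beta>: "\<beta> > 0" "\<And>z. norm (B z) \<le> \<beta> * norm z"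
    using bounded_linear.pos_bounded[OF bounded_linear_B] by (auto simp: mult.commute)
  \<comment> \<open>Chosen so that the error \<open>\<tau> * (M * \<beta> * \<epsilon>)\<close> of
    the state and the excess \<open>\<tau> * \<epsilon>\<close> of the energy add up to
    \<open>e\<close>.\<close>
  define \<epsilon> where "\<epsilon> = e / (\<tau> * (M * \<beta> + 1))"
  have pos: "M * \<beta> + 1 > 0" using M \<beta> by (simp add: add_pos_pos)
  have \<epsilon>: "\<epsilon> > 0" using e \<tau> pos by (simp add: \<epsilon>_def)
  have "\<tau> * (M * \<beta> + 1) * \<epsilon> = e" using \<tau> pos unfolding \<epsilon>_def by simp
  then have sum: "\<tau> * (M * \<beta> * \<epsilon>) + \<tau> * \<epsilon> = e" by (simp add: algebra_simps)
  have "0 \<le> \<tau> * (M * \<beta> * \<epsilon>)" "0 \<le> \<tau> * \<epsilon>" using \<tau> M \<beta> \<epsilon> by auto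
  then have le: "\<tau> * (M * \<beta> * \<epsilon>) \<le> e" "\<tau> * \<epsilon> \<le> e" using sum by linarith+
  have "uniformly_continuous_on {0..\<tau>} v" "uniformly_continuous_on {0..\<tau>} (\<lambda>s. (norm (v s))\<^sup>2)"
    by (intro compact_uniformly_continuous continuous_intros v compact_Icc)+
  then obtain d1 d2 where d: "d1 > 0" "d2 > 0"
    and d1: "\<And>s s'. s \<in> {0..\<tau>} \<Longrightarrow> s' \<in> {0..\<tau>} \<Longrightarrow> dist s s' < d1 \<Longrightarrow> dist (v s) (v s') < \<epsilon>"
    and d2: "\<And>s s'. s \<in> {0..\<tau>} \<Longrightarrow> s' \<in> {0..\<tau>} \<Longrightarrow> dist s s' < d2 \<Longrightarrow> dist ((norm (v s))\<^sup>2) ((norm (v s'))\<^sup>2) < \<epsilon>"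
    using \<epsilon> unfolding uniformly_continuous_on_def by metis
  obtain n where n: "\<tau> / min d1 d2 < real n" using reals_Archimedean2 by blast
  have n0: "real n > 0" using n d \<tau> by (intro le_less_trans[OF _ n]) auto
  define h where "h = \<tau> / real n"
  have h: "0 \<le> h" "real n * h = \<tau>" using \<tau> n0 by (auto simp: h_def)
  have "h < min d1 d2" using n n0 d by (simp add: h_def field_simps del: min_less_iff_conj)
  then have hd: "h < d1" "h < d2" by auto
  have osc: "norm (v s - v s') \<le> \<epsilon> \<and> (norm (v s))\<^sup>2 \<le> (norm (v s'))\<^sup>2 + \<epsilon>"
    if "s \<in> {0..\<tau>}" "s' \<in> {0..\<tau>}" "\<bar>s - s'\<bar> \<le> h" for s s'
    using d1[of s s'] d2[of s s'] that hd by (auto simp: dist_norm)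
  obtain us where us: "valid_control us" "duration us = \<tau>"
    "norm (state 0 us - steering_integral \<tau> v) \<le> \<tau> * (M * \<beta> * \<epsilon>)"
    "control_energy us \<le> integral {0..\<tau>} (\<lambda>s. (norm (v s))\<^sup>2) + \<tau> * \<epsilon>"
    using piecewise_constant_approx_aux[OF v M(2) _ \<beta>(2) _ osc h(1), of n] M \<beta> h by auto
  show ?thesis
  proof (rule that[OF us(1,2)])
    show "norm (state x us - (T \<tau> x + steering_integral \<tau> v)) \<le> e"
      using us(3) le(1) unfolding state_eq[OF us(1), of x] us(2) by simp
  qed (use us(4) le(2) in simp)
qed

end

text \<open>The bound \<open>A\<close> may depend on \<open>x\<close> but not on \<open>e\<close>;
  in this weak form null controllability survives the passage to continuous controls.\<close>

locale approx_null_controllable = input_system T B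
  for T :: "real \<Rightarrow> 'x::{real_inner,banach} \<Rightarrow> 'x" and B :: "'u::real_inner \<Rightarrow> 'x" +
  fixes t1 :: real
  assumes t1: "t1 > 0"
    and steer: "\<exists>A. \<forall>e>0. \<exists>v. continuous_on {0..t1} v \<and> integral {0..t1} (\<lambda>s. (norm (v s))\<^sup>2) \<le> A \<and>
      norm (T t1 x + integral {0..t1} (\<lambda>s. T (t1 - s) (B (v s)))) \<le> e"
begin

definition steers :: "'x \<Rightarrow> real \<Rightarrow> real \<Rightarrow> bool" where
  "steers x A e \<longleftrightarrow> (\<exists>v. continuous_on {0..t1} v \<and> integral {0..t1} (\<lambda>s. (norm (v s))\<^sup>2) \<le> A \<and>
      norm (T t1 x + steering_integral t1 v) \<le> e)"

lemma steers_scaleR: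
  assumes "steers x A e"
  shows "steers (r *\<^sub>R x) (r\<^sup>2 * A) (\<bar>r\<bar> * e)"
proof -
  obtain v where v: "continuous_on {0..t1} v" "integral {0..t1} (\<lambda>s. (norm (v s))\<^sup>2) \<le> A"
    "norm (T t1 x + steering_integral t1 v) \<le> e"
    using assms unfolding steers_def by blast
  have "((\<lambda>s. T (t1 - s) (B (r *\<^sub>R v s))) has_integral r *\<^sub>R steering_integral t1 v) {0..t1}"
    by (rule has_integral_eq[OF _ has_integral_cmul[OF has_integral_steering[OF v(1)]]])
      (simp add: B_simps T_scaleR)
  then have "T t1 (r *\<^sub>R x) + steering_integral t1 (\<lambda>s. r *\<^sub>R v s) = r *\<^sub>R (T t1 x + steering_integral t1 v)"
    using t1 by (simp add: integral_unique T_scaleR scaleR_add_right)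
  then have "norm (T t1 (r *\<^sub>R x) + steering_integral t1 (\<lambda>s. r *\<^sub>R v s)) \<le> \<bar>r\<bar> * e"
    using v(3) by (simp add: mult_left_mono)
  moreover have "integral {0..t1} (\<lambda>s. (norm (r *\<^sub>R v s))\<^sup>2) \<le> r\<^sup>2 * A"
    using v(2) by (simp add: power_mult_distrib mult_left_mono)
  ultimately show ?thesis
    unfolding steers_def using v(1) by (intro exI[of _ "\<lambda>s. r *\<^sub>R v s"]) (auto intro!: continuous_intros)
qed

lemma steers_diff:
  assumes "steers x A e" "steers y A' e'"
  shows "steers (x - y) (2 * A + 2 * A') (e + e')"
proof -
  obtain v where v: "continuous_on {0..t1} v" "integral {0..t1} (\<lambda>s. (norm (v s))\<^sup>2) \<le> A"
    "norm (T t1 x + steering_integral t1 v) \<le> e"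
    using assms(1) unfolding steers_def by blast
  obtain w where w: "continuous_on {0..t1} w" "integral {0..t1} (\<lambda>s. (norm (w s))\<^sup>2) \<le> A'"
    "norm (T t1 y + steering_integral t1 w) \<le> e'"
    using assms(2) unfolding steers_def by blast
  have "((\<lambda>s. T (t1 - s) (B (v s - w s))) has_integral steering_integral t1 v - steering_integral t1 w) {0..t1}"
    by (rule has_integral_eq[OF _ has_integral_diff[OF has_integral_steering[OF v(1)] has_integral_steering[OF w(1)]]])
      (simp add: B_simps T_diff)
  then have "T t1 (x - y) + steering_integral t1 (\<lambda>s. v s - w s) =
      (T t1 x + steering_integral t1 v) - (T t1 y + steering_integral t1 w)"
    using t1 by (simp add: integral_unique T_diff)
  then have "norm (T t1 (x - y) + steering_integral t1 (\<lambda>s. v s - w s)) \<le>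
      norm (T t1 x + steering_integral t1 v) + norm (T t1 y + steering_integral t1 w)"
    by (simp only: norm_triangle_ineq4)
  then have 1: "norm (T t1 (x - y) + steering_integral t1 (\<lambda>s. v s - w s)) \<le> e + e'"
    using v(3) w(3) by linarith
  have vi: "(\<lambda>s. (norm (v s))\<^sup>2) integrable_on {0..t1}" and wi: "(\<lambda>s. (norm (w s))\<^sup>2) integrable_on {0..t1}"
    and di: "(\<lambda>s. (norm (v s - w s))\<^sup>2) integrable_on {0..t1}"
    by (intro integrable_continuous_interval continuous_intros v w)+
  have "((\<lambda>s. 2 * (norm (v s))\<^sup>2 + 2 * (norm (w s))\<^sup>2) has_integral
      2 * integral {0..t1} (\<lambda>s. (norm (v s))\<^sup>2) + 2 * integral {0..t1} (\<lambda>s. (norm (w s))\<^sup>2)) {0..t1}"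
    by (intro has_integral_add has_integral_mult_right integrable_integral vi wi)
  from has_integral_le[OF integrable_integral[OF di] this]
  have "integral {0..t1} (\<lambda>s. (norm (v s - w s))\<^sup>2) \<le> 2 * A + 2 * A'"
    using norm_add_power2_le[of "v _" "- w _"] v(2) w(2) by simp
  with 1 show ?thesis
    unfolding steers_def using v w by (intro exI[of _ "\<lambda>s. v s - w s"]) (auto intro!: continuous_intros)
qed

text \<open>States that can be steered arbitrarily close to 0 with energy \<open>n\<close> form
  closed sets that cover the space, so one of these contains a ball. Differences move the ball to
  the origin, and homogeneity extends the estimate to all states.\<close>

lemma uniform_steering:
  obtains C where "C \<ge> 0" "\<And>x e. e > 0 \<Longrightarrow> steers x (C * (norm x)\<^sup>2) e"
proof -
  obtain M where M: "M \<ge> 1" "\<And>s z. s \<in> {0..t1} \<Longrightarrow> norm (T s z) \<le> M * norm z"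
    using T_bounded_on_interval by blast
  define C where "C n = {x. \<forall>e>0. steers x (real n) e}" for n
  have "closed (C n)" for n
  proof -
    have "x \<in> C n" if x: "x \<in> closure (C n)" for x
      unfolding C_def
    proof (intro CollectI allI impI)
      fix e :: real assume e: "e > 0"
      then have "e / (2 * M) > 0" using M by simp
      then obtain y where y: "y \<in> C n" "dist y x < e / (2 * M)"
        using x unfolding closure_approachable by blast
      \<comment> \<open>A control for the nearby state \<open>y\<close> is used unchanged for
        \<open>x\<close>: the energy is the same, and the end points differ by
        \<open>T t1 (x - y)\<close>.\<close>
      have "steers y (real n) (e / 2)" using y(1) e unfolding C_def by simp
      then obtain v where v: "continuous_on {0..t1} v" "integral {0..t1} (\<lambda>s. (norm (v s))\<^sup>2) \<le> real n"
        "norm (T t1 y + steering_integral t1 v) \<le> e / 2"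
        unfolding steers_def by blast
      have "norm (T t1 (x - y)) \<le> M * norm (x - y)" using M t1 by simp
      also have "\<dots> \<le> e / 2" using y(2) M by (simp add: dist_norm norm_minus_commute field_simps)
      finally have "norm (T t1 (x - y)) + norm (T t1 y + steering_integral t1 v) \<le> e" using v(3) by simp
      moreover have "T t1 x + steering_integral t1 v = T t1 (x - y) + (T t1 y + steering_integral t1 v)"
        using t1 by (simp add: T_diff)
      ultimately have "norm (T t1 x + steering_integral t1 v) \<le> e"
        by (simp only: norm_triangle_le)
      then show "steers x (real n) e" unfolding steers_def using v by blast
    qed
    then show ?thesis using closure_subset_eq by blast
  qed
  moreover have "(\<Union>n. C n) = UNIV"
  proof -
    have "\<exists>n. x \<in> C n" for x
    proof -
      obtain A where A: "\<And>e. e > 0 \<Longrightarrow> steers x A e" using steer[of x] unfolding steers_def by blast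
      obtain n where "A \<le> real n" using real_arch_simple by blast
      then have "x \<in> C n" using A unfolding C_def steers_def by (blast intro: order_trans)
      then show ?thesis ..
    qed
    then show ?thesis by blast
  qed
  ultimately obtain n x0 r where r: "r > 0" "ball x0 r \<subseteq> C n"
    using Baire_closed_cover by metis
  have small: "steers z (4 * real n) e" if "norm z < r" "e > 0" for z e
  proof -
    have "x0 + z \<in> C n" "x0 \<in> C n" using r that by (auto simp: subset_eq dist_norm)
    then have "steers (x0 + z) (real n) (e / 2)" "steers x0 (real n) (e / 2)"
      using that unfolding C_def by auto
    from steers_diff[OF this] show ?thesis by simp
  qed
  show ?thesis
  proof (rule that)
    \<comment> \<open>Scaling \<open>x\<close> to norm \<open>r / 2\<close> and back multiplies the
      energy \<open>4 * real n\<close> by \<open>(2 * norm x / r)\<^sup>2\<close>, which explains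
      the 16.\<close>
    show "0 \<le> 16 * real n / r\<^sup>2" by simp
    fix x :: 'x and e :: real assume e: "e > 0"
    show "steers x (16 * real n / r\<^sup>2 * (norm x)\<^sup>2) e"
    proof (cases "x = 0")
      case True
      have "steering_integral t1 (\<lambda>_. 0) = 0"
        by (intro integral_unique has_integral_is_0) (simp add: B_simps T_of_zero)
      then show ?thesis using True t1 e unfolding steers_def
        by (intro exI[of _ "\<lambda>_. 0"]) (simp add: T_of_zero)
    next
      case False
      define c where "c = r / (2 * norm x)"
      have c: "c > 0" using r False by (simp add: c_def)
      have "norm (c *\<^sub>R x) < r" using r False by (simp add: c_def)
      from steers_scaleR[OF small[OF this, of "e * c"], of "1 / c"] c e
      have "steers x ((1 / c)\<^sup>2 * (4 * real n)) e" by simp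
      moreover have "(1 / c)\<^sup>2 * (4 * real n) = 16 * real n / r\<^sup>2 * (norm x)\<^sup>2"
        by (simp add: c_def power_divide power_mult_distrib)
      ultimately show ?thesis by metis
    qed
  qed
qed

text \<open>Halving the state divides its squared norm by 4. If the running cost is at most
  \<open>K0 * (norm x)\<^sup>2\<close>, then with penalty \<open>2 * K0\<close> the total is at most
  3/2 of this, below the penalty saved by not stopping at once. Durations up to
  \<open>2 * t1\<close> are filled with the zero control, longer ones are reached by
  repetition.\<close>

lemma contracting_control:
  obtains K where "K \<ge> 0"
    "\<And>x \<tau>. t1 \<le> \<tau> \<Longrightarrow> \<exists>us. valid_control us \<and> duration us = \<tau> \<and> total_cost K x us \<le> K * (norm x)\<^sup>2"
proof -
  obtain C where C: "C \<ge> 0" "\<And>x e. e > 0 \<Longrightarrow> steers x (C * (norm x)\<^sup>2) e"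
    using uniform_steering by blast
  obtain M where M: "M \<ge> 1" "\<And>s z. s \<in> {0..2 * t1} \<Longrightarrow> norm (T s z) \<le> M * norm z"
    using T_bounded_on_interval by blast
  obtain \<beta> where \<beta>: "\<beta> > 0" "\<And>z. norm (B z) \<le> \<beta> * norm z"
    using bounded_linear.pos_bounded[OF bounded_linear_B] by (auto simp: mult.commute)
  \<comment> \<open>The trajectory is at most \<open>L * norm x\<close>: \<open>M\<close> stems from
    the initial state, the rest from the L1 norm of the control, estimated by Young's inequality
    with parameter \<open>norm x\<close> and energy
    \<open>(C + 1) * (norm x)\<^sup>2\<close>.\<close>
  define L where "L = M + M * \<beta> * ((t1 + (C + 1)) / 2)"
  define K0 where "K0 = (C + 1) + 2 * t1 * L\<^sup>2"
  have K0: "K0 \<ge> 0" using C t1 by (simp add: K0_def)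
  have short: "\<exists>us. valid_control us \<and> duration us = \<tau> \<and> total_cost (2 * K0) x us \<le> 2 * K0 * (norm x)\<^sup>2"
    if \<tau>: "t1 \<le> \<tau>" "\<tau> \<le> 2 * t1" for \<tau> x
  proof (cases "x = 0")
    \<comment> \<open>At \<open>x = 0\<close> the cost must vanish, so no positive error can be
      tolerated; the zero control works exactly.\<close>
    case True
    have "flow 0 s (B 0) = 0" if "0 \<le> s" for s
      using that linear_0[OF linear_orbit_integral] by (simp add: flow_def T_of_zero B_simps)
    then have "integral {0..\<tau>} (\<lambda>s. (norm (flow 0 s (B 0)))\<^sup>2) = 0" "flow 0 \<tau> (B 0) = 0"
      using \<tau> t1 by (auto intro!: integral_unique has_integral_is_0)
    then show ?thesis using True \<tau> t1
      by (intro exI[of _ "[(\<tau>, 0)]"]) (simp add: total_cost_def)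
  next
    case False
    let ?r = "norm x"
    have r: "?r > 0" using False by simp
    \<comment> \<open>The errors of steering and of passing to step functions together leave at most
      \<open>norm x / (2 * M)\<close>; the idle time after \<open>t1\<close> enlarges this by at
      most \<open>M\<close>. The bound by the squared norm keeps the excess of energy
      quadratic.\<close>
    define e where "e = min (?r / (2 * M)) (?r\<^sup>2) / 2"
    have e: "e > 0" "e \<le> ?r\<^sup>2" "e + e \<le> ?r / (2 * M)"
    proof -
      show "e > 0" using r M by (simp add: e_def)
      have "2 * e \<le> ?r / (2 * M)" "2 * e \<le> ?r\<^sup>2" by (simp_all add: e_def)
      then show "e + e \<le> ?r / (2 * M)" "e \<le> ?r\<^sup>2" using \<open>e > 0\<close> by simp_all
    qed
    obtain v where v: "continuous_on {0..t1} v" "integral {0..t1} (\<lambda>s. (norm (v s))\<^sup>2) \<le> C * ?r\<^sup>2"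
      "norm (T t1 x + steering_integral t1 v) \<le> e"
      using C(2)[OF e(1), of x] unfolding steers_def by blast
    obtain us where us: "valid_control us" "duration us = t1"
      "norm (state x us - (T t1 x + steering_integral t1 v)) \<le> e"
      "control_energy us \<le> integral {0..t1} (\<lambda>s. (norm (v s))\<^sup>2) + e"
      using piecewise_constant_approx[OF v(1) t1 e(1)] by blast
    have "norm (state x us) \<le> e + e"
      using us(3) v(3) norm_triangle_sub[of "state x us" "T t1 x + steering_integral t1 v"] by linarith
    then have end_le: "norm (state x us) \<le> ?r / (2 * M)" using e by linarith
    have energy: "control_energy us \<le> (C + 1) * ?r\<^sup>2"
      using us(4) v(2) e(2) by (simp add: algebra_simps)
    have L1: "control_L1 us \<le> (t1 + (C + 1)) / 2 * ?r"
    proof (rule mult_right_le_imp_le)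
      show "control_L1 us * (2 * ?r) \<le> (t1 + (C + 1)) / 2 * ?r * (2 * ?r)"
        using control_L1_young[OF us(1), of ?r] energy us(2)
        by (simp add: power2_eq_square algebra_simps)
    qed (use r in simp)
    define us' where "us' = us @ [(\<tau> - t1, 0)]"
    have us': "valid_control us'" "duration us' = \<tau>" "control_L1 us' = control_L1 us"
      "control_energy us' = control_energy us"
      using us \<tau> by (auto simp: us'_def)
    have "state x us' = T (\<tau> - t1) (state x us)"
      using linear_0[OF linear_orbit_integral] by (simp add: us'_def state_append flow_def B_simps)
    then have "norm (state x us') \<le> M * norm (state x us)" using M(2)[of "\<tau> - t1"] \<tau> by simp
    also have "\<dots> \<le> M * (?r / (2 * M))" using M(1) end_le by (intro mult_left_mono) auto
    also have "\<dots> = ?r / 2" using M(1) by simp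
    finally have "norm (state x us') \<le> ?r / 2" .
    then have "(norm (state x us'))\<^sup>2 \<le> (?r / 2)\<^sup>2" by (intro power_mono) auto
    then have end2: "2 * K0 * (norm (state x us'))\<^sup>2 \<le> 2 * K0 * (?r / 2)\<^sup>2"
      using K0 by (intro mult_left_mono) auto
    have "running_cost x us' \<le> control_energy us' + duration us' * (L * ?r)\<^sup>2"
    proof (rule conjunct2[OF running_cost_bounds[OF M(2) _ \<beta>(2) _ us'(1), where z = 0 and R = "M * ?r" and l = 0 and D = "L * ?r"]])
      show "norm (T s x - 0) \<le> M * ?r" if "s \<in> {0..duration us'}" for s
        using M(2)[of s x] that us' \<tau> by simp
      have "M * \<beta> * control_L1 us' \<le> M * \<beta> * ((t1 + (C + 1)) / 2 * ?r)"
        using L1 us' M \<beta> by (intro mult_left_mono) auto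
      then show "M * ?r + M * \<beta> * control_L1 us' \<le> L * ?r" by (simp add: L_def algebra_simps)
      show "0 \<le> (norm y)\<^sup>2 \<and> (norm y)\<^sup>2 \<le> (L * ?r)\<^sup>2" if "norm (y - 0) \<le> L * ?r" for y :: 'x
        using that by (auto intro: power_mono)
    qed (use M \<beta> us' \<tau> in auto)
    also have "\<dots> \<le> (C + 1) * ?r\<^sup>2 + 2 * t1 * (L * ?r)\<^sup>2"
      using us' energy \<tau> by (intro add_mono mult_right_mono) auto
    also have "\<dots> = K0 * ?r\<^sup>2" by (simp add: K0_def algebra_simps power_mult_distrib)
    finally have "total_cost (2 * K0) x us' \<le> K0 * ?r\<^sup>2 + 2 * K0 * (?r / 2)\<^sup>2"
      unfolding total_cost_def using end2 by simp
    also have "\<dots> \<le> 2 * K0 * ?r\<^sup>2" using K0 by (simp add: power_divide)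
    finally show ?thesis using us' by blast
  qed
  have long: "\<exists>us. valid_control us \<and> duration us = \<tau> \<and> total_cost (2 * K0) x us \<le> 2 * K0 * (norm x)\<^sup>2"
    if "t1 \<le> \<tau>" "\<tau> \<le> (real n + 2) * t1" for n \<tau> x
    using that
  proof (induction n arbitrary: \<tau> x)
    case 0
    then show ?case using short by simp
  next
    case (Suc n)
    show ?case
    proof (cases "\<tau> \<le> 2 * t1")
      case True
      then show ?thesis using short Suc.prems by simp
    next
      case False
      obtain us where us: "valid_control us" "duration us = t1" "total_cost (2 * K0) x us \<le> 2 * K0 * (norm x)\<^sup>2"
        using short[of t1 x] t1 by auto
      obtain vs where vs: "valid_control vs" "duration vs = \<tau> - t1"
        "total_cost (2 * K0) (state x us) vs \<le> 2 * K0 * (norm (state x us))\<^sup>2"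
        using Suc.IH[of "\<tau> - t1" "state x us"] Suc.prems False by (auto simp: algebra_simps)
      \<comment> \<open>The second control costs no more than the terminal penalty that it
        replaces.\<close>
      have "total_cost (2 * K0) x (us @ vs) \<le> total_cost (2 * K0) x us"
        unfolding total_cost_append using vs(3) by (simp add: total_cost_def)
      then show ?thesis using us vs by (intro exI[of _ "us @ vs"]) auto
    qed
  qed
  show ?thesis
  proof (rule that[of "2 * K0"])
    fix x \<tau> assume \<tau>: "t1 \<le> \<tau>"
    obtain n where "\<tau> / t1 \<le> real n" using real_arch_simple by blast
    then have "\<tau> \<le> (real n + 2) * t1" using t1 by (simp add: field_simps)
    then show "\<exists>us. valid_control us \<and> duration us = \<tau> \<and> total_cost (2 * K0) x us \<le> 2 * K0 * (norm x)\<^sup>2"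
      using long \<tau> by blast
  qed (use K0 in simp)
qed

end

section \<open>The value function\<close>

text \<open>Cauchy's functional equation: \<open>g\<close> is additive and vanishes on the integers,
  so its values on the unit interval bound it everywhere, and then \<open>g (n r) = n g r\<close>
  forces it to be 0.\<close>

lemma additive_bounded_imp_linear:
  fixes f :: "real \<Rightarrow> real"
  assumes add: "\<And>r s. f (r + s) = f r + f s" and bd: "\<And>r. \<bar>r\<bar> \<le> 1 \<Longrightarrow> \<bar>f r\<bar> \<le> D"
  shows "f r = r * f 1"
proof -
  define g where "g r = f r - r * f 1" for r
  have g_add: "g (r + s) = g r + g s" for r s by (simp add: g_def add algebra_simps)
  have g0: "g 0 = 0" using g_add[of 0 0] by simp
  have g_minus: "g (- r) = - g r" for r using g_add[of r "- r"] g0 by simp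
  have g1: "g 1 = 0" by (simp add: g_def)
  have g_nat: "g (real n * r) = real n * g r" for n r
    by (induction n) (simp_all add: g0 g_add algebra_simps)
  have g_int: "g (of_int k) = 0" for k
    using g_nat[of "nat k" 1] g_nat[of "nat (- k)" 1] g_minus[of "- of_int k"] g1
    by (cases "k \<ge> 0") auto
  have "D \<ge> 0" using bd[of 0] by simp
  have bound: "\<bar>g r\<bar> \<le> 2 * D" for r
  proof -
    have "g r = g (frac r) + g (of_int \<lfloor>r\<rfloor>)"
      using g_add[of "frac r" "of_int \<lfloor>r\<rfloor>"] by (simp add: frac_def)
    then have "g r = f (frac r) - frac r * f 1" by (simp add: g_int) (simp add: g_def)
    moreover have "\<bar>f (frac r)\<bar> \<le> D" using frac_ge_0[of r] frac_lt_1[of r] by (intro bd) auto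
    moreover have "\<bar>frac r * f 1\<bar> \<le> 1 * D"
      unfolding abs_mult using frac_ge_0[of r] frac_lt_1[of r] bd[of 1] by (intro mult_mono) auto
    ultimately show ?thesis by linarith
  qed
  have "g r = 0"
  proof (rule ccontr)
    assume "g r \<noteq> 0"
    then obtain n where "2 * D / \<bar>g r\<bar> < real n" using reals_Archimedean2 by blast
    then have "2 * D < real n * \<bar>g r\<bar>" using \<open>g r \<noteq> 0\<close> by (simp add: field_simps)
    moreover have "real n * \<bar>g r\<bar> = \<bar>g (real n * r)\<bar>" by (simp add: g_nat abs_mult)
    ultimately show False using bound[of "real n * r"] by simp
  qed
  then show ?thesis by (simp add: g_def)
qed

section \<open>Quadratic forms characterised by the parallelogram law\<close>

definition polar_form :: "('a::real_vector \<Rightarrow> real) \<Rightarrow> 'a \<Rightarrow> 'a \<Rightarrow> real" where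
  "polar_form q x y = (q (x + y) - q (x - y)) / 4"

text \<open>The bound concerns the absolute value of \<open>q\<close>, so that the locale also
  covers the possibly indefinite form \<open>V x - V (T t x)\<close>.\<close>

locale bounded_quadratic_form =
  fixes q :: "'a::real_normed_vector \<Rightarrow> real" and C :: real
  assumes parallelogram: "q (x + y) + q (x - y) = 2 * q x + 2 * q y"
    and bound: "\<bar>q x\<bar> \<le> C * (norm x)\<^sup>2"
begin

lemma q_zero: "q 0 = 0" using bound[of 0] by simp

lemma q_minus: "q (- x) = q x" using parallelogram[of 0 x] q_zero by simp

lemma four_polar: "4 * polar_form q x y = q (x + y) - q (x - y)"
  by (simp add: polar_form_def)

lemma polar_commute: "polar_form q x y = polar_form q y x"
  using q_minus[of "x - y"] by (simp add: polar_form_def add.commute)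

lemma q_add: "q (x + y) = q x + 2 * polar_form q x y + q y"
  using parallelogram[of x y] four_polar[of x y] by linarith

lemma polar_minus: "polar_form q (- x) y = - polar_form q x y"
proof -
  have "q (- x + y) = q (x - y)" "q (- x - y) = q (x + y)"
    using q_minus[of "x - y"] q_minus[of "x + y"] by (simp_all add: add.commute)
  then show ?thesis using four_polar[of x y] four_polar[of "- x" y] by linarith
qed

text \<open>Subtracting the parallelogram laws at \<open>x + y\<close> and \<open>x - y\<close>
  relates the values at \<open>x + x'\<close> and \<open>x - x'\<close>; exchanging \<open>x\<close>
  and \<open>x'\<close> and using oddness in the first argument eliminates the latter.\<close>

lemma polar_add: "polar_form q (x + x') y = polar_form q x y + polar_form q x' y"
proof -
  have *: "polar_form q (x + x') y + polar_form q (x - x') y = 2 * polar_form q x y" for x x'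
    using parallelogram[of "x + y" x'] parallelogram[of "x - y" x']
      four_polar[of "x + x'" y] four_polar[of "x - x'" y] four_polar[of x y]
    by (simp add: algebra_simps)
  have "polar_form q (x' - x) y = - polar_form q (x - x') y" using polar_minus[of "x - x'" y] by simp
  then show ?thesis using *[of x x'] *[of x' x] by (simp add: add.commute)
qed

lemma polar_bound_sum: "\<bar>polar_form q x y\<bar> \<le> C * (norm x + norm y)\<^sup>2 / 2"
proof (cases "norm x + norm y = 0")
  case True
  then have "x = 0" "y = 0" by (auto simp: add_nonneg_eq_0_iff)
  then show ?thesis by (simp add: polar_form_def q_zero)
next
  case False
  have C: "0 \<le> C"
  proof -
    obtain z :: 'a where "z \<noteq> 0" using False by (metis add_0 norm_zero)
    then have "0 < (norm z)\<^sup>2" by simp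
    moreover have "0 \<le> C * (norm z)\<^sup>2" using bound[of z] by linarith
    ultimately show ?thesis by (simp add: zero_le_mult_iff)
  qed
  have "\<bar>q (x + y)\<bar> \<le> C * (norm x + norm y)\<^sup>2"
    using C by (intro order_trans[OF bound] mult_left_mono power_mono norm_triangle_ineq) auto
  moreover have "\<bar>q (x - y)\<bar> \<le> C * (norm x + norm y)\<^sup>2"
    using C by (intro order_trans[OF bound] mult_left_mono power_mono norm_triangle_ineq4) auto
  ultimately show ?thesis using four_polar[of x y] by linarith
qed

lemma polar_scaleR: "polar_form q (r *\<^sub>R x) y = r * polar_form q x y"
proof (cases "x = 0")
  case True
  then show ?thesis using polar_minus[of 0 y] by simp
next
  case False
  have C: "0 \<le> C"
    using bound[of x] False by (metis abs_ge_zero order_trans zero_le_mult_iff zero_less_norm_iff zero_less_power2 not_less norm_eq_zero)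
  have "polar_form q (r *\<^sub>R x) y = r * polar_form q (1 *\<^sub>R x) y"
  proof (rule additive_bounded_imp_linear)
    show "polar_form q ((r + s) *\<^sub>R x) y = polar_form q (r *\<^sub>R x) y + polar_form q (s *\<^sub>R x) y" for r s
      by (simp add: scaleR_add_left polar_add)
    fix r :: real assume "\<bar>r\<bar> \<le> 1"
    then have "norm (r *\<^sub>R x) \<le> norm x" by (simp add: mult_left_le_one_le)
    then show "\<bar>polar_form q (r *\<^sub>R x) y\<bar> \<le> C * (norm x + norm y)\<^sup>2 / 2"
      using C by (intro order_trans[OF polar_bound_sum] divide_right_mono mult_left_mono power_mono add_mono) auto
  qed
  then show ?thesis by simp
qed

text \<open>Cauchy-Schwarz would require positivity. Instead the crude bound is used on unit
  vectors, where \<open>norm x + norm y = 2\<close>, and extended by bilinearity; hence the factor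
  2.\<close>

lemma polar_bound: "\<bar>polar_form q x y\<bar> \<le> 2 * C * norm x * norm y"
proof (cases "x = 0 \<or> y = 0")
  case True
  then show ?thesis using polar_scaleR[of 0 0 y] polar_scaleR[of 0 0 x] polar_commute[of x y] by auto
next
  case False
  let ?x = "(1 / norm x) *\<^sub>R x" and ?y = "(1 / norm y) *\<^sub>R y"
  have "polar_form q x y = norm x * polar_form q ?x y"
    using polar_scaleR[of "norm x" ?x y] False by simp
  also have "polar_form q ?x y = norm y * polar_form q ?y ?x"
    using polar_scaleR[of "norm y" ?y ?x] polar_commute[of ?x y] False by simp
  finally have "\<bar>polar_form q x y\<bar> = norm x * norm y * \<bar>polar_form q ?y ?x\<bar>"
    by (simp add: abs_mult)
  also have "\<dots> \<le> norm x * norm y * (2 * C)"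
    using polar_bound_sum[of ?y ?x] False by (intro mult_left_mono) auto
  finally show ?thesis by (simp add: algebra_simps)
qed

lemma bounded_linear_polar: "bounded_linear (polar_form q x)"
proof (rule bounded_linear_intro)
  show "polar_form q x (y + z) = polar_form q x y + polar_form q x z" for y z
    using polar_add[of y z x] by (simp add: polar_commute)
  show "polar_form q x (r *\<^sub>R y) = r *\<^sub>R polar_form q x y" for r y
    using polar_scaleR[of r y x] by (simp add: polar_commute)
  show "norm (polar_form q x y) \<le> norm y * (2 * C * norm x)" for y
    using polar_bound[of x y] by (simp add: algebra_simps)
qed

lemma q_diff_bound: "\<bar>q x - q y\<bar> \<le> 2 * C * norm (x - y) * norm (x + y)"
proof -
  let ?p = "polar_form q"
  have [simp]: "?p z z = q z" for z using q_add[of z z] parallelogram[of z z] q_zero by simp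
  have "?p (x - y) (x + y) = ?p x (x + y) - ?p y (x + y)"
    using polar_add[of x "- y" "x + y"] polar_minus by simp
  also have "\<dots> = (?p x x + ?p x y) - (?p y x + ?p y y)"
    using bounded_linear.linear[OF bounded_linear_polar] by (simp add: linear_add)
  finally have "q x - q y = ?p (x - y) (x + y)" by (simp add: polar_commute)
  then show ?thesis using polar_bound by simp
qed

end

section \<open>The linear-quadratic problem with a terminal penalty\<close>

context input_system
begin

lemma running_cost_ge_energy: "valid_control us \<Longrightarrow> control_energy us \<le> running_cost x us"
proof (induction us arbitrary: x)
  case (Cons p us)
  obtain h v where p: "p = (h, v)" by fastforce
  have "0 \<le> integral {0..h} (\<lambda>s. (norm (flow x s (B v)))\<^sup>2)"
    by (rule has_integral_nonneg[OF has_integral_flow_cost]) simp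
  then show ?case using Cons.IH[of "flow x h (B v)"] Cons.prems by (simp add: p)
qed simp

text \<open>\<open>L\<close> acts on states and \<open>N\<close> on control values. The instances
  are multiplication by real numbers and by elements of the scalar field, the latter for the
  linearity of the feedback over that field.\<close>

lemma total_cost_scale:
  assumes L: "\<And>x h v. 0 \<le> h \<Longrightarrow> flow (L x) h (B (N v)) = L (flow x h (B v))"
    and nL: "\<And>x. norm (L x) = c * norm x" and nN: "\<And>v. norm (N v) = c * norm v"
    and "valid_control us"
  shows "total_cost K (L x) (map (\<lambda>(h, v). (h, N v)) us) = c\<^sup>2 * total_cost K x us"
  using assms(4)
proof (induction us arbitrary: x)
  case Nil
  then show ?case by (simp add: total_cost_Nil nL power_mult_distrib)
next
  case (Cons p us)
  obtain h v where p: "p = (h, v)" by fastforce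
  have h: "0 \<le> h" "valid_control us" using Cons.prems p by auto
  have "((\<lambda>s. (norm (flow (L x) s (B (N v))))\<^sup>2) has_integral
      c\<^sup>2 * integral {0..h} (\<lambda>s. (norm (flow x s (B v)))\<^sup>2)) {0..h}"
    by (rule has_integral_eq[OF _ has_integral_mult_right[OF has_integral_flow_cost]])
      (auto simp: L nL power_mult_distrib)
  then have "integral {0..h} (\<lambda>s. (norm (flow (L x) s (B (N v))))\<^sup>2) =
      c\<^sup>2 * integral {0..h} (\<lambda>s. (norm (flow x s (B v)))\<^sup>2)"
    by (rule integral_unique)
  then show ?case
    using Cons.IH[OF h(2), of "flow x h (B v)"] L[OF h(1)]
    by (simp add: p total_cost_def nN power_mult_distrib algebra_simps)
qed

end

locale lq_problem = input_system T B
  for T :: "real \<Rightarrow> 'x::{real_inner,banach} \<Rightarrow> 'x" and B :: "'u::real_inner \<Rightarrow> 'x" +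
  fixes t1 K :: real
  assumes t1: "t1 > 0" and K: "K \<ge> 0"
    and extend: "t1 \<le> \<tau> \<Longrightarrow> \<exists>us. valid_control us \<and> duration us = \<tau> \<and> total_cost K x us \<le> K * (norm x)\<^sup>2"
begin

text \<open>The duration is free. The empty control is among the competitors, which gives the upper
  bound \<open>K * (norm x)\<^sup>2\<close>.\<close>

definition V :: "'x \<Rightarrow> real" where
  "V x = Inf (total_cost K x ` Collect valid_control)"

lemma total_cost_nonneg: "valid_control us \<Longrightarrow> 0 \<le> total_cost K x us"
  using running_cost_nonneg K by (simp add: total_cost_def)

lemma V_le: "valid_control us \<Longrightarrow> V x \<le> total_cost K x us"
  unfolding V_def by (intro cInf_lower bdd_belowI[of _ 0]) (auto simp: total_cost_nonneg)

lemma V_near: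
  assumes "e > 0"
  obtains us where "valid_control us" "total_cost K x us \<le> V x + e"
proof -
  have "total_cost K x ` Collect valid_control \<noteq> {}"
    using valid_control_simps(1) by blast
  from cInf_lessD[OF this, of "V x + e"] assms obtain us where "valid_control us" "total_cost K x us < V x + e"
    unfolding V_def by auto
  then show ?thesis using that by simp
qed

lemma V_nonneg: "0 \<le> V x"
proof -
  have "total_cost K x ` Collect valid_control \<noteq> {}"
    using valid_control_simps(1) by blast
  then show ?thesis unfolding V_def by (rule cInf_greatest) (auto simp: total_cost_nonneg)
qed

lemma V_le_norm: "V x \<le> K * (norm x)\<^sup>2"
  using V_le[of "[]" x] by (simp add: total_cost_Nil)

lemma V_append:
  assumes "valid_control us"
  shows "V x \<le> running_cost x us + V (state x us)"
proof (rule field_le_epsilon)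
  fix e :: real assume "e > 0"
  then obtain vs where "valid_control vs" "total_cost K (state x us) vs \<le> V (state x us) + e"
    using V_near by blast
  then show "V x \<le> running_cost x us + V (state x us) + e"
    using V_le[of "us @ vs" x] assms by (simp add: total_cost_append)
qed

text \<open>By \<open>extend\<close>, a near-optimal control can be prolonged for any time of at
  least \<open>t1\<close> at a cost not exceeding its own terminal penalty. Thus near-optimal
  controls for different states can be given equal durations.\<close>

lemma V_near_long:
  assumes "e > 0"
  obtains d where "\<And>\<tau>. d \<le> \<tau> \<Longrightarrow> \<exists>us. valid_control us \<and> duration us = \<tau> \<and> total_cost K x us \<le> V x + e"
proof -
  obtain us where us: "valid_control us" "total_cost K x us \<le> V x + e" using V_near assms by blast
  show ?thesis
  proof (rule that)
    fix \<tau> assume "duration us + t1 \<le> \<tau>"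
    then obtain vs where vs: "valid_control vs" "duration vs = \<tau> - duration us"
      "total_cost K (state x us) vs \<le> K * (norm (state x us))\<^sup>2"
      using extend[of "\<tau> - duration us" "state x us"] by auto
    have "total_cost K x (us @ vs) \<le> total_cost K x us"
      unfolding total_cost_append using vs(3) by (simp add: total_cost_def)
    then show "\<exists>us. valid_control us \<and> duration us = \<tau> \<and> total_cost K x us \<le> V x + e"
      using us vs by (intro exI[of _ "us @ vs"]) auto
  qed
qed

text \<open>A near-optimal control of duration at least \<open>t\<close> is cut at \<open>t\<close>;
  its tail competes for the value at the intermediate state.\<close>

lemma dynamic_programming:
  assumes "0 \<le> t" "e > 0"
  obtains us where "valid_control us" "duration us = t" "running_cost x us + V (state x us) \<le> V x + e"
proof -
  obtain d where d: "\<And>\<tau>. d \<le> \<tau> \<Longrightarrow> \<exists>us. valid_control us \<and> duration us = \<tau> \<and> total_cost K x us \<le> V x + e"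
    using V_near_long assms by blast
  obtain us where us: "valid_control us" "duration us = max d t" "total_cost K x us \<le> V x + e"
    using d[of "max d t"] by auto
  obtain us1 us2 where cut: "valid_control us1" "valid_control us2" "duration us1 = t" "equivalent_control us (us1 @ us2)"
    using cut_control[OF us(1) assms(1)] us(2) by auto
  have "running_cost x us1 + V (state x us1) \<le> total_cost K x (us1 @ us2)"
    using V_le[OF cut(2)] by (simp add: total_cost_append)
  also have "\<dots> \<le> V x + e" using us(3) total_cost_cong[OF cut(4)] by simp
  finally show ?thesis using that cut by blast
qed

lemma V_scale_le:
  assumes "\<And>x h v. 0 \<le> h \<Longrightarrow> flow (L x) h (B (N v)) = L (flow x h (B v))"
    and "\<And>x. norm (L x) = c * norm x" and "\<And>v. norm (N v) = c * norm v" and "c \<ge> 0"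
  shows "V (L x) \<le> c\<^sup>2 * V x"
proof (rule field_le_epsilon)
  fix e :: real assume e: "e > 0"
  define d where "d = e / (c\<^sup>2 + 1)"
  have pos: "c\<^sup>2 + 1 > 0" by (simp add: add_nonneg_pos)
  then have "c\<^sup>2 + 1 \<noteq> 0" by linarith
  then have "(c\<^sup>2 + 1) * d = e" unfolding d_def times_divide_eq_right by (rule nonzero_mult_div_cancel_left)
  then have d: "d > 0" "c\<^sup>2 * d + d = e" using e pos unfolding distrib_right by (simp_all add: d_def)
  obtain us where us: "valid_control us" "total_cost K x us \<le> V x + d" using V_near d by blast
  have "valid_control (map (\<lambda>(h, v). (h, N v)) us)" using us(1) by (auto simp: valid_control_def)
  then have "V (L x) \<le> c\<^sup>2 * total_cost K x us"
    using V_le total_cost_scale[of L N, OF assms(1-3) us(1)] by metis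
  also have "\<dots> \<le> c\<^sup>2 * (V x + d)" using us(2) by (intro mult_left_mono) auto
  also have "\<dots> \<le> c\<^sup>2 * V x + e" using d by (simp add: distrib_left)
  finally show "V (L x) \<le> c\<^sup>2 * V x + e" .
qed

lemma V_scaleR_le: "V (r *\<^sub>R x) \<le> r\<^sup>2 * V x"
proof -
  have "V (r *\<^sub>R x) \<le> \<bar>r\<bar>\<^sup>2 * V x"
    by (rule V_scale_le[of "\<lambda>x. r *\<^sub>R x" "\<lambda>v. r *\<^sub>R v"])
      (auto simp: flow_def T_scaleR B_simps orbit_integral_scaleR scaleR_add_right)
  then show ?thesis by simp
qed

lemma V_parallelogram_le: "V (x + y) + V (x - y) \<le> 2 * V x + 2 * V y"
proof (rule field_le_epsilon)
  fix e :: real assume e: "e > 0"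
  obtain d where d: "\<And>\<tau>. d \<le> \<tau> \<Longrightarrow> \<exists>us. valid_control us \<and> duration us = \<tau> \<and> total_cost K x us \<le> V x + e / 4"
    using V_near_long e by (metis zero_less_divide_iff zero_less_numeral)
  obtain d' where d': "\<And>\<tau>. d' \<le> \<tau> \<Longrightarrow> \<exists>us. valid_control us \<and> duration us = \<tau> \<and> total_cost K y us \<le> V y + e / 4"
    using V_near_long e by (metis zero_less_divide_iff zero_less_numeral)
  obtain us where us: "valid_control us" "duration us = max d d'" "total_cost K x us \<le> V x + e / 4"
    using d[of "max d d'"] by auto
  obtain vs where vs: "valid_control vs" "duration vs = max d d'" "total_cost K y vs \<le> V y + e / 4"
    using d'[of "max d d'"] by auto
  obtain ws :: "(real \<times> 'u \<times> 'u) list" where ws: "\<And>h v w. (h, v, w) \<in> set ws \<Longrightarrow> 0 \<le> h"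
    "equivalent_control us (map (\<lambda>(h, v, w). (h, v)) ws)"
    "equivalent_control vs (map (\<lambda>(h, v, w). (h, w)) ws)"
    using common_refinement[OF us(1) vs(1)] us(2) vs(2) by metis
  have "valid_control (map (\<lambda>(h, v, w). (h, v + w)) ws)" "valid_control (map (\<lambda>(h, v, w). (h, v - w)) ws)"
    using ws(1) by (auto simp: valid_control_def)
  then have "V (x + y) + V (x - y) \<le> total_cost K (x + y) (map (\<lambda>(h, v, w). (h, v + w)) ws) +
      total_cost K (x - y) (map (\<lambda>(h, v, w). (h, v - w)) ws)"
    by (intro add_mono V_le)
  also have "\<dots> = 2 * total_cost K x us + 2 * total_cost K y vs"
    unfolding total_cost_cong[OF ws(2)] total_cost_cong[OF ws(3)] by (rule total_cost_parallelogram) (rule ws(1))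
  also have "\<dots> \<le> 2 * V x + 2 * V y + e" using us(3) vs(3) by simp
  finally show "V (x + y) + V (x - y) \<le> 2 * V x + 2 * V y + e" .
qed

sublocale V: bounded_quadratic_form V K
proof
  show "V (x + y) + V (x - y) = 2 * V x + 2 * V y" for x y
  proof (rule antisym[OF V_parallelogram_le])
    \<comment> \<open>Applied to \<open>x + y\<close> and \<open>x - y\<close>, the parallelogram
      inequality yields its own converse, because scaling by 1/2 gives this lower bound for the
      value at twice a vector.\<close>
    have half: "4 * V z \<le> V (2 *\<^sub>R z)" for z
      using V_scaleR_le[of "1/2" "2 *\<^sub>R z"] by (simp add: power2_eq_square)
    have "(x + y) + (x - y) = 2 *\<^sub>R x" "(x + y) - (x - y) = 2 *\<^sub>R y" by (simp_all add: scaleR_2)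
    then show "2 * V x + 2 * V y \<le> V (x + y) + V (x - y)"
      using V_parallelogram_le[of "x + y" "x - y"] half[of x] half[of y] by simp
  qed
  show "\<bar>V x\<bar> \<le> K * (norm x)\<^sup>2" for x using V_nonneg V_le_norm by simp
qed

abbreviation "b \<equiv> polar_form V"

text \<open>In one direction the zero control is used up to time \<open>t\<close>. In the other, a
  near-optimal control moves the end state away from \<open>T t x\<close> by a multiple of its L1
  norm; by Young's inequality the energy absorbs the effect, up to a term linear in
  \<open>t\<close>. The estimate holds for all states, not only in the domain of the
  generator.\<close>

lemma V_quasi_invariant:
  obtains C where "C \<ge> 0" "\<And>t x. t \<in> {0..t1} \<Longrightarrow> \<bar>V x - V (T t x)\<bar> \<le> C * t * (norm x)\<^sup>2"
proof -
  obtain M where M: "M \<ge> 1" "\<And>s z. s \<in> {0..t1} \<Longrightarrow> norm (T s z) \<le> M * norm z"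
    using T_bounded_on_interval by blast
  obtain \<beta> where \<beta>: "\<beta> > 0" "\<And>z. norm (B z) \<le> \<beta> * norm z"
    using bounded_linear.pos_bounded[OF bounded_linear_B] by (auto simp: mult.commute)
  \<comment> \<open>\<open>2 * K\<close> comes from \<open>polar_bound\<close>, \<open>M\<close>
    from \<open>T t x\<close>, and \<open>M * \<beta>\<close> from the state driven from 0.\<close>
  define c where "c = 2 * K * M * (M * \<beta>)"
  have c0: "c \<ge> 0" using K M \<beta> by (simp add: c_def)
  show ?thesis
  proof (rule that[of "M\<^sup>2 + c\<^sup>2"])
    fix t x assume t: "t \<in> {0..t1}"
    have "V x \<le> running_cost x [(t, 0)] + V (T t x)"
      using V_append[of "[(t, 0)]" x] t linear_0[OF linear_orbit_integral] by (simp add: flow_def B_simps)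
    moreover have "running_cost x [(t, 0)] \<le> control_energy [(t, 0::'u)] + duration [(t, 0::'u)] * (M * norm x)\<^sup>2"
    proof (rule conjunct2[OF running_cost_bounds[OF M(2) _ \<beta>(2), where z = 0 and R = "M * norm x" and l = 0 and D = "M * norm x"]])
      show "norm (T s x - 0) \<le> M * norm x" if "s \<in> {0..duration [(t, 0::'u)]}" for s
        using M(2)[of s x] that t by simp
      show "0 \<le> (norm y)\<^sup>2 \<and> (norm y)\<^sup>2 \<le> (M * norm x)\<^sup>2" if "norm (y - 0) \<le> M * norm x" for y :: 'x
        using that by (auto intro: power_mono)
    qed (use M \<beta> t in auto)
    ultimately have 1: "V x - V (T t x) \<le> M\<^sup>2 * t * (norm x)\<^sup>2"
      by (simp add: power_mult_distrib algebra_simps)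
    have 2: "V (T t x) \<le> V x + c\<^sup>2 * t * (norm x)\<^sup>2"
    proof (rule field_le_epsilon)
      fix e :: real assume "e > 0"
      then obtain us where us: "valid_control us" "duration us = t" "running_cost x us + V (state x us) \<le> V x + e"
        using dynamic_programming t by (metis atLeastAtMost_iff)
      let ?w = "state 0 us"
      have w: "norm ?w \<le> M * \<beta> * control_L1 us"
        using norm_state_zero_le[OF M(2) _ \<beta>(2) _ us(1)] us(2) t M \<beta> by auto
      have "\<bar>b (T t x) ?w\<bar> \<le> 2 * K * norm (T t x) * norm ?w" by (rule V.polar_bound)
      also have "\<dots> \<le> 2 * K * (M * norm x) * (M * \<beta> * control_L1 us)"
        using K M t w by (intro mult_mono) auto
      also have "\<dots> = c * norm x * control_L1 us" by (simp add: c_def algebra_simps)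
      finally have "V (T t x) - 2 * (c * norm x * control_L1 us) \<le> V (state x us)"
        using V.q_add[of "T t x" ?w] V_nonneg[of ?w] state_eq[OF us(1), of x] us(2) by simp
      moreover have "2 * (c * norm x) * control_L1 us \<le> (c * norm x)\<^sup>2 * t + control_energy us"
        using control_L1_young[OF us(1)] us(2) by metis
      ultimately show "V (T t x) \<le> V x + c\<^sup>2 * t * (norm x)\<^sup>2 + e"
        using us(3) running_cost_ge_energy[OF us(1), of x] by (simp add: power_mult_distrib algebra_simps)
    qed
    have "0 \<le> c\<^sup>2 * t * (norm x)\<^sup>2" "0 \<le> M\<^sup>2 * t * (norm x)\<^sup>2" using t by auto
    then show "\<bar>V x - V (T t x)\<bar> \<le> (M\<^sup>2 + c\<^sup>2) * t * (norm x)\<^sup>2"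
      using 1 2 by (simp add: distrib_right abs_le_iff)
  qed simp
qed

text \<open>The form \<open>V - V \<circ> T t\<close> is itself quadratic and of norm \<open>O(t)\<close>, so its polar form is
  small uniformly in \<open>z\<close>. This replaces the strong continuity of the adjoint semigroup.\<close>

lemma polar_T_bound:
  assumes C: "\<And>x. \<bar>V x - V (T t x)\<bar> \<le> C * t * (norm x)\<^sup>2" and t: "0 \<le> t"
    and M: "\<And>z. norm (T t z) \<le> M * norm z"
  shows "\<bar>b x (T t z) - b x z\<bar> \<le> (2 * (C * t) * norm x + 2 * K * norm (T t x - x) * M) * norm z"
proof -
  interpret D: bounded_quadratic_form "\<lambda>x. V x - V (T t x)" "C * t"
    using V.parallelogram C t by unfold_locales (simp_all add: T_plus T_diff algebra_simps)
  have "polar_form (\<lambda>x. V x - V (T t x)) x z = b x z - b (T t x) (T t z)"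
    using t by (simp add: polar_form_def T_plus T_diff field_simps)
  then have 1: "\<bar>b x z - b (T t x) (T t z)\<bar> \<le> 2 * (C * t) * norm x * norm z"
    using D.polar_bound[of x z] by simp
  have "\<bar>b (T t x - x) (T t z)\<bar> \<le> 2 * K * norm (T t x - x) * norm (T t z)" by (rule V.polar_bound)
  also have "\<dots> \<le> 2 * K * norm (T t x - x) * (M * norm z)"
    using K M by (intro mult_left_mono) auto
  finally have 2: "\<bar>b (T t x - x) (T t z)\<bar> \<le> 2 * K * norm (T t x - x) * M * norm z" by (simp add: mult.assoc)
  have "b (T t x - x) (T t z) = b (T t x) (T t z) - b x (T t z)"
    using V.polar_add[of "T t x" "- x"] V.polar_minus by simp
  then show ?thesis using 1 2 by (simp add: distrib_right)
qed

text \<open>The left-hand side is the minimum over controls of this duration, attained by the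
  constant control \<open>f\<close>, where the square of \<open>v - f\<close> vanishes.\<close>

lemma completing_square:
  assumes "valid_control us"
  shows "- (duration us * (norm f)\<^sup>2) \<le> control_energy us - 2 * (\<Sum>(h, v)\<leftarrow>us. h * (f \<bullet> v))"
  using assms
proof (induction us)
  case (Cons p us)
  obtain h v where p: "p = (h, v)" by fastforce
  have "0 \<le> (norm (v - f))\<^sup>2" by simp
  then have "2 * (f \<bullet> v) \<le> (norm f)\<^sup>2 + (norm v)\<^sup>2"
    by (simp add: power2_norm_eq_inner inner_diff inner_commute)
  then have "h * (2 * (f \<bullet> v)) \<le> h * ((norm f)\<^sup>2 + (norm v)\<^sup>2)"
    using Cons.prems p by (intro mult_left_mono) auto
  then show ?case using Cons p by (simp add: algebra_simps)
qed simp

text \<open>The Riccati inequality in integrated form: \<open>f\<close> is \<open>- B\<^sup>* Q x\<close>, where \<open>Q\<close> is the operator of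
  the form \<open>V\<close>.\<close>

lemma V_riccati_inequality:
  assumes f: "\<And>v. b x (B v) = - (f \<bullet> v)" and \<eta>: "\<eta> > 0"
  shows "\<forall>\<^sub>F t in at_right 0. V (T t x) + t * (norm x)\<^sup>2 - t * (norm f)\<^sup>2 \<le> V x + \<eta> * t"
proof -
  obtain M where M: "M \<ge> 1" "\<And>s z. s \<in> {0..t1} \<Longrightarrow> norm (T s z) \<le> M * norm z"
    using T_bounded_on_interval by blast
  obtain \<beta> where \<beta>: "\<beta> > 0" "\<And>z. norm (B z) \<le> \<beta> * norm z"
    using bounded_linear.pos_bounded[OF bounded_linear_B] by (auto simp: mult.commute)
  obtain C where C: "C \<ge> 0" "\<And>t x. t \<in> {0..t1} \<Longrightarrow> \<bar>V x - V (T t x)\<bar> \<le> C * t * (norm x)\<^sup>2"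
    using V_quasi_invariant by blast
  let ?r = "norm x"
  \<comment> \<open>The cross term \<open>2 * b (T t x) ?w\<close> is at most \<open>k\<close> times
    the L1 norm, and Young's inequality absorbs it into the energy; so the energy is at most
    \<open>C1 * t\<close> and the L1 norm at most \<open>C2 * t\<close>. \<open>C3\<close> collects
    three errors of order \<open>\<theta> * t\<close>: in the running cost, in replacing
    \<open>T t x\<close> by \<open>x\<close> in the cross term, and from the drift of
    \<open>b x\<close> along the semigroup.\<close>
  define k where "k = 4 * K * M * (M * \<beta>) * ?r"
  define C1 where "C1 = 2 * (C * ?r\<^sup>2 + 1) + k\<^sup>2"
  define C2 where "C2 = (1 + C1) / 2"
  define C3 where "C3 = 2 * ?r * (1 + M * \<beta> * C2) + 4 * K * (M * \<beta> * C2) + 2 * ((2 * C * ?r + 2 * K * M) * \<beta> * C2)"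
  have k0: "k \<ge> 0" using K M \<beta> by (simp add: k_def)
  have C1: "C1 \<ge> 0" using C by (simp add: C1_def)
  then have C2: "C2 \<ge> 0" by (simp add: C2_def)
  then have C3: "C3 \<ge> 0" using K M \<beta> C by (simp add: C3_def)
  \<comment> \<open>One tolerance with three uses: suboptimality per unit time, oscillation of the
    orbit of \<open>x\<close>, and upper bound for \<open>t\<close>.\<close>
  define \<theta> where "\<theta> = min 1 (\<eta> / (1 + C3))"
  have \<theta>: "0 < \<theta>" "\<theta> \<le> 1" "\<theta> * (1 + C3) \<le> \<eta>"
  proof -
    show "0 < \<theta>" "\<theta> \<le> 1" using \<eta> C3 by (auto simp: \<theta>_def)
    have "\<theta> * (1 + C3) \<le> \<eta> / (1 + C3) * (1 + C3)"
      using C3 by (intro mult_right_mono) (auto simp: \<theta>_def)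
    then show "\<theta> * (1 + C3) \<le> \<eta>" using C3 by simp
  qed
  have "\<forall>\<^sub>F s in at_right 0. dist (T s x) x < \<theta>"
    using T_tendsto[of x] \<theta>(1) by (rule tendstoD)
  then obtain d where d: "d > 0" "\<And>s. 0 < s \<Longrightarrow> s < d \<Longrightarrow> dist (T s x) x < \<theta>"
    unfolding eventually_at_right_field by blast
  have main: "V (T t x) + t * ?r\<^sup>2 - t * (norm f)\<^sup>2 \<le> V x + \<eta> * t"
    if t: "0 < t" "t < min d (min t1 \<theta>)" for t
  proof -
    have T\<theta>: "norm (T s x - x) \<le> \<theta>" if "s \<in> {0..t}" for s
      using d(2)[of s] that t \<theta> by (cases "s = 0") (auto simp: dist_norm T_zero)
    have Mt: "norm (T s z) \<le> M * norm z" if "s \<in> {0..t}" for s z using M that t by simp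
    obtain us where us: "valid_control us" "duration us = t" "running_cost x us + V (state x us) \<le> V x + \<theta> * t"
      using dynamic_programming[of t "\<theta> * t" x] t \<theta> by auto
    let ?w = "state 0 us" and ?E1 = "control_L1 us" and ?E2 = "control_energy us"
    have E1: "0 \<le> ?E1" using control_L1_nonneg us by blast
    have w: "norm ?w \<le> M * \<beta> * ?E1"
      using norm_state_zero_le[OF Mt _ \<beta>(2) _ us(1)] us(2) M \<beta> by auto
    \<comment> \<open>Expansion about \<open>T t x\<close>; the quadratic term \<open>V ?w\<close>
      is nonnegative and is dropped.\<close>
    have Vs: "V (T t x) + 2 * b (T t x) ?w \<le> V (state x us)"
      using V.q_add[of "T t x" ?w] V_nonneg[of ?w] state_eq[OF us(1), of x] us(2) by simp
    have "\<bar>b (T t x) ?w\<bar> \<le> 2 * K * norm (T t x) * norm ?w" by (rule V.polar_bound)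
    also have "\<dots> \<le> 2 * K * (M * ?r) * (M * \<beta> * ?E1)"
      using K M t w by (intro mult_mono) auto
    also have "2 * \<dots> = k * ?E1" by (simp add: k_def algebra_simps)
    finally have bw: "- (k * ?E1) \<le> 2 * b (T t x) ?w" by linarith
    have "V x - V (T t x) \<le> C * t * ?r\<^sup>2" using C(2)[of t x] t by (auto simp: abs_le_iff)
    then have "?E2 \<le> C * t * ?r\<^sup>2 + \<theta> * t + k * ?E1"
      using us(3) running_cost_ge_energy[OF us(1), of x] Vs bw by linarith
    moreover have "2 * k * ?E1 \<le> k\<^sup>2 * t + ?E2" using control_L1_young[OF us(1), of k] us(2) by simp
    moreover have "\<theta> * t \<le> t" using \<theta> t by simp
    ultimately have E2: "?E2 \<le> C1 * t" by (simp add: C1_def algebra_simps)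
    have E1t: "?E1 \<le> C2 * t"
      using control_L1_young[OF us(1), of 1] us(2) E2 by (simp add: C2_def algebra_simps)
    also have "\<dots> \<le> C2 * \<theta>" using C2 t by (intro mult_left_mono) auto
    finally have E1\<theta>: "?E1 \<le> C2 * \<theta>" .
    have wt: "norm ?w \<le> M * \<beta> * C2 * t"
      using order_trans[OF w mult_left_mono[OF E1t, of "M * \<beta>"]] M \<beta> by (simp add: mult.assoc)
    \<comment> \<open>The square is bounded below by its tangent at \<open>norm x\<close>, so only
      the distance of the trajectory from \<open>x\<close> enters.\<close>
    have rc: "?E2 + duration us * (?r\<^sup>2 - 2 * ?r * (\<theta> + M * \<beta> * ?E1)) \<le> running_cost x us"
    proof (rule conjunct1[OF running_cost_bounds[OF Mt _ \<beta>(2) _ us(1), where z = x and R = \<theta> and D = "\<theta> + M * \<beta> * ?E1" and r = "(?r + (\<theta> + M * \<beta> * ?E1))\<^sup>2"]])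
      fix y :: 'x assume y: "norm (y - x) \<le> \<theta> + M * \<beta> * ?E1"
      have "?r - norm y \<le> norm (y - x)" by (metis norm_minus_commute norm_triangle_ineq2)
      then have "?r - norm y \<le> \<theta> + M * \<beta> * ?E1" using y by linarith
      then have "2 * ?r * (?r - norm y) \<le> 2 * ?r * (\<theta> + M * \<beta> * ?E1)" by (intro mult_left_mono) auto
      moreover have "0 \<le> (?r - norm y)\<^sup>2" by simp
      ultimately have "?r\<^sup>2 - 2 * ?r * (\<theta> + M * \<beta> * ?E1) \<le> (norm y)\<^sup>2"
        by (simp add: power2_diff algebra_simps power2_eq_square)
      moreover have "norm y \<le> ?r + (\<theta> + M * \<beta> * ?E1)" using y norm_triangle_sub[of y x] by linarith
      then have "(norm y)\<^sup>2 \<le> (?r + (\<theta> + M * \<beta> * ?E1))\<^sup>2" by (intro power_mono) auto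
      ultimately show "?r\<^sup>2 - 2 * ?r * (\<theta> + M * \<beta> * ?E1) \<le> (norm y)\<^sup>2 \<and> (norm y)\<^sup>2 \<le> (?r + (\<theta> + M * \<beta> * ?E1))\<^sup>2"
        by blast
    qed (use M \<beta> us T\<theta> in auto)
    have "M * \<beta> * ?E1 \<le> M * \<beta> * (C2 * \<theta>)" using E1\<theta> M \<beta> by (intro mult_left_mono) auto
    then have "2 * ?r * (\<theta> + M * \<beta> * ?E1) \<le> 2 * ?r * (\<theta> + M * \<beta> * (C2 * \<theta>))"
      by (intro mult_left_mono[OF add_left_mono]) auto
    then have "t * (2 * ?r * (\<theta> + M * \<beta> * ?E1)) \<le> t * (2 * ?r * (\<theta> + M * \<beta> * (C2 * \<theta>)))"
      using t by (intro mult_left_mono[of "2 * ?r * _"]) auto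
    then have rc': "?E2 + t * ?r\<^sup>2 - \<theta> * t * (2 * ?r * (1 + M * \<beta> * C2)) \<le> running_cost x us"
      using rc us(2) by (simp add: algebra_simps)
    have "b (T t x - x) ?w = b (T t x) ?w - b x ?w"
      using V.polar_add[of "T t x" "- x"] V.polar_minus by simp
    moreover have "\<bar>b (T t x - x) ?w\<bar> \<le> 2 * K * norm (T t x - x) * norm ?w" by (rule V.polar_bound)
    moreover have "2 * K * norm (T t x - x) * norm ?w \<le> 2 * K * \<theta> * (M * \<beta> * C2 * t)"
      using K T\<theta>[of t] t wt \<theta> by (intro mult_mono) auto
    ultimately have b1: "b x ?w - 2 * K * \<theta> * (M * \<beta> * C2 * t) \<le> b (T t x) ?w" by linarith
    let ?e = "\<theta> * (2 * C * ?r + 2 * K * M)"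
    have e0: "0 \<le> ?e" using \<theta> C K M by simp
    \<comment> \<open>Under the functional \<open>b x\<close>, the state \<open>?w\<close> may be
      replaced by the weighted sum of the \<open>B v\<close> with an error of order
      \<open>\<theta> * t\<close>.\<close>
    have "\<bar>b x ?w - (\<Sum>(h, v)\<leftarrow>us. h * b x (B v))\<bar> \<le> ?e * \<beta> * ?E1"
    proof (rule functional_state_zero[OF Mt _ \<beta>(2) _ V.bounded_linear_polar _ e0 us(1)])
      fix s z assume s: "s \<in> {0..t}"
      have "\<bar>b x (T s z) - b x z\<bar> \<le> (2 * (C * s) * ?r + 2 * K * norm (T s x - x) * M) * norm z"
        using s t Mt C by (intro polar_T_bound) auto
      also have "\<dots> \<le> (2 * (C * \<theta>) * ?r + 2 * K * \<theta> * M) * norm z"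
        using s t C K M T\<theta>[OF s] \<theta> by (intro mult_right_mono add_mono mult_left_mono) auto
      finally show "\<bar>b x (T s z) - b x z\<bar> \<le> ?e * norm z" by (simp add: algebra_simps)
    qed (use M \<beta> us in auto)
    moreover have "(\<Sum>(h, v)\<leftarrow>us. h * b x (B v)) = - (\<Sum>(h, v)\<leftarrow>us. h * (f \<bullet> v))"
      by (induction us) (auto simp: f)
    moreover have "?e * \<beta> * ?E1 \<le> ?e * \<beta> * (C2 * t)"
      using e0 \<beta> E1t by (intro mult_left_mono) auto
    ultimately have b2: "- (\<Sum>(h, v)\<leftarrow>us. h * (f \<bullet> v)) - ?e * \<beta> * (C2 * t) \<le> b x ?w" by linarith
    have "- (t * (norm f)\<^sup>2) \<le> ?E2 - 2 * (\<Sum>(h, v)\<leftarrow>us. h * (f \<bullet> v))"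
      using completing_square[OF us(1)] us(2) by metis
    with us(3) Vs rc' b1 b2 have "V (T t x) + t * ?r\<^sup>2 - t * (norm f)\<^sup>2 -
        (\<theta> * t * (2 * ?r * (1 + M * \<beta> * C2)) + 2 * (2 * K * \<theta> * (M * \<beta> * C2 * t)) + 2 * (?e * \<beta> * (C2 * t)))
        \<le> V x + \<theta> * t"
      by linarith
    moreover have "\<theta> * t * (2 * ?r * (1 + M * \<beta> * C2)) + 2 * (2 * K * \<theta> * (M * \<beta> * C2 * t)) + 2 * (?e * \<beta> * (C2 * t)) + \<theta> * t =
        \<theta> * (1 + C3) * t"
      by (simp add: C3_def algebra_simps)
    moreover have "\<theta> * (1 + C3) * t \<le> \<eta> * t" using \<theta>(3) t by (intro mult_right_mono) auto
    ultimately show ?thesis by linarith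
  qed
  show ?thesis
    unfolding eventually_at_right_field
    using main d t1 \<theta> by (intro exI[of _ "min d (min t1 \<theta>)"]) auto
qed

end

section \<open>Bounded perturbations of semigroups\<close>

text \<open>Integrating factor: the hypothesis makes the derivative of \<open>W\<close> at most
  0.\<close>

lemma gronwall:
  fixes \<phi> :: "real \<Rightarrow> real"
  assumes \<phi>: "continuous_on {0..b} \<phi>" and k: "0 \<le> k"
    and le: "\<And>t. t \<in> {0..b} \<Longrightarrow> \<phi> t \<le> a + k * integral {0..t} \<phi>" and t: "t \<in> {0..b}"
  shows "\<phi> t \<le> a * exp (k * t)"
proof -
  define W where "W s = exp (- k * s) * (a + k * integral {0..s} \<phi>)" for s
  have "W t \<le> W 0"
  proof (cases "t = 0")
    case False
    show ?thesis
    proof (rule DERIV_nonpos_imp_decreasing_open[where f = W])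
      show "0 \<le> t" using t by simp
      show "continuous_on {0..t} W" unfolding W_def
        using t by (intro continuous_intros indefinite_integral_continuous_1 integrable_continuous_interval
            continuous_on_subset[OF \<phi>]) auto
      fix s assume s: "0 < s" "s < t"
      have "((\<lambda>x. integral {0..x} \<phi>) has_real_derivative \<phi> s) (at s within {0..b})"
        using s t by (intro integral_has_real_derivative \<phi>) auto
      then have "((\<lambda>x. integral {0..x} \<phi>) has_real_derivative \<phi> s) (at s)"
        using s t by (simp add: at_within_Icc_at)
      then have "(W has_real_derivative exp (- k * s) * (k * (\<phi> s - (a + k * integral {0..s} \<phi>)))) (at s)"
        unfolding W_def by (auto intro!: derivative_eq_intros simp: algebra_simps)
      moreover have "exp (- k * s) * (k * (\<phi> s - (a + k * integral {0..s} \<phi>))) \<le> 0"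
        using le[of s] s t k by (intro mult_nonneg_nonpos) auto
      ultimately show "\<exists>y. (W has_real_derivative y) (at s) \<and> y \<le> 0" by blast
    qed
  qed simp
  then have "exp (k * t) * W t \<le> exp (k * t) * a" by (simp add: W_def)
  moreover have "exp (k * t) * W t = a + k * integral {0..t} \<phi>"
    by (simp add: W_def mult.assoc[symmetric] flip: exp_add)
  ultimately have "\<phi> t \<le> exp (k * t) * a" using le[OF t] by linarith
  then show ?thesis by (simp add: mult.commute)
qed

text \<open>By compactness there is a last time with \<open>f t \<le> f 0 + \<eta> * t\<close>; were
  it before \<open>b\<close>, the hypothesis would produce a later one. The slope
  \<open>\<eta>\<close> costs at most \<open>e\<close> in the end.\<close>

lemma right_dini_le:
  fixes f :: "real \<Rightarrow> real"
  assumes f: "continuous_on {0..b} f" and b: "0 \<le> b"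
    and dini: "\<And>t \<eta>. 0 \<le> t \<Longrightarrow> \<eta> > 0 \<Longrightarrow> \<forall>\<^sub>F h in at_right 0. f (t + h) \<le> f t + \<eta> * h"
  shows "f b \<le> f 0"
proof (rule field_le_epsilon)
  fix e :: real assume e: "e > 0"
  define \<eta> where "\<eta> = e / (b + 1)"
  have \<eta>: "\<eta> > 0" "\<eta> * b \<le> e"
    using e b by (auto simp: \<eta>_def field_simps)
  define A where "A = {t \<in> {0..b}. f t \<le> f 0 + \<eta> * t}"
  have "compact A"
  proof -
    have "closed {t \<in> {0..b}. f t - \<eta> * t \<in> {..f 0}}"
      by (rule continuous_closed_preimage[unfolded vimage_def Int_def mem_Collect_eq])
        (auto intro!: continuous_intros f)
    moreover have "A = {t \<in> {0..b}. f t - \<eta> * t \<in> {..f 0}}" by (auto simp: A_def algebra_simps)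
    ultimately have "closed A" by simp
    moreover have "bounded A" by (rule bounded_subset[of "{0..b}"]) (auto simp: A_def)
    ultimately show ?thesis by (simp add: compact_eq_bounded_closed)
  qed
  moreover have "0 \<in> A" using b by (simp add: A_def)
  ultimately obtain m where m: "m \<in> A" "\<And>t. t \<in> A \<Longrightarrow> t \<le> m"
    using compact_attains_sup[of A] by blast
  have "m = b"
  proof (rule ccontr)
    assume "m \<noteq> b"
    then have mb: "0 \<le> m" "m < b" using m(1) by (auto simp: A_def)
    obtain d where d: "d > 0" "\<And>h. 0 < h \<Longrightarrow> h < d \<Longrightarrow> f (m + h) \<le> f m + \<eta> * h"
      using dini[OF mb(1) \<eta>(1)] unfolding eventually_at_right_field by blast
    define h where "h = min (d / 2) (b - m)"
    have h: "0 < h" "h < d" "m + h \<le> b" using d mb by (auto simp: h_def)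
    have "f (m + h) \<le> f 0 + \<eta> * (m + h)"
      using d(2)[OF h(1,2)] m(1) by (simp add: A_def distrib_left)
    then have "m + h \<in> A" using h mb by (simp add: A_def)
    then show False using m(2) h by fastforce
  qed
  then show "f b \<le> f 0 + e" using m(1) \<eta>(2) by (auto simp: A_def)
qed

text \<open>The representing vector minimises \<open>(norm v)\<^sup>2 - 2 * \<phi> v\<close>: by the
  parallelogram law minimising sequences are Cauchy, and the vanishing of the first variation at the
  minimum is the identity sought.\<close>

lemma riesz_representation:
  fixes \<phi> :: "'u::{real_inner,complete_space} \<Rightarrow> real"
  assumes \<phi>: "bounded_linear \<phi>"
  obtains w where "\<And>v. \<phi> v = w \<bullet> v"
proof -
  define q where "q v = (norm v)\<^sup>2 - 2 * \<phi> v" for v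
  have lin: "linear \<phi>" using \<phi> by (rule bounded_linear.linear)
  obtain C where C: "C > 0" "\<And>v. norm (\<phi> v) \<le> norm v * C" using bounded_linear.pos_bounded[OF \<phi>] by blast
  have lb: "- (C\<^sup>2) \<le> q v" for v
  proof -
    have "0 \<le> (norm v - C)\<^sup>2" by simp
    then have "2 * (norm v * C) \<le> (norm v)\<^sup>2 + C\<^sup>2" unfolding power2_diff by linarith
    then show ?thesis using C(2)[of v] by (simp add: q_def abs_le_iff)
  qed
  define m where "m = Inf (range q)"
  have bdd: "bdd_below (range q)" using lb by (intro bdd_belowI[of _ "- (C\<^sup>2)"]) auto
  have mle: "m \<le> q v" for v unfolding m_def using bdd by (intro cInf_lower) auto
  have "\<exists>v. q v < m + 1 / real (Suc n)" for n
    using cInf_lessD[of "range q" "m + 1 / real (Suc n)"] by (auto simp: m_def)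
  then obtain v where v: "\<And>n. q (v n) < m + 1 / real (Suc n)" by metis
  have par: "(norm (x - y))\<^sup>2 \<le> 2 * q x + 2 * q y - 4 * m" for x y
  proof -
    have "4 * q ((1/2) *\<^sub>R (x + y)) = (norm (x + y))\<^sup>2 - 4 * \<phi> x - 4 * \<phi> y"
      by (simp only: q_def norm_scaleR power_mult_distrib linear_cmul[OF lin] linear_add[OF lin])
        (simp add: power2_eq_square field_simps)
    then show ?thesis using mle[of "(1/2) *\<^sub>R (x + y)"] norm_parallelogram[of x y] by (simp add: q_def)
  qed
  have "Cauchy v"
  proof (rule metric_CauchyI)
    fix e :: real assume e: "e > 0"
    obtain N where N: "4 / e\<^sup>2 < real N" using reals_Archimedean2 by blast
    have "dist (v i) (v j) < e" if ij: "i \<ge> N" "j \<ge> N" for i j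
    proof -
      have N0: "real N > 0" using N e by (intro le_less_trans[OF _ N]) simp
      have "1 / real (Suc i) \<le> 1 / real N" "1 / real (Suc j) \<le> 1 / real N"
        using ij N0 by (auto intro!: divide_left_mono)
      then have "(norm (v i - v j))\<^sup>2 < 4 * (1 / real N)"
        using par[of "v i" "v j"] v[of i] v[of j] by linarith
      also have "\<dots> < e\<^sup>2" using N N0 e by (simp add: field_simps)
      finally show ?thesis using e by (simp add: dist_norm power_less_imp_less_base)
    qed
    then show "\<exists>M. \<forall>i\<ge>M. \<forall>j\<ge>M. dist (v i) (v j) < e" by blast
  qed
  then obtain w where w: "v \<longlonglongrightarrow> w" using Cauchy_convergent convergent_def by blast
  have "(\<lambda>n. q (v n)) \<longlonglongrightarrow> q w"
    unfolding q_def by (intro tendsto_intros w bounded_linear.tendsto[OF \<phi>])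
  moreover have "(\<lambda>n. m + 1 / real (Suc n)) \<longlonglongrightarrow> m + 0"
    using LIMSEQ_inverse_real_of_nat by (intro tendsto_add tendsto_const) (simp add: inverse_eq_divide)
  ultimately have "q w \<le> m + 0"
    by (rule LIMSEQ_le) (use v less_imp_le in blast)
  then have min: "q w \<le> q x" for x using mle[of x] by linarith
  have "\<phi> z = w \<bullet> z" for z
  proof -
    define a where "a = w \<bullet> z - \<phi> z"
    have exp: "q (w + r *\<^sub>R z) = q w + 2 * r * a + r\<^sup>2 * (norm z)\<^sup>2" for r
      unfolding q_def a_def power2_norm_eq_inner
      by (simp add: inner_add inner_commute linear_add[OF lin] linear_cmul[OF lin] algebra_simps)
        (simp add: power2_eq_square)
    have nn: "0 \<le> 2 * r * a + r\<^sup>2 * (norm z)\<^sup>2" for r using min[of "w + r *\<^sub>R z"] exp[of r] by linarith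
    have "a = 0"
    proof (rule ccontr)
      assume a: "a \<noteq> 0"
      \<comment> \<open>The value \<open>r = - a / n\<close> makes the quadratic polynomial in
        \<open>r\<close> negative if \<open>a\<close> is nonzero; the added 1 covers
        \<open>z = 0\<close>.\<close>
      define n where "n = (norm z)\<^sup>2 + 1"
      have n: "n > 0" by (simp add: n_def add_nonneg_pos)
      have "(- a / n)\<^sup>2 * (norm z)\<^sup>2 \<le> (- a / n)\<^sup>2 * n" by (intro mult_left_mono) (auto simp: n_def)
      also have "\<dots> = a\<^sup>2 / n" using n by (simp add: power2_eq_square field_simps)
      finally have "0 \<le> 2 * (- a / n) * a + a\<^sup>2 / n" using nn[of "- a / n"] by linarith
      also have "\<dots> = - (a\<^sup>2 / n)" by (simp add: power2_eq_square field_simps)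
      finally show False using a n by (simp add: divide_le_0_iff)
    qed
    then show ?thesis by (simp add: a_def)
  qed
  then show ?thesis using that by blast
qed

section \<open>Convolutions with the semigroup and the Duhamel equation\<close>

context banach_semigroup
begin

definition convolution :: "(real \<Rightarrow> 'x) \<Rightarrow> real \<Rightarrow> 'x" where
  "convolution f t = integral {0..t} (\<lambda>s. T (t - s) (f s))"

lemma has_integral_convolution':
  assumes "continuous_on {0..} f" "0 \<le> a"
  shows "((\<lambda>s. T (t - s) (f s)) has_integral integral {a..t} (\<lambda>s. T (t - s) (f s))) {a..t}"
  by (intro has_integral_convolution continuous_on_subset[OF assms(1)]) (use assms in auto)

text \<open>The substitution \<open>s = t * r\<close> moves the integral to the fixed interval
  \<open>{0..1}\<close>, where continuity in a parameter applies.\<close>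

lemma continuous_on_convolution:
  assumes f: "continuous_on {0..} f"
  shows "continuous_on {0..} (convolution f)"
proof -
  have "continuous_on ({0..} \<times> cbox 0 1) (\<lambda>(t, r). t *\<^sub>R T (t - t * r) (f (t * r)))"
    unfolding case_prod_beta
    by (intro continuous_on_scaleR continuous_on_T continuous_intros continuous_on_compose2[OF f])
      (auto simp: mult_left_le)
  then have *: "continuous_on {0..} (\<lambda>t. integral (cbox 0 1) (\<lambda>r. t *\<^sub>R T (t - t * r) (f (t * r))))"
    by (rule integral_continuous_on_param)
  have "integral (cbox 0 1) (\<lambda>r. t *\<^sub>R T (t - t * r) (f (t * r))) = convolution f t" if "t \<in> {0..}" for t
  proof (cases "t = 0")
    case False
    then have t: "t > 0" using that by simp
    have "((\<lambda>s. T (t - s) (f s)) has_integral convolution f t) (cbox 0 t)"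
      using has_integral_convolution'[OF f, of 0 t] by (simp add: convolution_def)
    from has_integral_cmul[OF has_integral_affinity'[OF this t, of 0], of t]
    show ?thesis using t by (intro integral_unique) simp
  qed (simp add: convolution_def)
  with * show ?thesis by (rule continuous_on_eq)
qed

lemma convolution_diff:
  assumes "continuous_on {0..} f" "continuous_on {0..} g"
  shows "convolution (\<lambda>s. f s - g s) t = convolution f t - convolution g t"
proof -
  have "((\<lambda>s. T (t - s) (f s - g s)) has_integral convolution f t - convolution g t) {0..t}"
    unfolding convolution_def
    by (rule has_integral_eq[OF _ has_integral_diff[OF has_integral_convolution'[OF assms(1) order_refl]
            has_integral_convolution'[OF assms(2) order_refl]]]) (simp add: T_diff)
  then show ?thesis by (simp add: convolution_def integral_unique)
qed

lemma convolution_add: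
  assumes "continuous_on {0..} f" "continuous_on {0..} g"
  shows "convolution (\<lambda>s. f s + g s) t = convolution f t + convolution g t"
proof -
  have "((\<lambda>s. T (t - s) (f s + g s)) has_integral convolution f t + convolution g t) {0..t}"
    unfolding convolution_def
    by (rule has_integral_eq[OF _ has_integral_add[OF has_integral_convolution'[OF assms(1) order_refl]
            has_integral_convolution'[OF assms(2) order_refl]]]) (simp add: T_plus)
  then show ?thesis by (simp add: convolution_def integral_unique)
qed

lemma norm_convolution_le:
  assumes f: "continuous_on {0..} f" and g: "continuous_on {0..t} g"
    and M: "\<And>s z. s \<in> {0..t} \<Longrightarrow> norm (T s z) \<le> M * norm z" "0 \<le> M"
    and fg: "\<And>s. s \<in> {0..t} \<Longrightarrow> norm (f s) \<le> g s"
  shows "norm (convolution f t) \<le> M * integral {0..t} g"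
proof -
  have "norm (integral {0..t} (\<lambda>s. T (t - s) (f s))) \<le> integral {0..t} (\<lambda>s. M * g s)"
  proof (rule Henstock_Kurzweil_Integration.integral_norm_bound_integral)
    show "(\<lambda>s. T (t - s) (f s)) integrable_on {0..t}"
      using has_integral_convolution'[OF f order_refl] by blast
    show "(\<lambda>s. M * g s) integrable_on {0..t}" by (intro integrable_continuous_interval continuous_intros g)
    fix s assume s: "s \<in> {0..t}"
    have "norm (T (t - s) (f s)) \<le> M * norm (f s)" using s by (intro M) auto
    also have "\<dots> \<le> M * g s" using fg[OF s] M by (intro mult_left_mono) auto
    finally show "norm (T (t - s) (f s)) \<le> M * g s" .
  qed
  then show ?thesis by (simp add: convolution_def)
qed

context
  fixes P :: "'x \<Rightarrow> 'x"
  assumes P: "bounded_linear P"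
begin

lemma continuous_on_P: "continuous_on A f \<Longrightarrow> continuous_on A (\<lambda>s. P (f s))"
  by (rule bounded_linear.continuous_on[OF P])

definition solves :: "'x \<Rightarrow> (real \<Rightarrow> 'x) \<Rightarrow> bool" where
  "solves x Z \<longleftrightarrow> continuous_on {0..} Z \<and> (\<forall>t\<ge>0. Z t = T t x + convolution (\<lambda>s. P (Z s)) t)"

text \<open>An inequality instead of the equation, to serve twice: with \<open>a = 0\<close> for the
  difference of two solutions, and with \<open>a = M * norm x\<close> for the boundedness of the
  solution operator.\<close>

lemma solution_bound:
  assumes Z: "continuous_on {0..} Z" and le: "\<And>t. t \<in> {0..b} \<Longrightarrow> norm (Z t) \<le> a + norm (convolution (\<lambda>s. P (Z s)) t)"
    and M: "\<And>s z. s \<in> {0..b} \<Longrightarrow> norm (T s z) \<le> M * norm z" "0 \<le> M"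
    and p: "\<And>z. norm (P z) \<le> p * norm z" "0 \<le> p" and t: "t \<in> {0..b}"
  shows "norm (Z t) \<le> a * exp (M * p * t)"
proof (rule gronwall[of b])
  have Zb: "continuous_on {0..s} Z" for s by (rule continuous_on_subset[OF Z]) auto
  show "continuous_on {0..b} (\<lambda>t. norm (Z t))" by (intro continuous_intros Zb)
  fix t assume t: "t \<in> {0..b}"
  have "norm (convolution (\<lambda>s. P (Z s)) t) \<le> M * integral {0..t} (\<lambda>s. p * norm (Z s))"
    using t by (intro norm_convolution_le continuous_on_P Z M p continuous_intros Zb) auto
  then show "norm (Z t) \<le> a + M * p * integral {0..t} (\<lambda>s. norm (Z s))"
    using le[OF t] by (simp add: mult.assoc)
qed (use M p t in auto)

lemma P_bound: obtains p where "p > 0" "\<And>z. norm (P z) \<le> p * norm z"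
  using bounded_linear.pos_bounded[OF P] by (auto simp: mult.commute)

lemma P_simps: "P (x + y) = P x + P y" "P (x - y) = P x - P y" "P 0 = 0"
  using bounded_linear.linear[OF P] by (auto simp: linear_add linear_diff linear_0)

lemma solution_unique:
  assumes "solves x Y" "solves x Z" "0 \<le> t"
  shows "Y t = Z t"
proof -
  obtain M where M: "M \<ge> 1" "\<And>s z. s \<in> {0..t} \<Longrightarrow> norm (T s z) \<le> M * norm z"
    using T_bounded_on_interval by blast
  obtain p where p: "p > 0" "\<And>z. norm (P z) \<le> p * norm z" using P_bound by blast
  have YZ: "continuous_on {0..} Y" "continuous_on {0..} Z" using assms by (auto simp: solves_def)
  have "norm (Y t - Z t) \<le> 0 * exp (M * p * t)"
  proof (rule solution_bound)
    show "continuous_on {0..} (\<lambda>t. Y t - Z t)" by (intro continuous_intros YZ)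
    fix s assume s: "s \<in> {0..t}"
    have "Y s - Z s = convolution (\<lambda>r. P (Y r)) s - convolution (\<lambda>r. P (Z r)) s"
      using assms s by (simp add: solves_def)
    also have "\<dots> = convolution (\<lambda>r. P (Y r) - P (Z r)) s"
      by (intro convolution_diff[symmetric] continuous_on_P YZ)
    finally show "norm (Y s - Z s) \<le> 0 + norm (convolution (\<lambda>r. P (Y r - Z r)) s)"
      by (simp add: P_simps)
  qed (use M p assms in auto)
  then show ?thesis by simp
qed

text \<open>The terms of the Dyson-Phillips series, whose sum is the solution.\<close>

fun dyson :: "'x \<Rightarrow> nat \<Rightarrow> real \<Rightarrow> 'x" where
  "dyson x 0 = (\<lambda>t. T t x)"
| "dyson x (Suc n) = convolution (\<lambda>s. P (dyson x n s))"

lemma continuous_on_dyson: "continuous_on {0..} (dyson x n)"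
  by (induction n) (auto intro!: continuous_on_orbit continuous_on_convolution continuous_on_P)

text \<open>The weight \<open>exp (2 * (M * p) * t)\<close> makes each iteration gain a factor \<open>1 / 2\<close>.\<close>

lemma dyson_bound:
  assumes M: "\<And>s z. s \<in> {0..b} \<Longrightarrow> norm (T s z) \<le> M * norm z" "0 \<le> M"
    and p: "\<And>z. norm (P z) \<le> p * norm z" "0 < p"
    and t: "t \<in> {0..b}"
  shows "norm (dyson x n t) \<le> M * norm x * exp (2 * (M * p) * t) / 2 ^ n"
  using t
proof (induction n arbitrary: t)
  case 0
  have "norm (T t x) \<le> M * norm x * 1" using M 0 by simp
  also have "\<dots> \<le> M * norm x * exp (2 * (M * p) * t)"
    using M p 0 by (intro mult_left_mono) auto
  finally show ?case by simp
next
  case (Suc n)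
  let ?k = "M * p" and ?C = "M * norm x / 2 ^ n"
  define g where "g s = p * (?C * exp (2 * ?k * s))" for s
  have gi: "((\<lambda>s. M * g s) has_integral ?C * exp (2 * ?k * t) / 2 - ?C * exp (2 * ?k * 0) / 2) {0..t}"
  proof (rule fundamental_theorem_of_calculus)
    fix s
    have "((\<lambda>s. ?C * exp (2 * ?k * s) / 2) has_real_derivative M * g s) (at s within {0..t})"
      unfolding g_def by (auto intro!: derivative_eq_intros)
    then show "((\<lambda>s. ?C * exp (2 * ?k * s) / 2) has_vector_derivative M * g s) (at s within {0..t})"
      by (simp add: has_real_derivative_iff_has_vector_derivative)
  qed (use Suc.prems in simp)
  have "norm (convolution (\<lambda>s. P (dyson x n s)) t) \<le> M * integral {0..t} g"
  proof (rule norm_convolution_le)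
    show "continuous_on {0..} (\<lambda>s. P (dyson x n s))" by (intro continuous_on_P continuous_on_dyson)
    show "continuous_on {0..t} g" unfolding g_def by (intro continuous_intros)
    fix s assume "s \<in> {0..t}"
    then have "norm (dyson x n s) \<le> ?C * exp (2 * ?k * s)" using Suc by auto
    then show "norm (P (dyson x n s)) \<le> g s"
      unfolding g_def using p by (intro order_trans[OF p(1)] mult_left_mono) auto
  qed (use M Suc.prems in auto)
  also have "\<dots> = integral {0..t} (\<lambda>s. M * g s)" by simp
  also have "\<dots> \<le> ?C * exp (2 * ?k * t) / 2" using integral_unique[OF gi] M by simp
  finally show ?case by (simp add: mult.commute)
qed

lemma solution_exists: "\<exists>Z. solves x Z"
proof -
  define Z where "Z t = (\<Sum>n. dyson x n t)" for t
  obtain p where p: "p > 0" "\<And>z. norm (P z) \<le> p * norm z" using P_bound by blast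
  have ul: "uniform_limit {0..b} (\<lambda>N t. \<Sum>n<N. dyson x n t) Z sequentially" if b: "0 \<le> b" for b
  proof -
    obtain M where M: "M \<ge> 1" "\<And>s z. s \<in> {0..b} \<Longrightarrow> norm (T s z) \<le> M * norm z"
      using T_bounded_on_interval by blast
    show ?thesis
      unfolding Z_def
    proof (rule Weierstrass_m_test)
      fix n t assume t: "t \<in> {0..b}"
      have "norm (dyson x n t) \<le> M * norm x * exp (2 * (M * p) * t) / 2 ^ n"
        using M p t by (intro dyson_bound[of b]) auto
      also have "\<dots> \<le> M * norm x * exp (2 * (M * p) * b) / 2 ^ n"
        using M p t by (intro divide_right_mono mult_left_mono) auto
      finally show "norm (dyson x n t) \<le> M * norm x * exp (2 * (M * p) * b) * (1 / 2) ^ n"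
        by (simp add: power_divide)
    next
      show "summable (\<lambda>n. M * norm x * exp (2 * (M * p) * b) * (1 / 2 :: real) ^ n)"
        by (intro summable_mult summable_geometric) simp
    qed
  qed
  have cS: "continuous_on {0..} (\<lambda>t. \<Sum>n<N. dyson x n t)" for N
    by (intro continuous_intros continuous_on_dyson)
  have Zb: "continuous_on {0..b} Z" for b
  proof (cases "0 \<le> b")
    case True
    show ?thesis
      by (rule uniform_limit_theorem[OF _ ul[OF True]])
        (auto intro!: always_eventually continuous_on_subset[OF cS])
  qed auto
  have cZ: "continuous_on {0..} Z"
    unfolding continuous_on_def
  proof
    fix t :: real assume t: "t \<in> {0..}"
    then have "(Z \<longlongrightarrow> Z t) (at t within {0..t + 1})"
      using Zb[of "t + 1"] by (auto simp: continuous_on_def)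
    moreover have "at t within {0..t + 1} = at t within {0..}"
      by (rule at_within_nhd[of _ "{..<t + 1}"]) auto
    ultimately show "(Z \<longlongrightarrow> Z t) (at t within {0..})" by simp
  qed
  \<comment> \<open>The partial sums are Picard iterates: there is one more term on the left than
    under the convolution, and the limit of both sides is the Duhamel equation.\<close>
  have partial: "(\<Sum>n<Suc N. dyson x n t) = T t x + convolution (\<lambda>s. P (\<Sum>n<N. dyson x n s)) t" for N t
  proof (induction N)
    case 0
    have "convolution (\<lambda>s. 0) t = 0"
      unfolding convolution_def by (intro integral_unique has_integral_is_0) (simp add: T_of_zero)
    then show ?case by (simp add: P_simps)
  next
    case (Suc N)
    have "convolution (\<lambda>s. P (\<Sum>n<Suc N. dyson x n s)) t =
        convolution (\<lambda>s. P (\<Sum>n<N. dyson x n s)) t + convolution (\<lambda>s. P (dyson x N s)) t"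
      by (simp add: P_simps) (intro convolution_add continuous_on_P cS continuous_on_dyson)
    then show ?case using Suc by simp
  qed
  have "Z t = T t x + convolution (\<lambda>s. P (Z s)) t" if t: "0 \<le> t" for t
  proof -
    obtain M where M: "M \<ge> 1" "\<And>s z. s \<in> {0..t} \<Longrightarrow> norm (T s z) \<le> M * norm z"
      using T_bounded_on_interval by blast
    have "(\<lambda>N. convolution (\<lambda>s. P (\<Sum>n<N. dyson x n s)) t) \<longlonglongrightarrow> convolution (\<lambda>s. P (Z s)) t"
    proof (rule LIMSEQ_I)
      fix r :: real assume r: "r > 0"
      define e where "e = r / (M * p * (t + 1))"
      have e: "e > 0" using r M p t by (simp add: e_def)
      have "M * p * t * e < M * p * (t + 1) * e" using M p e by simp
      also have "\<dots> = r" using M p t by (simp add: e_def)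
      finally have er: "M * p * t * e < r" .
      have "\<forall>\<^sub>F N in sequentially. \<forall>s\<in>{0..t}. dist (\<Sum>n<N. dyson x n s) (Z s) < e"
        using ul[OF t] e by (simp add: uniform_limit_iff)
      then obtain N0 where N0: "\<And>N s. N \<ge> N0 \<Longrightarrow> s \<in> {0..t} \<Longrightarrow> dist (\<Sum>n<N. dyson x n s) (Z s) < e"
        unfolding eventually_sequentially by blast
      have "norm (convolution (\<lambda>s. P (\<Sum>n<N. dyson x n s)) t - convolution (\<lambda>s. P (Z s)) t) < r" if N: "N \<ge> N0" for N
      proof -
        have "convolution (\<lambda>s. P (\<Sum>n<N. dyson x n s)) t - convolution (\<lambda>s. P (Z s)) t =
            convolution (\<lambda>s. P (\<Sum>n<N. dyson x n s) - P (Z s)) t"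
          by (intro convolution_diff[symmetric] continuous_on_P cS cZ)
        also have "norm \<dots> \<le> M * integral {0..t} (\<lambda>s. p * e)"
        proof (rule norm_convolution_le)
          fix s assume s: "s \<in> {0..t}"
          have "norm (P (\<Sum>n<N. dyson x n s) - P (Z s)) \<le> p * norm ((\<Sum>n<N. dyson x n s) - Z s)"
            using p(2)[of "(\<Sum>n<N. dyson x n s) - Z s"] by (simp add: P_simps)
          also have "\<dots> \<le> p * e" using N0[OF N s] p by (intro mult_left_mono) (auto simp: dist_norm)
          finally show "norm (P (\<Sum>n<N. dyson x n s) - P (Z s)) \<le> p * e" .
        qed (use M in \<open>auto intro!: continuous_intros continuous_on_P cS cZ\<close>)
        also have "\<dots> = M * p * t * e" using t by simp
        finally show ?thesis using er by simp
      qed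
      then show "\<exists>N0. \<forall>N\<ge>N0. norm (convolution (\<lambda>s. P (\<Sum>n<N. dyson x n s)) t - convolution (\<lambda>s. P (Z s)) t) < r"
        by blast
    qed
    then have "(\<lambda>N. \<Sum>n<Suc N. dyson x n t) \<longlonglongrightarrow> T t x + convolution (\<lambda>s. P (Z s)) t"
      unfolding partial by (intro tendsto_intros)
    moreover have "(\<lambda>N. \<Sum>n<N. dyson x n t) \<longlonglongrightarrow> Z t"
      using tendsto_uniform_limitI[OF ul[OF t], of t] t by simp
    then have "(\<lambda>N. \<Sum>n<Suc N. dyson x n t) \<longlonglongrightarrow> Z t" by (rule LIMSEQ_Suc)
    ultimately show ?thesis by (rule LIMSEQ_unique[rotated])
  qed
  then show ?thesis using cZ unfolding solves_def by blast
qed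

text \<open>The choice affects no value at \<open>t \<ge> 0\<close>, where solutions are
  unique.\<close>

definition perturbed :: "real \<Rightarrow> 'x \<Rightarrow> 'x" where
  "perturbed t x = (SOME Z. solves x Z) t"

lemma solves_perturbed: "solves x (\<lambda>t. perturbed t x)"
  unfolding perturbed_def using someI_ex[OF solution_exists] by simp

lemma perturbed_eqI: "solves x Z \<Longrightarrow> 0 \<le> t \<Longrightarrow> perturbed t x = Z t"
  using solution_unique solves_perturbed by blast

lemma continuous_on_perturbed: "continuous_on {0..} (\<lambda>t. perturbed t x)"
  using solves_perturbed by (simp add: solves_def)

lemma perturbed_eq: "0 \<le> t \<Longrightarrow> perturbed t x = T t x + convolution (\<lambda>s. P (perturbed s x)) t"
  using solves_perturbed[of x] by (simp add: solves_def)

lemma has_integral_perturbed: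
  assumes "0 \<le> t"
  shows "((\<lambda>s. T (t - s) (P (perturbed s x))) has_integral perturbed t x - T t x) {0..t}"
  using has_integral_convolution'[OF continuous_on_P[OF continuous_on_perturbed] order_refl]
    perturbed_eq[OF assms, of x] by (simp add: convolution_def)

text \<open>Both sides solve the equation with initial value \<open>L x\<close>. Applied to real
  multiples and to multiplication by elements of the scalar field.\<close>

lemma perturbed_commute:
  assumes L: "bounded_linear L" and LT: "\<And>t z. 0 \<le> t \<Longrightarrow> T t (L z) = L (T t z)" and LP: "\<And>z. P (L z) = L (P z)"
    and t: "0 \<le> t"
  shows "perturbed t (L x) = L (perturbed t x)"
proof (rule perturbed_eqI[OF _ t])
  have "L (perturbed t x) = T t (L x) + convolution (\<lambda>s. P (L (perturbed s x))) t" if t: "0 \<le> t" for t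
  proof -
    have "((\<lambda>s. L (T (t - s) (P (perturbed s x)))) has_integral L (convolution (\<lambda>s. P (perturbed s x)) t)) {0..t}"
      using has_integral_linear[OF has_integral_convolution'[OF continuous_on_P[OF continuous_on_perturbed[of x]], of 0 t] L]
      by (simp add: o_def convolution_def)
    then have "((\<lambda>s. T (t - s) (P (L (perturbed s x)))) has_integral L (convolution (\<lambda>s. P (perturbed s x)) t)) {0..t}"
      by (rule has_integral_eq[rotated]) (simp add: LT LP)
    then have "convolution (\<lambda>s. P (L (perturbed s x))) t = L (convolution (\<lambda>s. P (perturbed s x)) t)"
      by (simp add: convolution_def integral_unique)
    then show ?thesis
      using perturbed_eq[OF t, of x] linear_add[OF bounded_linear.linear[OF L]] LT[OF t, of x] by simp
  qed
  then show "solves (L x) (\<lambda>t. L (perturbed t x))"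
    unfolding solves_def by (auto intro!: bounded_linear.continuous_on[OF L] continuous_on_perturbed)
qed

lemma perturbed_plus:
  assumes "0 \<le> t"
  shows "perturbed t (x + y) = perturbed t x + perturbed t y"
proof (rule perturbed_eqI[OF _ assms])
  show "solves (x + y) (\<lambda>t. perturbed t x + perturbed t y)"
    unfolding solves_def
  proof (intro conjI allI impI)
    show "continuous_on {0..} (\<lambda>t. perturbed t x + perturbed t y)"
      by (intro continuous_intros continuous_on_perturbed)
    fix t :: real assume t: "0 \<le> t"
    have "convolution (\<lambda>s. P (perturbed s x + perturbed s y)) t =
        convolution (\<lambda>s. P (perturbed s x)) t + convolution (\<lambda>s. P (perturbed s y)) t"
      unfolding P_simps by (intro convolution_add continuous_on_P continuous_on_perturbed)
    then show "perturbed t x + perturbed t y = T t (x + y) + convolution (\<lambda>s. P (perturbed s x + perturbed s y)) t"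
      using perturbed_eq[OF t, of x] perturbed_eq[OF t, of y] t by (simp add: T_plus)
  qed
qed

lemma bounded_linear_perturbed:
  assumes t: "0 \<le> t"
  shows "bounded_linear (perturbed t)"
proof -
  obtain M where M: "M \<ge> 1" "\<And>s z. s \<in> {0..t} \<Longrightarrow> norm (T s z) \<le> M * norm z"
    using T_bounded_on_interval by blast
  obtain p where p: "p > 0" "\<And>z. norm (P z) \<le> p * norm z" using P_bound by blast
  show ?thesis
  proof (rule bounded_linear_intro)
    show "perturbed t (x + y) = perturbed t x + perturbed t y" for x y by (rule perturbed_plus[OF t])
    show "perturbed t (r *\<^sub>R x) = r *\<^sub>R perturbed t x" for r x
      using linear_cmul[OF bounded_linear.linear[OF P]]
      by (intro perturbed_commute[OF _ _ _ t]) (auto simp: T_scaleR bounded_linear_scaleR_right)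
    fix x
    have "norm (perturbed t x) \<le> (M * norm x) * exp (M * p * t)"
    proof (rule solution_bound[OF continuous_on_perturbed])
      fix s assume s: "s \<in> {0..t}"
      have "norm (perturbed s x) \<le> norm (T s x) + norm (convolution (\<lambda>s. P (perturbed s x)) s)"
        using perturbed_eq[of s x] s by (metis atLeastAtMost_iff norm_triangle_ineq)
      then show "norm (perturbed s x) \<le> M * norm x + norm (convolution (\<lambda>s. P (perturbed s x)) s)"
        using M(2)[OF s, of x] by linarith
    qed (use M p t in auto)
    then show "norm (perturbed t x) \<le> norm x * (M * exp (M * p * t))" by (simp add: mult_ac)
  qed
qed

text \<open>The shifted solution solves the equation started at \<open>perturbed r x\<close>: the
  convolution up to \<open>t + r\<close> splits at \<open>r\<close>, and its first part is
  \<open>T t\<close> of the convolution up to \<open>r\<close>.\<close>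

lemma perturbed_add:
  assumes r: "0 \<le> r" and t: "0 \<le> t"
  shows "perturbed (t + r) x = perturbed t (perturbed r x)"
proof (rule perturbed_eqI[OF _ t, symmetric])
  have "perturbed (t + r) x = T t (perturbed r x) + convolution (\<lambda>s. P (perturbed (s + r) x)) t" if t: "0 \<le> t" for t
  proof -
    let ?f = "\<lambda>s. P (perturbed s x)"
    have f: "continuous_on {0..} ?f" by (intro continuous_on_P continuous_on_perturbed)
    have "((\<lambda>s. T t (T (r - s) (?f s))) has_integral T t (convolution ?f r)) {0..r}"
      using has_integral_linear[OF has_integral_convolution'[OF f, of 0 r] bounded_linear_T[OF t]]
      by (simp add: o_def convolution_def)
    then have 1: "((\<lambda>s. T (t + r - s) (?f s)) has_integral T t (convolution ?f r)) {0..r}"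
    proof (rule has_integral_eq[rotated])
      fix s assume "s \<in> {0..r}"
      then show "T t (T (r - s) (?f s)) = T (t + r - s) (?f s)"
        using T_add[OF t, of "r - s" "?f s"] by (simp add: algebra_simps)
    qed
    have 2: "((\<lambda>s. T (t + r - s) (?f s)) has_integral integral {r..t + r} (\<lambda>s. T (t + r - s) (?f s))) {r..t + r}"
      by (rule has_integral_convolution'[OF f r])
    have "integral {r..t + r} (\<lambda>s. T (t + r - s) (?f s)) = convolution (\<lambda>s. ?f (s + r)) t"
      using has_integral_shift_real_ivl[OF 2, of r] by (simp add: convolution_def integral_unique)
    moreover have "convolution ?f (t + r) = T t (convolution ?f r) + integral {r..t + r} (\<lambda>s. T (t + r - s) (?f s))"
      using has_integral_combine[OF r _ 1 2] t by (simp add: convolution_def integral_unique)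
    ultimately show ?thesis
      using perturbed_eq[of "t + r" x] perturbed_eq[OF r, of x] r t by (simp add: T_add T_plus)
  qed
  moreover have "continuous_on {0..} (\<lambda>s. perturbed (s + r) x)"
    using r by (intro continuous_on_compose2[OF continuous_on_perturbed] continuous_intros) auto
  ultimately show "solves (perturbed r x) (\<lambda>t. perturbed (t + r) x)" by (auto simp: solves_def)
qed

lemma perturbed_zero: "perturbed 0 x = x"
  using perturbed_eq[of 0 x] by (simp add: convolution_def T_zero)

lemma C0_semigroup_perturbed: "C0_semigroup (*\<^sub>R) perturbed"
  unfolding C0_semigroup_def bounded_operator_def
proof (intro conjI allI impI)
  show "((\<lambda>t. perturbed t x) \<longlongrightarrow> x) (at_right 0)" for x
    using continuous_on_perturbed[of x] unfolding continuous_on_def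
    by (elim ballE[of _ _ 0]) (simp_all add: perturbed_zero at_within_Ici_at_right)
  fix t :: real assume t: "0 \<le> t"
  show bl: "bounded_linear (perturbed t)" using t by (rule bounded_linear_perturbed)
  show "perturbed t (c *\<^sub>R x) = c *\<^sub>R perturbed t x" for c x
    using linear_cmul[OF bounded_linear.linear[OF bl]] by simp
qed (auto simp: perturbed_zero perturbed_add)

text \<open>The difference of the two orbits is an integral whose integrand tends to
  \<open>P x\<close>, and this holds for every \<open>x\<close>, inside or outside the domain of the
  generator. Both the decrease of \<open>V\<close> and the identification of the generator rest on
  it.\<close>

lemma perturbed_derivative: "((\<lambda>h. (perturbed h x - T h x) /\<^sub>R h) \<longlongrightarrow> P x) (at_right 0)"
proof (rule tendstoI)
  fix e :: real assume e: "e > 0"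
  define A where "A = {(h, s). 0 \<le> s \<and> s \<le> (h :: real)}"
  have "continuous_on A (\<lambda>q. T (fst q - snd q) (P (perturbed (snd q) x)))"
    by (intro continuous_on_T continuous_on_P continuous_on_compose2[OF continuous_on_perturbed] continuous_intros)
      (auto simp: A_def)
  then obtain d where d: "d > 0"
    "\<And>q. q \<in> A \<Longrightarrow> dist q (0, 0) < d \<Longrightarrow> dist (T (fst q - snd q) (P (perturbed (snd q) x))) (P x) < e / 2"
    using e unfolding continuous_on_iff
    by (elim ballE[of _ _ "(0, 0)"] allE[of _ "e / 2"]) (auto simp: A_def T_zero perturbed_zero)
  show "\<forall>\<^sub>F h in at_right 0. dist ((perturbed h x - T h x) /\<^sub>R h) (P x) < e"
    unfolding eventually_at_right_field
  proof (intro exI[of _ "d / 2"] conjI allI impI)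
    fix h assume h: "0 < h" "h < d / 2"
    have "((\<lambda>s. T (h - s) (P (perturbed s x)) - P x) has_integral (perturbed h x - T h x) - h *\<^sub>R P x) {0..h}"
      using has_integral_diff[OF has_integral_perturbed[of h x] has_integral_const_real[of "P x" 0 h]] h by simp
    then have "norm ((perturbed h x - T h x) - h *\<^sub>R P x) \<le> (h - 0) * (e / 2)"
    proof (rule has_integral_norm_le)
      fix s assume s: "s \<in> {0..h}"
      have "dist (h, s) (0, 0) \<le> \<bar>h\<bar> + \<bar>s\<bar>"
        by (simp add: dist_Pair_Pair sqrt_sum_squares_le_sum_abs)
      then have "dist (T (h - s) (P (perturbed s x))) (P x) < e / 2"
        using d(2)[of "(h, s)"] s h by (auto simp: A_def)
      then show "norm (T (h - s) (P (perturbed s x)) - P x) \<le> e / 2" by (simp add: dist_norm)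
    qed (use h in simp)
    moreover have "(perturbed h x - T h x) /\<^sub>R h - P x = ((perturbed h x - T h x) - h *\<^sub>R P x) /\<^sub>R h"
      using h by (simp add: scaleR_diff_right)
    ultimately have "norm ((perturbed h x - T h x) /\<^sub>R h - P x) \<le> e / 2"
      using h by (simp only: norm_scaleR abs_inverse abs_of_pos) (simp add: inverse_eq_divide divide_le_eq mult.commute)
    then show "dist ((perturbed h x - T h x) /\<^sub>R h) (P x) < e" using e by (simp add: dist_norm)
  qed (use d in simp)
qed

end

end

section \<open>The closed loop\<close>

lemma (in bounded_quadratic_form) continuous_on_q:
  assumes f: "continuous_on A f"
  shows "continuous_on A (\<lambda>x. q (f x))"
  unfolding continuous_on_def
proof
  fix x assume x: "x \<in> A"
  have f': "(f \<longlongrightarrow> f x) (at x within A)" using f x by (simp add: continuous_on_def)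
  have "((\<lambda>y. q (f y) - q (f x)) \<longlongrightarrow> 0) (at x within A)"
  proof (rule Lim_null_comparison)
    show "\<forall>\<^sub>F y in at x within A. norm (q (f y) - q (f x)) \<le> 2 * C * norm (f y - f x) * norm (f y + f x)"
      using q_diff_bound by (intro always_eventually) simp
    have "((\<lambda>y. 2 * C * norm (f y - f x) * norm (f y + f x)) \<longlongrightarrow> 2 * C * norm (f x - f x) * norm (f x + f x)) (at x within A)"
      by (intro tendsto_intros f')
    then show "((\<lambda>y. 2 * C * norm (f y - f x) * norm (f y + f x)) \<longlongrightarrow> 0) (at x within A)" by simp
  qed
  then show "((\<lambda>x. q (f x)) \<longlongrightarrow> q (f x)) (at x within A)" by (simp add: LIM_zero_iff)
qed

context lq_problem
begin

text \<open>Expand \<open>V\<close> about \<open>T h x\<close>, where \<open>S h x\<close> is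
  \<open>T h x\<close> plus \<open>h\<close> times a vector tending to \<open>B (F x)\<close>. The
  cross term contributes minus twice \<open>h * (norm (F x))\<^sup>2\<close>, the Riccati inequality
  gives this amount back once, and the remaining negative term is discarded.\<close>

lemma closed_loop_decrease:
  assumes F: "\<And>x v. b x (B v) = - (F x \<bullet> v)"
    and der: "((\<lambda>h. (S h x - T h x) /\<^sub>R h) \<longlongrightarrow> B (F x)) (at_right 0)" and \<eta>: "\<eta> > 0"
  shows "\<forall>\<^sub>F h in at_right 0. V (S h x) + h * (norm x)\<^sup>2 \<le> V x + \<eta> * h"
proof -
  let ?F = "at_right (0::real)"
  define D where "D h = (S h x - T h x) /\<^sub>R h" for h
  have D: "(D \<longlongrightarrow> B (F x)) ?F" using der unfolding D_def[abs_def] .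
  have Tx: "((\<lambda>h. T h x) \<longlongrightarrow> x) ?F" by (rule T_tendsto)
  have id0: "((\<lambda>h. h) \<longlongrightarrow> 0) ?F" by (rule tendsto_ident_at)
  have 1: "((\<lambda>h. b x (D h)) \<longlongrightarrow> b x (B (F x))) ?F"
    by (rule bounded_linear.tendsto[OF V.bounded_linear_polar D])
  have 2: "((\<lambda>h. b (T h x - x) (D h)) \<longlongrightarrow> 0) ?F"
  proof (rule Lim_null_comparison)
    show "\<forall>\<^sub>F h in ?F. norm (b (T h x - x) (D h)) \<le> 2 * K * norm (T h x - x) * norm (D h)"
      using V.polar_bound by (intro always_eventually) simp
    have "((\<lambda>h. 2 * K * norm (T h x - x) * norm (D h)) \<longlongrightarrow> 2 * K * norm (x - x) * norm (B (F x))) ?F"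
      by (intro tendsto_intros Tx D)
    then show "((\<lambda>h. 2 * K * norm (T h x - x) * norm (D h)) \<longlongrightarrow> 0) ?F" by simp
  qed
  have 3: "((\<lambda>h. h * V (D h)) \<longlongrightarrow> 0) ?F"
  proof (rule Lim_null_comparison)
    show "\<forall>\<^sub>F h in ?F. norm (h * V (D h)) \<le> \<bar>h\<bar> * (K * (norm (D h))\<^sup>2)"
      using V.bound by (intro always_eventually) (simp add: abs_mult mult_left_mono)
    have "((\<lambda>h. \<bar>h\<bar> * (K * (norm (D h))\<^sup>2)) \<longlongrightarrow> \<bar>0\<bar> * (K * (norm (B (F x)))\<^sup>2)) ?F"
      by (intro tendsto_intros id0 D)
    then show "((\<lambda>h. \<bar>h\<bar> * (K * (norm (D h))\<^sup>2)) \<longlongrightarrow> 0) ?F" by simp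
  qed
  have "((\<lambda>h. 2 * (b x (D h) + b (T h x - x) (D h)) + h * V (D h)) \<longlongrightarrow> 2 * (b x (B (F x)) + 0) + 0) ?F"
    by (intro tendsto_intros 1 2 3)
  then have "((\<lambda>h. 2 * (b x (D h) + b (T h x - x) (D h)) + h * V (D h)) \<longlongrightarrow> - 2 * (norm (F x))\<^sup>2) ?F"
    by (simp add: F power2_norm_eq_inner)
  then have "\<forall>\<^sub>F h in ?F. 2 * (b x (D h) + b (T h x - x) (D h)) + h * V (D h) < - 2 * (norm (F x))\<^sup>2 + \<eta> / 2"
    by (rule order_tendstoD(2)) (use \<eta> in simp)
  moreover have "\<forall>\<^sub>F h in ?F. V (T h x) + h * (norm x)\<^sup>2 - h * (norm (F x))\<^sup>2 \<le> V x + \<eta> / 2 * h"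
    by (rule V_riccati_inequality) (use F \<eta> in auto)
  moreover have "\<forall>\<^sub>F h in ?F. h > 0" by (simp add: eventually_at_right_less)
  ultimately show ?thesis
  proof eventually_elim
    case (elim h)
    have "S h x = T h x + h *\<^sub>R D h" using elim(3) by (simp add: D_def)
    then have "V (S h x) = V (T h x) + 2 * b (T h x) (h *\<^sub>R D h) + V (h *\<^sub>R D h)" by (simp add: V.q_add)
    also have "b (T h x) (h *\<^sub>R D h) = h * b (T h x) (D h)"
      using linear_cmul[OF bounded_linear.linear[OF V.bounded_linear_polar]] by simp
    also have "b (T h x) (D h) = b x (D h) + b (T h x - x) (D h)"
      using V.polar_add[of x "T h x - x" "D h"] by simp
    finally have "V (S h x) \<le> V (T h x) + 2 * (h * (b x (D h) + b (T h x - x) (D h))) + h\<^sup>2 * V (D h)"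
      using V_scaleR_le[of h "D h"] by simp
    also have "\<dots> = V (T h x) + h * (2 * (b x (D h) + b (T h x - x) (D h)) + h * V (D h))"
      by (simp add: power2_eq_square algebra_simps)
    also have "\<dots> \<le> V (T h x) + h * (- 2 * (norm (F x))\<^sup>2 + \<eta> / 2)"
      using elim(1,3) by (intro add_left_mono mult_left_mono) auto
    finally have "V (S h x) \<le> V (T h x) - 2 * (h * (norm (F x))\<^sup>2) + \<eta> / 2 * h" by (simp add: algebra_simps)
    moreover have "0 \<le> h * (norm (F x))\<^sup>2" using elim(3) by simp
    moreover have "\<eta> * h = \<eta> / 2 * h + \<eta> / 2 * h" by simp
    ultimately show ?case using elim(2) by linarith
  qed
qed

text \<open>A Datko-type argument: \<open>V\<close> along the orbit plus the accumulated energy is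
  nonincreasing, so the energy is at most \<open>V x\<close>. For \<open>t > 1\<close>, comparing
  \<open>S t x\<close> with the orbit over the last unit of time bounds its squared norm by a
  multiple of that energy.\<close>

lemma closed_loop_bounded:
  assumes S: "C0_semigroup (*\<^sub>R) S" and F: "\<And>x v. b x (B v) = - (F x \<bullet> v)"
    and der: "\<And>x. ((\<lambda>h. (S h x - T h x) /\<^sub>R h) \<longlongrightarrow> B (F x)) (at_right 0)"
  obtains M where "M \<ge> 1" "\<And>t x. 0 \<le> t \<Longrightarrow> norm (S t x) \<le> M * norm x"
proof -
  interpret S: banach_semigroup S by unfold_locales (rule S)
  have cS: "continuous_on {a..c} (\<lambda>s. (norm (S s x))\<^sup>2)" if "0 \<le> a" for a c x
    using that by (intro continuous_intros S.continuous_on_orbit_interval)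
  have Si: "((\<lambda>s. (norm (S s x))\<^sup>2) has_integral integral {a..c} (\<lambda>s. (norm (S s x))\<^sup>2)) {a..c}" if "0 \<le> a" for a c x
    by (intro integrable_integral integrable_continuous_interval cS that)
  have energy: "integral {0..t} (\<lambda>s. (norm (S s x))\<^sup>2) \<le> K * (norm x)\<^sup>2" if t: "0 \<le> t" for t x
  proof -
    let ?\<phi> = "\<lambda>t. V (S t x) + integral {0..t} (\<lambda>s. (norm (S s x))\<^sup>2)"
    have "?\<phi> t \<le> ?\<phi> 0"
    proof (rule right_dini_le[where f = ?\<phi>])
      show "continuous_on {0..t} ?\<phi>"
        by (intro continuous_intros V.continuous_on_q S.continuous_on_orbit_interval
            indefinite_integral_continuous_1 integrable_continuous_interval cS) auto
      fix r \<eta> :: real assume r: "0 \<le> r" and \<eta>: "\<eta> > 0"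
      have "((\<lambda>h. (norm (S h (S r x)))\<^sup>2) \<longlongrightarrow> (norm (S r x))\<^sup>2) (at_right 0)"
        by (intro tendsto_intros S.T_tendsto)
      then have "\<forall>\<^sub>F h in at_right 0. (norm (S h (S r x)))\<^sup>2 < (norm (S r x))\<^sup>2 + \<eta> / 2"
        by (rule order_tendstoD(2)) (use \<eta> in simp)
      then obtain d where d: "d > 0" "\<And>h. 0 < h \<Longrightarrow> h < d \<Longrightarrow> (norm (S h (S r x)))\<^sup>2 < (norm (S r x))\<^sup>2 + \<eta> / 2"
        unfolding eventually_at_right_field by blast
      have "\<forall>\<^sub>F h in at_right 0. 0 < h \<and> h < d"
        unfolding eventually_at_right_field using d(1) by blast
      moreover have "\<forall>\<^sub>F h in at_right 0. V (S h (S r x)) + h * (norm (S r x))\<^sup>2 \<le> V (S r x) + \<eta> / 2 * h"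
        by (rule closed_loop_decrease[OF F der]) (use \<eta> in simp)
      ultimately show "\<forall>\<^sub>F h in at_right 0. ?\<phi> (r + h) \<le> ?\<phi> r + \<eta> * h"
      proof eventually_elim
        case (elim h)
        have "integral {r..r + h} (\<lambda>s. (norm (S s x))\<^sup>2) \<le> ((norm (S r x))\<^sup>2 + \<eta> / 2) * h"
        proof (rule has_integral_le[OF Si[OF r]])
          show "((\<lambda>s. (norm (S r x))\<^sup>2 + \<eta> / 2) has_integral ((norm (S r x))\<^sup>2 + \<eta> / 2) * h) {r..r + h}"
            using has_integral_const_real[of "(norm (S r x))\<^sup>2 + \<eta> / 2" r "r + h"] elim(1) by (simp add: mult.commute)
          fix s assume s: "s \<in> {r..r + h}"
          show "(norm (S s x))\<^sup>2 \<le> (norm (S r x))\<^sup>2 + \<eta> / 2"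
          proof (cases "s = r")
            case False
            have "(norm (S (s - r) (S r x)))\<^sup>2 \<le> (norm (S r x))\<^sup>2 + \<eta> / 2"
              using d(2)[of "s - r"] s elim(1) False by (intro less_imp_le) auto
            then show ?thesis using S.T_add[of "s - r" r x] s r by simp
          qed (use \<eta> in simp)
        qed
        moreover have "integral {0..r + h} (\<lambda>s. (norm (S s x))\<^sup>2) =
            integral {0..r} (\<lambda>s. (norm (S s x))\<^sup>2) + integral {r..r + h} (\<lambda>s. (norm (S s x))\<^sup>2)"
          using has_integral_combine[OF r _ Si Si[OF r], of "r + h" x] elim(1) by (simp add: integral_unique)
        moreover have "S (r + h) x = S h (S r x)" using S.T_add[of h r x] r elim(1) by (simp add: add.commute)
        ultimately show ?case using elim(2) by (simp add: algebra_simps)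
      qed
    qed (rule t)
    then have "integral {0..t} (\<lambda>s. (norm (S s x))\<^sup>2) \<le> V x"
      using V_nonneg[of "S t x"] by (simp add: S.T_zero)
    then show ?thesis using V_le_norm[of x] by linarith
  qed
  obtain M where M: "M \<ge> 1" "\<And>s z. s \<in> {0..1} \<Longrightarrow> norm (S s z) \<le> M * norm z"
    using S.T_bounded_on_interval by blast
  show ?thesis
  \<comment> \<open>\<open>M\<close> serves for times up to 1, and \<open>M * sqrt K\<close> for
    later ones.\<close>
  proof (rule that[of "M * (1 + sqrt K)"])
    show "1 \<le> M * (1 + sqrt K)" using M(1) K mult_mono[of 1 M 1 "1 + sqrt K"] by simp
    fix t :: real and x assume t: "0 \<le> t"
    show "norm (S t x) \<le> M * (1 + sqrt K) * norm x"
    proof (cases "t \<le> 1")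
      case True
      then have "norm (S t x) \<le> M * norm x" using M t by simp
      also have "\<dots> \<le> M * (1 + sqrt K) * norm x" using M K by (intro mult_right_mono) auto
      finally show ?thesis .
    next
      case False
      have "((\<lambda>s. (norm (S t x))\<^sup>2) has_integral (norm (S t x))\<^sup>2) {t - 1..t}"
        using has_integral_const_real[of "(norm (S t x))\<^sup>2" "t - 1" t] by simp
      moreover have "((\<lambda>s. M\<^sup>2 * (norm (S s x))\<^sup>2) has_integral M\<^sup>2 * integral {t - 1..t} (\<lambda>s. (norm (S s x))\<^sup>2)) {t - 1..t}"
        using False by (intro has_integral_mult_right Si) auto
      ultimately have "(norm (S t x))\<^sup>2 \<le> M\<^sup>2 * integral {t - 1..t} (\<lambda>s. (norm (S s x))\<^sup>2)"
      proof (rule has_integral_le)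
        fix s assume s: "s \<in> {t - 1..t}"
        have "S t x = S (t - s) (S s x)" using S.T_add[of "t - s" s x] s False by simp
        then have "norm (S t x) \<le> M * norm (S s x)" using M(2)[of "t - s"] s by simp
        then have "(norm (S t x))\<^sup>2 \<le> (M * norm (S s x))\<^sup>2" by (intro power_mono) auto
        then show "(norm (S t x))\<^sup>2 \<le> M\<^sup>2 * (norm (S s x))\<^sup>2" by (simp add: power_mult_distrib)
      qed
      also have "integral {t - 1..t} (\<lambda>s. (norm (S s x))\<^sup>2) \<le> integral {0..t} (\<lambda>s. (norm (S s x))\<^sup>2)"
        using False by (intro integral_subset_le integrable_continuous_interval cS) auto
      also have "\<dots> \<le> K * (norm x)\<^sup>2" using energy t by blast
      finally have "(norm (S t x))\<^sup>2 \<le> M\<^sup>2 * (K * (norm x)\<^sup>2)" by (simp add: mult_left_mono)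
      also have "\<dots> = (M * sqrt K * norm x)\<^sup>2" using K by (simp add: power_mult_distrib)
      finally have "norm (S t x) \<le> M * sqrt K * norm x"
        by (rule power2_le_imp_le) (use M K in simp)
      also have "\<dots> \<le> M * (1 + sqrt K) * norm x" using M by (intro mult_right_mono mult_left_mono) auto
      finally show ?thesis .
    qed
  qed
qed

end

section \<open>Compatibility with the scalar field, and the exponential shift\<close>

lemma normed_space_overD:
  assumes "normed_space_over sc"
  shows "sc c (x + y) = sc c x + sc c y" "sc c (sc d x) = sc (c * d) x" "sc 1 x = x" "sc 0 x = 0"
    "sc (of_real r) x = r *\<^sub>R x" "norm (sc c x) = norm c * norm x"
proof -
  interpret vector_space sc using assms by (simp add: normed_space_over_def)
  show "sc c (x + y) = sc c x + sc c y" "sc c (sc d x) = sc (c * d) x" "sc 1 x = x" "sc 0 x = 0"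
    by (simp_all add: scale_right_distrib)
  show "sc (of_real r) x = r *\<^sub>R x" "norm (sc c x) = norm c * norm x"
    using assms by (auto simp: normed_space_over_def)
qed

lemma bounded_linear_scalar:
  assumes "normed_space_over sc"
  shows "bounded_linear (sc c)"
proof (rule bounded_linear_intro)
  show "sc c (x + y) = sc c x + sc c y" for x y by (rule normed_space_overD[OF assms])
  show "sc c (r *\<^sub>R x) = r *\<^sub>R sc c x" for r x
  proof -
    have "sc c (r *\<^sub>R x) = sc c (sc (of_real r) x)" by (simp only: normed_space_overD(5)[OF assms])
    also have "\<dots> = sc (of_real r) (sc c x)" by (simp add: normed_space_overD(2)[OF assms] mult.commute)
    also have "\<dots> = r *\<^sub>R sc c x" by (rule normed_space_overD(5)[OF assms])
    finally show ?thesis .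
  qed
  show "norm (sc c x) \<le> norm x * norm c" for x by (simp add: normed_space_overD(6)[OF assms])
qed

text \<open>Polarization, since multiplication by \<open>c\<close> scales every norm by
  \<open>norm c\<close>; the inner product is the real one.\<close>

lemma inner_scalar:
  fixes sc :: "'k::real_normed_field \<Rightarrow> 'a::real_inner \<Rightarrow> 'a"
  assumes "normed_space_over sc"
  shows "sc c x \<bullet> sc c y = (norm c)\<^sup>2 * (x \<bullet> y)"
proof -
  have "sc c x + sc c y = sc c (x + y)" by (simp add: normed_space_overD(1)[OF assms])
  then show ?thesis
    by (simp add: dot_norm normed_space_overD(6)[OF assms] power_mult_distrib algebra_simps diff_divide_distrib add_divide_distrib)
qed

lemma C0_semigroup_real: "C0_semigroup sc T \<Longrightarrow> C0_semigroup (*\<^sub>R) T"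
  unfolding C0_semigroup_def bounded_operator_def
  by (auto simp: linear_cmul bounded_linear.linear)

lemma C0_semigroup_exp:
  assumes "C0_semigroup (*\<^sub>R) T"
  shows "C0_semigroup (*\<^sub>R) (\<lambda>t x. exp (w * t) *\<^sub>R T t x)"
proof -
  have T: "\<And>t. t \<ge> 0 \<Longrightarrow> bounded_linear (T t)" "\<And>x. T 0 x = x" "\<And>s t x. s \<ge> 0 \<Longrightarrow> t \<ge> 0 \<Longrightarrow> T (s + t) x = T s (T t x)"
    "\<And>x. ((\<lambda>t. T t x) \<longlongrightarrow> x) (at_right 0)"
    using assms by (auto simp: C0_semigroup_def bounded_operator_def)
  have lin: "T s (r *\<^sub>R x) = r *\<^sub>R T s x" if "s \<ge> 0" for s r x
    using linear_cmul[OF bounded_linear.linear[OF T(1)[OF that]]] .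
  have "((\<lambda>t. exp (w * t) *\<^sub>R T t x) \<longlongrightarrow> exp (w * 0) *\<^sub>R x) (at_right 0)" for x
    by (intro tendsto_intros T)
  then show ?thesis
    unfolding C0_semigroup_def bounded_operator_def
    by (auto simp: T lin bounded_linear_compose[OF bounded_linear_scaleR_right T(1)] exp_add distrib_left)
qed

text \<open>If \<open>v\<close> is multiplied by \<open>exp (w * s)\<close>, the exponentials under
  the integral combine to \<open>c = exp (w * \<tau>)\<close>, independent of \<open>s\<close>. So
  the end state is multiplied by \<open>c\<close>, and the energy by at most
  \<open>c\<^sup>2\<close>.\<close>

lemma exp_shift_null_controllable:
  fixes T :: "real \<Rightarrow> 'x::{real_inner,banach} \<Rightarrow> 'x" and B :: "'u::real_inner \<Rightarrow> 'x"
    and emb :: "'x \<Rightarrow> 'y::real_normed_vector"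
  assumes T: "C0_semigroup (*\<^sub>R) T" and B: "bounded_linear B"
    and emb: "bounded_linear emb" "\<And>z. emb z = 0 \<Longrightarrow> z = 0" and \<tau>: "\<tau> > 0"
    and null: "\<And>x. \<exists>u\<in>L2 \<tau>. emb (T \<tau> x) + integral {0..\<tau>} (\<lambda>s. emb (T (\<tau> - s) (B (u s)))) = 0"
    and w: "0 \<le> w"
  shows "approx_null_controllable (\<lambda>t x. exp (w * t) *\<^sub>R T t x) B \<tau>"
proof -
  interpret T: banach_semigroup T by unfold_locales (rule T)
  interpret W: input_system "\<lambda>t x. exp (w * t) *\<^sub>R T t x" B
    by (intro input_system.intro banach_semigroup.intro strongly_continuous_semigroup.intro
        input_system_axioms.intro C0_semigroup_exp T B)
  have "\<exists>A. \<forall>e>0. \<exists>v. continuous_on {0..\<tau>} v \<and> integral {0..\<tau>} (\<lambda>s. (norm (v s))\<^sup>2) \<le> A \<and>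
      norm (exp (w * \<tau>) *\<^sub>R T \<tau> x + integral {0..\<tau>} (\<lambda>s. exp (w * (\<tau> - s)) *\<^sub>R T (\<tau> - s) (B (v s)))) \<le> e" for x
  proof -
    obtain u where u: "u \<in> L2 \<tau>" "emb (T \<tau> x) + integral {0..\<tau>} (\<lambda>s. emb (T (\<tau> - s) (B (u s)))) = 0"
      using null by blast
    obtain A where A: "\<And>e. e > 0 \<Longrightarrow> \<exists>v. continuous_on {0..\<tau>} v \<and> integral {0..\<tau>} (\<lambda>s. (norm (v s))\<^sup>2) \<le> A \<and>
        norm (T \<tau> x + integral {0..\<tau>} (\<lambda>s. T (\<tau> - s) (B (v s)))) \<le> e"
      using T.steering_approx[OF B emb \<tau> u] by blast
    define c where "c = exp (w * \<tau>)"
    have c: "c > 0" by (simp add: c_def)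
    have "\<exists>v. continuous_on {0..\<tau>} v \<and> integral {0..\<tau>} (\<lambda>s. (norm (v s))\<^sup>2) \<le> c\<^sup>2 * A \<and>
      norm (c *\<^sub>R T \<tau> x + integral {0..\<tau>} (\<lambda>s. exp (w * (\<tau> - s)) *\<^sub>R T (\<tau> - s) (B (v s)))) \<le> e" if e: "e > 0" for e
    proof -
      have "e / c > 0" using e c by simp
      from A[OF this] obtain v where v: "continuous_on {0..\<tau>} v" "integral {0..\<tau>} (\<lambda>s. (norm (v s))\<^sup>2) \<le> A"
        "norm (T \<tau> x + integral {0..\<tau>} (\<lambda>s. T (\<tau> - s) (B (v s)))) \<le> e / c" by blast
      let ?v = "\<lambda>s. exp (w * s) *\<^sub>R v s" and ?i = "integral {0..\<tau>} (\<lambda>s. T (\<tau> - s) (B (v s)))"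
      have cv: "continuous_on {0..\<tau>} ?v" by (intro continuous_intros v)
      have "((\<lambda>s. T (\<tau> - s) (B (v s))) has_integral ?i) {0..\<tau>}"
        by (intro T.has_integral_convolution bounded_linear.continuous_on[OF B] v)
      from has_integral_cmul[OF this, of c]
      have "((\<lambda>s. exp (w * (\<tau> - s)) *\<^sub>R T (\<tau> - s) (B (?v s))) has_integral c *\<^sub>R ?i) {0..\<tau>}"
      proof (rule has_integral_eq[rotated])
        fix s assume "s \<in> {0..\<tau>}"
        then show "c *\<^sub>R T (\<tau> - s) (B (v s)) = exp (w * (\<tau> - s)) *\<^sub>R T (\<tau> - s) (B (?v s))"
          by (simp add: W.B_simps T.T_scaleR c_def algebra_simps flip: exp_add)
      qed
      then have "c *\<^sub>R T \<tau> x + integral {0..\<tau>} (\<lambda>s. exp (w * (\<tau> - s)) *\<^sub>R T (\<tau> - s) (B (?v s))) =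
          c *\<^sub>R (T \<tau> x + ?i)"
        by (simp add: integral_unique scaleR_add_right)
      moreover have "norm (c *\<^sub>R (T \<tau> x + ?i)) \<le> e" using v(3) c unfolding norm_scaleR by (simp add: pos_le_divide_eq mult.commute)
      moreover have "integral {0..\<tau>} (\<lambda>s. (norm (?v s))\<^sup>2) \<le> c\<^sup>2 * A"
      proof -
        have "integral {0..\<tau>} (\<lambda>s. (norm (?v s))\<^sup>2) \<le> integral {0..\<tau>} (\<lambda>s. c\<^sup>2 * (norm (v s))\<^sup>2)"
        proof (rule integral_le)
          fix s assume s: "s \<in> {0..\<tau>}"
          have "exp (w * s) \<le> c" unfolding c_def using s w by (simp add: mult_left_mono)
          then show "(norm (?v s))\<^sup>2 \<le> c\<^sup>2 * (norm (v s))\<^sup>2"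
            unfolding norm_scaleR power_mult_distrib by (intro mult_right_mono power_mono) auto
        qed (intro integrable_continuous_interval continuous_intros v)+
        also have "\<dots> \<le> c\<^sup>2 * A" using v(2) by (simp add: mult_left_mono)
        finally show ?thesis .
      qed
      ultimately show ?thesis using cv by (intro exI[of _ ?v] conjI) (simp_all only:)
    qed
    then show ?thesis unfolding c_def by (intro exI[of _ "(exp (w * \<tau>))\<^sup>2 * A"] allI impI)
  qed
  then show ?thesis by unfold_locales (use \<tau> in auto)
qed

text \<open>\<open>V\<close> belongs to the shifted semigroup, but the closed loop \<open>S\<close>
  is the perturbation of \<open>T\<close> itself by \<open>B F\<close>. Multiplied by
  \<open>exp (w * t)\<close>, it has the right derivative relative to the shifted semigroup at time
  0, and this is all that \<open>closed_loop_bounded\<close> asks of it.\<close>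

lemma bounded_stabilization:
  fixes scX :: "'k::real_normed_field \<Rightarrow> 'x::{real_inner,banach} \<Rightarrow> 'x"
    and scU :: "'k \<Rightarrow> 'u::{real_inner,complete_space} \<Rightarrow> 'u"
    and emb :: "'x \<Rightarrow> 'y::real_normed_vector"
  assumes nX: "normed_space_over scX" and nU: "normed_space_over scU"
    and T: "C0_semigroup scX T" and B: "bounded_operator scU scX B"
    and emb: "bounded_linear emb" "\<And>z. emb z = 0 \<Longrightarrow> z = 0" and \<tau>: "\<tau> > 0"
    and null: "\<And>x. \<exists>u\<in>L2 \<tau>. emb (T \<tau> x) + integral {0..\<tau>} (\<lambda>s. emb (T (\<tau> - s) (B (u s)))) = 0"
    and w: "0 \<le> w"
  shows "\<exists>F S M. bounded_operator scX scU F \<and> C0_semigroup scX S \<and>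
    (\<forall>t\<ge>0. \<forall>x. ((\<lambda>s. T (t - s) (B (F (S s x)))) has_integral S t x - T t x) {0..t}) \<and>
    (\<forall>x. ((\<lambda>h. (S h x - T h x) /\<^sub>R h) \<longlongrightarrow> B (F x)) (at_right 0)) \<and>
    M \<ge> 1 \<and> (\<forall>t\<ge>0. \<forall>x. norm (S t x) \<le> M * exp (- w * t) * norm x)"
proof -
  have T': "C0_semigroup (*\<^sub>R) T" using T by (rule C0_semigroup_real)
  have B': "bounded_linear B" and Bsc: "\<And>c v. B (scU c v) = scX c (B v)"
    using B by (auto simp: bounded_operator_def)
  have Tsc: "T t (scX c x) = scX c (T t x)" if "0 \<le> t" for t c x
    using T that by (auto simp: C0_semigroup_def bounded_operator_def)
  note blX = bounded_linear_scalar[OF nX] and blU = bounded_linear_scalar[OF nU]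
  note linX = linear_cmul[OF bounded_linear.linear[OF blX]] linear_add[OF bounded_linear.linear[OF blX]]
  interpret T: banach_semigroup T by unfold_locales (rule T')
  let ?T = "\<lambda>t x. exp (w * t) *\<^sub>R T t x"
  interpret A: approx_null_controllable ?T B \<tau>
    by (rule exp_shift_null_controllable[OF T' B' emb \<tau> null w])
  obtain K where K: "K \<ge> 0"
    "\<And>x d. \<tau> \<le> d \<Longrightarrow> \<exists>us. valid_control us \<and> duration us = d \<and> A.total_cost K x us \<le> K * (norm x)\<^sup>2"
    using A.contracting_control by blast
  interpret L: lq_problem ?T B \<tau> K by unfold_locales (use \<tau> K in auto)
  have "\<exists>f. \<forall>v. L.b x (B v) = - (f \<bullet> v)" for x
  proof -
    have "bounded_linear (\<lambda>v. - L.b x (B v))"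
      by (intro bounded_linear_minus bounded_linear_compose[OF L.V.bounded_linear_polar B'])
    then obtain f where "\<And>v. - L.b x (B v) = f \<bullet> v" using riesz_representation by blast
    then show ?thesis by (metis minus_equation_iff)
  qed
  then obtain F where F: "\<And>x v. L.b x (B v) = - (F x \<bullet> v)" by metis
  have F_eqI: "F x = f" if "\<And>v. L.b x (B v) = - (f \<bullet> v)" for x f
  proof -
    have "\<forall>v. F x \<bullet> v = f \<bullet> v" using that F by (metis neg_equal_iff_equal)
    then show ?thesis by (simp only: vector_eq_rdot)
  qed
  have V_le: "L.V (scX c x) \<le> (norm c)\<^sup>2 * L.V x" for c x
  proof (rule L.V_scale_le[of "scX c" "scU c"])
    fix x h v assume h: "0 \<le> (h :: real)"
    have "A.orbit_integral h (scX c (B v)) = scX c (A.orbit_integral h (B v))"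
      by (rule A.orbit_integral_commute[OF blX]) (simp add: Tsc linX)
    then show "A.flow (scX c x) h (B (scU c v)) = scX c (A.flow x h (B v))"
      using h by (simp add: A.flow_def Bsc Tsc linX)
  qed (simp_all add: normed_space_overD(6)[OF nX] normed_space_overD(6)[OF nU])
  \<comment> \<open>The inequality for \<open>c\<close> and for \<open>1 / c\<close> gives equality;
    through the polar form it makes the feedback compatible with the scalars.\<close>
  have V_eq: "L.V (scX c x) = (norm c)\<^sup>2 * L.V x" for c x
  proof (cases "c = 0")
    case True
    then show ?thesis by (simp add: normed_space_overD(4)[OF nX] L.V.q_zero)
  next
    case False
    have "L.V x = L.V (scX (1 / c) (scX c x))"
      using False by (simp add: normed_space_overD(2,3)[OF nX])
    also have "\<dots> \<le> (norm (1 / c))\<^sup>2 * L.V (scX c x)" by (rule V_le)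
    finally have "(norm c)\<^sup>2 * L.V x \<le> (norm c)\<^sup>2 * ((norm (1 / c))\<^sup>2 * L.V (scX c x))"
      by (intro mult_left_mono) auto
    also have "\<dots> = L.V (scX c x)" using False by (simp add: norm_divide power_divide)
    finally show ?thesis using V_le[of c x] by simp
  qed
  have b_eq: "L.b (scX c x) (scX c y) = (norm c)\<^sup>2 * L.b x y" for c x y
  proof -
    have "scX c x + scX c y = scX c (x + y)" "scX c x - scX c y = scX c (x - y)"
      using bounded_linear.linear[OF blX] by (simp_all add: linear_add linear_diff)
    then show ?thesis by (simp add: polar_form_def V_eq right_diff_distrib)
  qed
  have F_add: "F (x + y) = F x + F y" for x y
  proof (rule F_eqI)
    fix v
    have "L.b (x + y) (B v) = L.b x (B v) + L.b y (B v)" by (rule L.V.polar_add)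
    also have "\<dots> = - ((F x + F y) \<bullet> v)" by (simp only: F inner_add_left minus_add_distrib)
    finally show "L.b (x + y) (B v) = - ((F x + F y) \<bullet> v)" .
  qed
  have F_sc: "F (scX c x) = scU c (F x)" for c x
  proof (cases "c = 0")
    case True
    have "F 0 = 0" using F_add[of 0 0] by simp
    then show ?thesis using True by (simp add: normed_space_overD(4)[OF nX] normed_space_overD(4)[OF nU])
  next
    case False
    show ?thesis
    proof (rule F_eqI)
      fix v
      \<comment> \<open>Both arguments of the form must carry the factor \<open>c\<close> before
        \<open>b_eq\<close> and \<open>inner_scalar\<close> apply.\<close>
      have v: "v = scU c (scU (1 / c) v)" using False by (simp add: normed_space_overD(2,3)[OF nU])
      have "L.b (scX c x) (B v) = L.b (scX c x) (scX c (B (scU (1 / c) v)))" by (subst v) (simp only: Bsc)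
      also have "\<dots> = - ((norm c)\<^sup>2 * (F x \<bullet> scU (1 / c) v))" by (simp only: b_eq F mult_minus_right)
      also have "\<dots> = - (scU c (F x) \<bullet> scU c (scU (1 / c) v))" by (simp only: inner_scalar[OF nU])
      finally show "L.b (scX c x) (B v) = - (scU c (F x) \<bullet> v)" using v by simp
    qed
  qed
  obtain \<beta> where \<beta>: "\<beta> > 0" "\<And>z. norm (B z) \<le> \<beta> * norm z"
    using bounded_linear.pos_bounded[OF B'] by (auto simp: mult.commute)
  have F_bl: "bounded_linear F"
  proof (rule bounded_linear_intro)
    show "F (x + y) = F x + F y" for x y by (rule F_add)
    show "F (r *\<^sub>R x) = r *\<^sub>R F x" for r x
      using F_sc[of "of_real r" x] by (simp add: normed_space_overD(5)[OF nX] normed_space_overD(5)[OF nU])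
    fix x
    have "norm (F x) * norm (F x) = - L.b x (B (F x))" by (simp add: F power2_norm_eq_inner flip: power2_eq_square)
    also have "\<dots> \<le> 2 * K * norm x * norm (B (F x))" using L.V.polar_bound[of x "B (F x)"] by (simp add: abs_le_iff)
    also have "\<dots> \<le> 2 * K * norm x * (\<beta> * norm (F x))" using K \<beta> by (intro mult_left_mono) auto
    finally have "norm (F x) * norm (F x) \<le> norm x * (2 * K * \<beta>) * norm (F x)" by (simp add: mult_ac)
    then show "norm (F x) \<le> norm x * (2 * K * \<beta>)"
      using K \<beta> by (cases "F x = 0") auto
  qed
  define P where "P x = B (F x)" for x
  have P: "bounded_linear P" unfolding P_def by (rule bounded_linear_compose[OF B' F_bl])
  define S where "S = T.perturbed P"
  have S': "C0_semigroup (*\<^sub>R) S" unfolding S_def by (rule T.C0_semigroup_perturbed[OF P])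
  have Ssc: "S t (scX c x) = scX c (S t x)" if "0 \<le> t" for t c x
    unfolding S_def by (rule T.perturbed_commute[OF P blX _ _ that]) (simp_all add: Tsc P_def F_sc Bsc)
  have S: "C0_semigroup scX S"
    using S' Ssc by (auto simp: C0_semigroup_def bounded_operator_def)
  have der: "((\<lambda>h. (S h x - T h x) /\<^sub>R h) \<longlongrightarrow> P x) (at_right 0)" for x
    unfolding S_def by (rule T.perturbed_derivative[OF P])
  let ?S = "\<lambda>t x. exp (w * t) *\<^sub>R S t x"
  have "((\<lambda>h. (?S h x - ?T h x) /\<^sub>R h) \<longlongrightarrow> B (F x)) (at_right 0)" for x
  proof -
    have "((\<lambda>h. exp (w * h) *\<^sub>R ((S h x - T h x) /\<^sub>R h)) \<longlongrightarrow> exp (w * 0) *\<^sub>R P x) (at_right 0)"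
      by (intro tendsto_intros der)
    moreover have "exp (w * h) *\<^sub>R ((S h x - T h x) /\<^sub>R h) = (?S h x - ?T h x) /\<^sub>R h" for h
      by (simp add: scaleR_diff_right mult.commute)
    ultimately show ?thesis by (simp add: P_def)
  qed
  then obtain M where M: "M \<ge> 1" "\<And>t x. 0 \<le> t \<Longrightarrow> norm (?S t x) \<le> M * norm x"
    using L.closed_loop_bounded[OF C0_semigroup_exp[OF S'] F] by blast
  have "norm (S t x) \<le> M * exp (- w * t) * norm x" if "0 \<le> t" for t x
  proof -
    have "exp (- w * t) * (exp (w * t) * norm (S t x)) \<le> exp (- w * t) * (M * norm x)"
      using M(2)[OF that, of x] by (intro mult_left_mono) auto
    then show ?thesis by (simp add: mult_ac flip: exp_add mult.assoc)
  qed
  moreover have "((\<lambda>s. T (t - s) (B (F (S s x)))) has_integral S t x - T t x) {0..t}" if "0 \<le> t" for t x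
    using T.has_integral_perturbed[OF P that, of x] by (simp add: S_def P_def)
  moreover have "bounded_operator scX scU F" using F_bl F_sc by (simp add: bounded_operator_def)
  ultimately show ?thesis using S der M(1) unfolding P_def by blast
qed

text \<open>A type variable of the sort \<open>{real_inner, complete_space}\<close> does not belong to the class
  \<open>banach\<close>, on which the integration theory of the library depends, but a copy of the type does.\<close>

datatype 'a copy = Copy (orig: 'a)

instantiation copy :: ("{real_inner,complete_space}") real_inner
begin

definition "0 = Copy 0"
definition "x + y = Copy (orig x + orig y)"
definition "x - y = Copy (orig x - orig y)"
definition "- x = Copy (- orig x)"
definition "r *\<^sub>R x = Copy (r *\<^sub>R orig x)"
definition "x \<bullet> y = orig x \<bullet> orig y"
definition "norm x = norm (orig x)"
definition "dist x y = dist (orig x) (orig y)"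
definition "sgn x = Copy (sgn (orig x))"
definition "(uniformity :: ('a copy \<times> 'a copy) filter) = (INF e\<in>{0 <..}. principal {(x, y). dist x y < e})"
definition "open (S :: 'a copy set) \<longleftrightarrow> (\<forall>x\<in>S. \<forall>\<^sub>F (x', y) in uniformity. x' = x \<longrightarrow> y \<in> S)"

lemmas copy_defs = zero_copy_def plus_copy_def minus_copy_def uminus_copy_def scaleR_copy_def
  inner_copy_def norm_copy_def dist_copy_def sgn_copy_def

instance
  by intro_classes
    (auto simp: copy_defs uniformity_copy_def open_copy_def algebra_simps inner_add_left inner_commute
      dist_norm norm_eq_sqrt_inner sgn_div_norm copy.expand intro: copy.expand)

end

lemma orig_simps [simp]:
  "orig 0 = 0" "orig (x + y) = orig x + orig y" "orig (x - y) = orig x - orig y"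
  "orig (r *\<^sub>R x) = r *\<^sub>R orig x" "norm (orig x) = norm x" "norm (Copy z) = norm z"
  by (simp_all add: copy_defs)

instance copy :: ("{real_inner,complete_space}") complete_space
proof
  fix X :: "nat \<Rightarrow> 'a copy" assume "Cauchy X"
  then have "Cauchy (\<lambda>n. orig (X n))" by (simp add: Cauchy_def dist_copy_def)
  then obtain l where "(\<lambda>n. orig (X n)) \<longlonglongrightarrow> l" using Cauchy_convergent convergent_def by blast
  then have "X \<longlonglongrightarrow> Copy l" by (simp add: tendsto_iff dist_copy_def)
  then show "convergent X" by (rule convergentI)
qed

instance copy :: ("{real_inner,complete_space}") banach ..

lemma bounded_linear_orig: "bounded_linear orig"
  by (rule bounded_linear_intro[of _ 1]) auto

lemma bounded_linear_Copy: "bounded_linear Copy"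
  by (rule bounded_linear_intro[of _ 1]) (auto simp: copy_defs)

section \<open>Generators and admissibility\<close>

lemma at_right_zero_nonneg: "\<forall>\<^sub>F h in at_right (0::real). 0 \<le> h"
  using eventually_at_right_less[of "0::real"] by (rule eventually_mono) simp

text \<open>Conjugation by the isometry \<open>Copy\<close> transports the hypotheses to a Banach
  state space and the conclusion back.\<close>

lemma bounded_stabilization_hilbert:
  fixes scX :: "'k::real_normed_field \<Rightarrow> 'x::{real_inner,complete_space} \<Rightarrow> 'x"
    and scU :: "'k \<Rightarrow> 'u::{real_inner,complete_space} \<Rightarrow> 'u"
    and emb :: "'x \<Rightarrow> 'y::real_normed_vector"
  assumes nX: "normed_space_over scX" and nU: "normed_space_over scU"
    and T: "C0_semigroup scX T" and B: "bounded_operator scU scX B"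
    and emb: "bounded_linear emb" "\<And>z. emb z = 0 \<Longrightarrow> z = 0" and \<tau>: "\<tau> > 0"
    and null: "\<And>x. \<exists>u\<in>L2 \<tau>. emb (T \<tau> x) + integral {0..\<tau>} (\<lambda>s. emb (T (\<tau> - s) (B (u s)))) = 0"
    and w: "0 \<le> w"
  shows "\<exists>F S M. bounded_operator scX scU F \<and> C0_semigroup scX S \<and>
    (\<forall>t\<ge>0. \<forall>x. ((\<lambda>s. T (t - s) (B (F (S s x)))) has_integral S t x - T t x) {0..t}) \<and>
    (\<forall>x. ((\<lambda>h. (S h x - T h x) /\<^sub>R h) \<longlongrightarrow> B (F x)) (at_right 0)) \<and>
    M \<ge> 1 \<and> (\<forall>t\<ge>0. \<forall>x. norm (S t x) \<le> M * exp (- w * t) * norm x)"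
proof -
  let ?sc = "\<lambda>c x. Copy (scX c (orig x))" and ?T = "\<lambda>t x. Copy (T t (orig x))"
    and ?B = "\<lambda>v. Copy (B v)" and ?emb = "\<lambda>x. emb (orig x)"
  have conj: "bounded_linear (\<lambda>x. Copy (f (orig x)))" if "bounded_linear f" for f :: "'x \<Rightarrow> 'x"
    by (rule bounded_linear_compose[OF bounded_linear_Copy bounded_linear_compose[OF that bounded_linear_orig]])
  have conj': "bounded_linear (\<lambda>x. orig (f (Copy x)))" if "bounded_linear f" for f :: "'x copy \<Rightarrow> 'x copy"
    by (rule bounded_linear_compose[OF bounded_linear_orig bounded_linear_compose[OF that bounded_linear_Copy]])
  note D = normed_space_overD[OF nX]
  have nC: "normed_space_over ?sc"
  proof -
    have "vector_space scX" using nX by (simp add: normed_space_over_def)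
    then have "vector_space ?sc"
      unfolding vector_space_def by (simp add: copy_defs)
    then show ?thesis by (simp add: normed_space_over_def D scaleR_copy_def)
  qed
  have CT: "C0_semigroup ?sc ?T"
    unfolding C0_semigroup_def bounded_operator_def
  proof (intro conjI allI impI)
    show "bounded_linear (?T t)" if "0 \<le> t" for t
      using T that by (intro conj) (simp add: C0_semigroup_def bounded_operator_def)
    have "((\<lambda>t. T t (orig x)) \<longlongrightarrow> orig x) (at_right 0)" for x
      using T by (simp add: C0_semigroup_def)
    from bounded_linear.tendsto[OF bounded_linear_Copy this]
    show "((\<lambda>t. ?T t x) \<longlongrightarrow> x) (at_right 0)" for x by simp
  qed (use T in \<open>simp_all add: C0_semigroup_def bounded_operator_def\<close>)
  have CB: "bounded_operator scU ?sc ?B"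
    using B bounded_linear_compose[OF bounded_linear_Copy, of B] unfolding bounded_operator_def by simp
  have Cemb: "bounded_linear ?emb" "\<And>z. ?emb z = 0 \<Longrightarrow> z = 0"
    using bounded_linear_compose[OF emb(1) bounded_linear_orig] emb(2) by (auto simp: copy_defs intro: copy.expand)
  have Cnull: "\<exists>u\<in>L2 \<tau>. ?emb (?T \<tau> x) + integral {0..\<tau>} (\<lambda>s. ?emb (?T (\<tau> - s) (?B (u s)))) = 0" for x
    using null[of "orig x"] by simp
  obtain F S M where F: "bounded_operator ?sc scU F" and S: "C0_semigroup ?sc S"
    and int: "\<And>t x. t \<ge> 0 \<Longrightarrow> ((\<lambda>s. ?T (t - s) (?B (F (S s x)))) has_integral S t x - ?T t x) {0..t}"
    and der: "\<And>x. ((\<lambda>h. (S h x - ?T h x) /\<^sub>R h) \<longlongrightarrow> ?B (F x)) (at_right 0)"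
    and M: "M \<ge> 1" "\<And>t x. t \<ge> 0 \<Longrightarrow> norm (S t x) \<le> M * exp (- w * t) * norm x"
    using bounded_stabilization[OF nC nU CT CB Cemb \<tau> Cnull w] by blast
  let ?F = "\<lambda>x. F (Copy x)" and ?S = "\<lambda>t x. orig (S t (Copy x))"
  have "bounded_operator scX scU ?F"
    unfolding bounded_operator_def
  proof (intro conjI allI)
    show "bounded_linear ?F"
      using F by (intro bounded_linear_compose[OF _ bounded_linear_Copy]) (simp add: bounded_operator_def)
    have "F (Copy (scX c (orig z))) = scU c (F z)" for c z using F by (simp add: bounded_operator_def)
    from this[of _ "Copy _"] show "?F (scX c x) = scU c (?F x)" for c x by simp
  qed
  moreover have "C0_semigroup scX ?S"
  proof -
    have "orig (S t (Copy (scX c x))) = scX c (orig (S t (Copy x)))" if "0 \<le> t" for t c x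
    proof -
      have "S t (Copy (scX c (orig (Copy x)))) = Copy (scX c (orig (S t (Copy x))))"
        using S that unfolding C0_semigroup_def bounded_operator_def by blast
      then show ?thesis by simp
    qed
    moreover have "((\<lambda>t. orig (S t (Copy x))) \<longlongrightarrow> orig (Copy x)) (at_right 0)" for x
      using S unfolding C0_semigroup_def by (intro bounded_linear.tendsto[OF bounded_linear_orig]) blast
    ultimately show ?thesis
      using S conj' unfolding C0_semigroup_def bounded_operator_def by simp
  qed
  moreover have "((\<lambda>s. T (t - s) (B (?F (?S s x)))) has_integral ?S t x - T t x) {0..t}" if "t \<ge> 0" for t x
    using has_integral_linear[OF int[OF that, of "Copy x"] bounded_linear_orig] by (simp add: o_def)
  moreover have "((\<lambda>h. (?S h x - T h x) /\<^sub>R h) \<longlongrightarrow> B (?F x)) (at_right 0)" for x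
    using bounded_linear.tendsto[OF bounded_linear_orig der[of "Copy x"]] by simp
  moreover have "norm (?S t x) \<le> M * exp (- w * t) * norm x" if "t \<ge> 0" for t x
    using M(2)[OF that, of "Copy x"] by simp
  ultimately show ?thesis using M(1) by (intro exI[of _ ?F] exI[of _ ?S] exI[of _ M]) simp
qed

section \<open>Generators under bounded perturbation\<close>

lemma gen_tendsto:
  "x \<in> gen_dom T \<Longrightarrow> ((\<lambda>h. (T h x - x) /\<^sub>R h) \<longlongrightarrow> gen T x) (at_right 0)"
  unfolding gen_dom_def gen_def using tendsto_Lim[OF trivial_limit_at_right_real] by fastforce

lemma gen_eqI:
  "((\<lambda>h. (T h x - x) /\<^sub>R h) \<longlongrightarrow> y) (at_right 0) \<Longrightarrow> x \<in> gen_dom T \<and> gen T x = y"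
  unfolding gen_dom_def gen_def using tendsto_Lim[OF trivial_limit_at_right_real] by blast

lemma gen_perturb:
  assumes der: "((\<lambda>h. (S h x - T h x) /\<^sub>R h) \<longlongrightarrow> z) (at_right 0)" and x: "x \<in> gen_dom T"
  shows "x \<in> gen_dom S \<and> gen S x = gen T x + z"
proof (rule gen_eqI)
  have "((\<lambda>h. (T h x - x) /\<^sub>R h + (S h x - T h x) /\<^sub>R h) \<longlongrightarrow> gen T x + z) (at_right 0)"
    by (intro tendsto_add gen_tendsto x der)
  then show "((\<lambda>h. (S h x - x) /\<^sub>R h) \<longlongrightarrow> gen T x + z) (at_right 0)"
    by (simp flip: scaleR_add_right)
qed

lemma gen_semigroup:
  assumes S: "C0_semigroup (*\<^sub>R) S" and t: "0 \<le> t" and x: "x \<in> gen_dom S"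
  shows "S t x \<in> gen_dom S \<and> gen S (S t x) = S t (gen S x)"
proof (rule gen_eqI)
  have bl: "bounded_linear (S t)" and add: "\<And>r. 0 \<le> r \<Longrightarrow> S r (S t x) = S t (S r x)"
    using S t by (auto simp: C0_semigroup_def bounded_operator_def) (metis add.commute)
  note lin = bounded_linear.linear[OF bl]
  have "((\<lambda>h. S t ((S h x - x) /\<^sub>R h)) \<longlongrightarrow> S t (gen S x)) (at_right 0)"
    by (rule bounded_linear.tendsto[OF bl gen_tendsto[OF x]])
  moreover have "\<forall>\<^sub>F h in at_right 0. S t ((S h x - x) /\<^sub>R h) = (S h (S t x) - S t x) /\<^sub>R h"
    using at_right_zero_nonneg by eventually_elim (simp add: add linear_diff[OF lin] linear_cmul[OF lin])
  ultimately show "((\<lambda>h. (S h (S t x) - S t x) /\<^sub>R h) \<longlongrightarrow> S t (gen S x)) (at_right 0)"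
    by (rule Lim_transform_eventually)
qed

lemma gen_diff:
  assumes T: "C0_semigroup (*\<^sub>R) T" and x: "x \<in> gen_dom T" and y: "y \<in> gen_dom T"
  shows "gen T (x - y) = gen T x - gen T y"
proof (rule conjunct2[OF gen_eqI])
  have lin: "linear (T h)" if "0 \<le> h" for h
    using T that by (simp add: C0_semigroup_def bounded_operator_def bounded_linear.linear)
  have "((\<lambda>h. (T h x - x) /\<^sub>R h - (T h y - y) /\<^sub>R h) \<longlongrightarrow> gen T x - gen T y) (at_right 0)"
    by (intro tendsto_diff gen_tendsto x y)
  moreover have "\<forall>\<^sub>F h in at_right 0. (T h x - x) /\<^sub>R h - (T h y - y) /\<^sub>R h = (T h (x - y) - (x - y)) /\<^sub>R h"
    using at_right_zero_nonneg
    by eventually_elim (simp add: linear_diff[OF lin] algebra_simps)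
  ultimately show "((\<lambda>h. (T h (x - y) - (x - y)) /\<^sub>R h) \<longlongrightarrow> gen T x - gen T y) (at_right 0)"
    by (rule Lim_transform_eventually)
qed

text \<open>\<open>S\<close> and \<open>T\<close> have the same generator domain, and the generators
  differ there by \<open>B F\<close>. As \<open>gen S\<close> commutes with \<open>S t\<close>,
  continuity in the graph norm reduces to strong continuity of \<open>S\<close>.\<close>

lemma perturbed_semigroupI:
  fixes T S :: "real \<Rightarrow> 'x::real_normed_vector \<Rightarrow> 'x" and B :: "'u \<Rightarrow> 'x"
  assumes T: "C0_semigroup scX T" and S: "C0_semigroup scX S" and P: "bounded_linear (\<lambda>x. B (F x))"
    and der: "\<And>x. ((\<lambda>h. (S h x - T h x) /\<^sub>R h) \<longlongrightarrow> B (F x)) (at_right 0)"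
    and int: "\<And>t x. t \<ge> 0 \<Longrightarrow> ((\<lambda>s. T (t - s) (B (F (S s x)))) has_integral S t x - T t x) {0..t}"
  shows "perturbed_semigroup scX T B F S"
proof -
  note T' = C0_semigroup_real[OF T] and S' = C0_semigroup_real[OF S]
  have der': "((\<lambda>h. (T h x - S h x) /\<^sub>R h) \<longlongrightarrow> - B (F x)) (at_right 0)" for x
    using tendsto_minus[OF der[of x]] by (simp flip: scaleR_minus_right)
  have genS: "S t x \<in> gen_dom T \<and> gen T (S t x) = S t (gen S x) - B (F (S t x))"
    if t: "0 \<le> t" and x: "x \<in> gen_dom T" for t x
    using gen_perturb[where S = T and T = S, OF der', of "S t x"] gen_semigroup[OF S' t] gen_perturb[where S = S and T = T, OF der x] by auto
  have "((\<lambda>t. norm_X1 T (S t x - x)) \<longlongrightarrow> 0) (at_right 0)" if x: "x \<in> gen_dom T" for x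
  proof -
    have S0: "((\<lambda>t. S t z) \<longlongrightarrow> z) (at_right 0)" for z using S by (simp add: C0_semigroup_def)
    have gx: "gen S x = gen T x + B (F x)" using gen_perturb[where S = S and T = T, OF der x] by blast
    have "((\<lambda>t. norm (S t x - x) + norm (S t (gen S x) - B (F (S t x)) - gen T x)) \<longlongrightarrow>
        norm (x - x) + norm (gen S x - B (F x) - gen T x)) (at_right 0)"
      by (intro tendsto_intros S0 bounded_linear.tendsto[OF P])
    then have "((\<lambda>t. norm (S t x - x) + norm (S t (gen S x) - B (F (S t x)) - gen T x)) \<longlongrightarrow> 0) (at_right 0)"
      by (simp add: gx)
    moreover have "\<forall>\<^sub>F t in at_right 0. norm (S t x - x) + norm (S t (gen S x) - B (F (S t x)) - gen T x) =
        norm_X1 T (S t x - x)"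
      using at_right_zero_nonneg
      by eventually_elim (use genS x gen_diff[OF T'] in \<open>simp add: graph_norm_def\<close>)
    ultimately show ?thesis by (rule Lim_transform_eventually)
  qed
  moreover have "S t x = T t x + integral {0..t} (\<lambda>\<tau>. T (t - \<tau>) (B (F (S \<tau> x))))" if "0 \<le> t" for t x
    using integral_unique[OF int[OF that, of x]] by simp
  ultimately show ?thesis
    unfolding perturbed_semigroup_def using S genS by blast
qed

text \<open>Sampling \<open>f\<close> at the nearest grid point \<open>r n x\<close> not above
  \<open>x\<close> gives simple functions that converge pointwise by continuity.\<close>

lemma continuous_imp_L2:
  fixes f :: "real \<Rightarrow> 'a::real_normed_vector"
  assumes f: "continuous_on {0..1} f"
  shows "f \<in> L2 1"
proof -
  let ?M = "lebesgue_on {0..1::real}"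
  define r where "r n x = real_of_int \<lfloor>real (Suc n) * x\<rfloor> / real (Suc n)" for n x
  have r: "r n x \<in> {0..1}" "dist (r n x) x \<le> 1 / real (Suc n)" if "x \<in> {0..1}" for n x
  proof -
    have "real_of_int \<lfloor>real (Suc n) * x\<rfloor> \<le> real (Suc n) * x" by simp
    also have "\<dots> \<le> real (Suc n) * 1" using that by (intro mult_left_mono) auto
    finally show "r n x \<in> {0..1}" using that by (simp add: r_def divide_le_eq)
    have "r n x - x = (real_of_int \<lfloor>real (Suc n) * x\<rfloor> - real (Suc n) * x) / real (Suc n)"
      by (simp add: r_def diff_divide_distrib del: of_nat_Suc)
    moreover have "\<bar>real_of_int \<lfloor>real (Suc n) * x\<rfloor> - real (Suc n) * x\<bar> \<le> 1" by linarith
    ultimately show "dist (r n x) x \<le> 1 / real (Suc n)"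
      by (simp add: dist_real_def divide_right_mono del: of_nat_Suc)
  qed
  have "simple_function ?M (r n)" for n
  proof (rule simple_function_borel_measurable)
    have "r n ` space ?M \<subseteq> (\<lambda>k. real_of_int k / real (Suc n)) ` {0..int (Suc n)}"
    proof
      fix y assume "y \<in> r n ` space ?M"
      then obtain x where x: "x \<in> {0..1}" "y = r n x" by auto
      then have "0 \<le> \<lfloor>real (Suc n) * x\<rfloor>" by simp
      moreover have "real (Suc n) * x \<le> real (Suc n) * 1" using x(1) by (intro mult_left_mono) auto
      then have "\<lfloor>real (Suc n) * x\<rfloor> \<le> int (Suc n)"
        using floor_mono[of "real (Suc n) * x" "real (Suc n) * 1"] by simp
      ultimately show "y \<in> (\<lambda>k. real_of_int k / real (Suc n)) ` {0..int (Suc n)}"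
        using x(2) unfolding r_def by (intro image_eqI[of _ _ "\<lfloor>real (Suc n) * x\<rfloor>"]) auto
    qed
    then show "finite (r n ` space ?M)" by (rule finite_subset) simp
    have "(\<lambda>x. real_of_int \<lfloor>real (Suc n) * x\<rfloor> / real (Suc n)) \<in> borel_measurable borel" by measurable
    then have "r n \<in> borel_measurable lebesgue"
      unfolding r_def[abs_def] by (intro measurable_completion) simp
    then show "r n \<in> borel_measurable ?M" by (rule measurable_restrict_space1)
  qed
  then have "simple_function ?M (\<lambda>x. f (r n x))" for n by (rule simple_function_compose1)
  moreover have "(\<lambda>n. f (r n x)) \<longlonglongrightarrow> f x" if x: "x \<in> {0..1}" for x
  proof (rule continuous_on_tendsto_compose[OF f])
    have "(\<lambda>n. dist (r n x) x) \<longlonglongrightarrow> 0"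
    proof (rule tendsto_sandwich[OF _ _ tendsto_const LIMSEQ_inverse_real_of_nat])
      show "\<forall>\<^sub>F n in sequentially. dist (r n x) x \<le> inverse (real (Suc n))"
        unfolding inverse_eq_divide by (intro always_eventually allI r(2)[OF x])
    qed simp
    then show "(\<lambda>n. r n x) \<longlonglongrightarrow> x" by (subst tendsto_dist_iff)
  qed (use x r(1)[OF x] in simp_all)
  then have "AE x in ?M. (\<lambda>n. f (r n x)) \<longlonglongrightarrow> f x" by (intro AE_I2) simp
  moreover have "integrable ?M (\<lambda>x. (norm (f x))\<^sup>2)"
    by (intro continuous_imp_integrable_real continuous_intros f)
  ultimately show ?thesis
    unfolding L2_def by (auto intro!: exI[of _ "\<lambda>n x. f (r n x)"])
qed

text \<open>The window \<open>t1 = 1\<close> is used: orbits are bounded and continuous on it, and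
  the graph norm dominates the norm of the space.\<close>

lemma bounded_feedback_admissible:
  fixes T :: "real \<Rightarrow> 'x::{real_normed_vector,complete_space} \<Rightarrow> 'x"
  assumes T: "C0_semigroup scX T" and F: "bounded_operator scX scU F"
  shows "admissible_feedback scX scU T F"
proof -
  interpret T: strongly_continuous_semigroup T
    by (intro strongly_continuous_semigroup.intro C0_semigroup_real[OF T])
  have F': "bounded_linear F" and Fsc: "\<And>c x. F (scX c x) = scU c (F x)"
    using F by (auto simp: bounded_operator_def)
  obtain k where k: "k > 0" "\<And>x. norm (F x) \<le> k * norm x"
    using bounded_linear.pos_bounded[OF F'] by (auto simp: mult.commute)
  obtain M where M: "M \<ge> 1" "\<And>s z. s \<in> {0..1} \<Longrightarrow> norm (T s z) \<le> M * norm z"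
    using T.T_bounded_on_interval by blast
  have L2: "(\<lambda>s. F (T (1 - s) x)) \<in> L2 1 \<and> L2_norm 1 (\<lambda>s. F (T (1 - s) x)) \<le> k * M * norm x" for x
  proof -
    have c: "continuous_on {0..1} (\<lambda>s. F (T (1 - s) x))"
      by (intro bounded_linear.continuous_on[OF F'] T.continuous_on_T continuous_intros) auto
    have "(LINT s|lebesgue_on {0..1}. (norm (F (T (1 - s) x)))\<^sup>2) \<le>
        (LINT s|lebesgue_on {0..1::real}. (k * M * norm x)\<^sup>2)"
    proof (rule integral_mono)
      show "integrable (lebesgue_on {0..1}) (\<lambda>s. (norm (F (T (1 - s) x)))\<^sup>2)"
        by (intro continuous_imp_integrable_real continuous_intros c)
      show "integrable (lebesgue_on {0..1::real}) (\<lambda>s. (k * M * norm x)\<^sup>2)"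
        by (intro continuous_imp_integrable_real continuous_intros)
      fix s assume "s \<in> space (lebesgue_on {0..1::real})"
      then have "norm (T (1 - s) x) \<le> M * norm x" by (intro M) auto
      then have "norm (F (T (1 - s) x)) \<le> k * (M * norm x)"
        using k by (intro order_trans[OF k(2)] mult_left_mono) auto
      then show "(norm (F (T (1 - s) x)))\<^sup>2 \<le> (k * M * norm x)\<^sup>2"
        by (intro power_mono) (auto simp: mult.assoc)
    qed
    also have "\<dots> = (k * M * norm x)\<^sup>2" by (simp add: measure_restrict_space)
    finally have "L2_norm 1 (\<lambda>s. F (T (1 - s) x)) \<le> sqrt ((k * M * norm x)\<^sup>2)"
      unfolding L2_norm_def by (rule real_sqrt_le_mono)
    also have "\<dots> = k * M * norm x" using k M by simp
    finally show ?thesis using continuous_imp_L2[OF c] by simp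
  qed
  have "norm (F x) \<le> k * norm_X1 T x" for x
    using k(1) by (intro order_trans[OF k(2)] mult_left_mono) (auto simp: graph_norm_def)
  moreover have "k * M > 0" using k M by simp
  ultimately show ?thesis
    unfolding admissible_feedback_def
    using linear_add[OF bounded_linear.linear[OF F']] Fsc L2
    by (intro conjI exI[of _ k] exI[of _ "1::real"] exI[of _ "k * M"]) auto
qed

text \<open>The norm of \<open>emb x\<close> is the norm of the resolvent at \<open>x\<close>, and
  the resolvent is both bounded and injective.\<close>

lemma extrapolation_embedding:
  assumes nX: "normed_space_over scaleX" and l: "l \<in> resolvent_set scaleX (gen_dom T) (gen T)"
    and ext: "extrapolation_space scaleX T l scaleY emb"
  shows "bounded_linear emb" and "emb z = 0 \<Longrightarrow> z = 0"
proof -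
  let ?R = "resolvent scaleX (gen_dom T) (gen T) l" and ?g = "\<lambda>x. scaleX l x - gen T x"
  have bij: "bij_betw ?g (gen_dom T) UNIV" and R: "bounded_linear ?R"
    using l by (auto simp: resolvent_set_def bounded_operator_def)
  have nY: "normed_space_over scaleY" and add: "\<And>x y. emb (x + y) = emb x + emb y"
    and sc: "\<And>c x. emb (scaleX c x) = scaleY c (emb x)" and norm: "\<And>x. norm (emb x) = norm (?R x)"
    using ext by (auto simp: extrapolation_space_def is_completion_def)
  obtain k where k: "\<And>x. norm (?R x) \<le> norm x * k" using bounded_linear.bounded[OF R] by blast
  show "bounded_linear emb"
  proof (rule bounded_linear_intro[OF add])
    show "emb (r *\<^sub>R x) = r *\<^sub>R emb x" for r x
      using sc[of "of_real r" x] by (simp add: normed_space_overD(5)[OF nX] normed_space_overD(5)[OF nY])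
    show "norm (emb x) \<le> norm x * k" for x using k norm by simp
  qed
  assume "emb z = 0"
  then have "?R z = 0" using norm[of z] by simp
  moreover have "?R 0 = 0" using bounded_linear.linear[OF R] by (rule linear_0)
  moreover have inv: "?g (?R y) = y" for y
    unfolding resolvent_def using bij by (intro f_inv_into_f) (simp add: bij_betw_def)
  ultimately show "z = 0" using inv[of z] inv[of 0] by metis
qed

theorem corollary2p8:
  fixes scaleX :: "'k::real_normed_field \<Rightarrow> 'x::{real_inner,complete_space} \<Rightarrow> 'x"
    and scaleU :: "'k \<Rightarrow> 'u::{real_inner,complete_space} \<Rightarrow> 'u"
    and scaleY :: "'k \<Rightarrow> 'y::banach \<Rightarrow> 'y"
    and T :: "real \<Rightarrow> 'x \<Rightarrow> 'x"
    and Text :: "real \<Rightarrow> 'y \<Rightarrow> 'y"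
    and B :: "'u \<Rightarrow> 'x"
    and emb :: "'x \<Rightarrow> 'y"
    and l :: 'k
  assumes "normed_space_over scaleX" and "normed_space_over scaleU"
    and "C0_semigroup scaleX T"
    and "admissible_input scaleU scaleX T B"
    and "l \<in> resolvent_set scaleX (gen_dom T) (gen T)"
    and "extrapolation_space scaleX T l scaleY emb"
    and "semigroup_extension scaleY emb T Text"
    and "exactly_null_controllable Text emb B"
  shows "completely_stabilizable_admissible scaleX scaleU T B \<and>
         completely_stabilizable_bounded scaleX scaleU T B"
proof -
  have B: "bounded_operator scaleU scaleX B" using assms(4) by (simp add: admissible_input_def)
  note emb = extrapolation_embedding[OF assms(1,5,6)]
  have Text: "\<And>t x. 0 \<le> t \<Longrightarrow> Text t (emb x) = emb (T t x)"
    using assms(7) by (simp add: semigroup_extension_def)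
  obtain \<tau> where \<tau>: "\<tau> > 0"
    and ctrl: "\<And>y. \<exists>u\<in>L2 \<tau>. Text \<tau> y + integral {0..\<tau>} (\<lambda>s. Text (\<tau> - s) (emb (B (u s)))) = 0"
    using assms(8) unfolding exactly_null_controllable_def by blast
  have null: "\<exists>u\<in>L2 \<tau>. emb (T \<tau> x) + integral {0..\<tau>} (\<lambda>s. emb (T (\<tau> - s) (B (u s)))) = 0" for x
  proof -
    obtain u where "u \<in> L2 \<tau>" "Text \<tau> (emb x) + integral {0..\<tau>} (\<lambda>s. Text (\<tau> - s) (emb (B (u s)))) = 0"
      using ctrl by blast
    moreover have "integral {0..\<tau>} (\<lambda>s. Text (\<tau> - s) (emb (B (u s)))) =
        integral {0..\<tau>} (\<lambda>s. emb (T (\<tau> - s) (B (u s))))"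
      by (intro integral_cong Text) auto
    ultimately show ?thesis using Text[of \<tau> x] \<tau> by auto
  qed
  have main: "\<exists>F S. bounded_operator scaleX scaleU F \<and> admissible_feedback scaleX scaleU T F \<and>
      perturbed_semigroup scaleX T B F S \<and> decays_at_rate S w" if w: "w > 0" for w
  proof -
    obtain F S M where F: "bounded_operator scaleX scaleU F" and S: "C0_semigroup scaleX S"
      and int: "\<And>t x. t \<ge> 0 \<Longrightarrow> ((\<lambda>s. T (t - s) (B (F (S s x)))) has_integral S t x - T t x) {0..t}"
      and der: "\<And>x. ((\<lambda>h. (S h x - T h x) /\<^sub>R h) \<longlongrightarrow> B (F x)) (at_right 0)"
      and M: "M \<ge> 1" "\<And>t x. t \<ge> 0 \<Longrightarrow> norm (S t x) \<le> M * exp (- w * t) * norm x"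
      using bounded_stabilization_hilbert[OF assms(1-3) B emb \<tau> null less_imp_le[OF w]] by blast
    have "bounded_linear (\<lambda>x. B (F x))"
      using B F unfolding bounded_operator_def by (blast intro: bounded_linear_compose)
    then have "perturbed_semigroup scaleX T B F S"
      using assms(3) S der int by (intro perturbed_semigroupI)
    moreover have "decays_at_rate S w"
      unfolding decays_at_rate_def using M by (intro exI[of _ M] conjI allI impI onorm_bound) auto
    ultimately show ?thesis using F bounded_feedback_admissible[OF assms(3) F] by blast
  qed
  then show ?thesis
    unfolding completely_stabilizable_admissible_def completely_stabilizable_bounded_def by blast
qed

end
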